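(* Let $r\ge2$ and let $\check R(z)$ be the normalized $R$-matrix of the $(2r+1)$-dimensional first fundamental representation $\tilde L_1$ of $U_q(\mathrm A_{2r}^{(2)})$, regarded as an operator on $\tilde L_1\otimes\tilde L_1$, where $\tilde L_1\cong L_{\omega_1}$ as a $U_{q^{1/2}}(\mathrm B_r)$-module. In terms of projectors, $$\check{R}(z)=P_{2\omega_1}^q-q^{-2}\frac{1-q^{2}z}{1-q^{-2}z}P_{\omega_2}^q+q^{-2r-1}\frac{1+q^{2r+1}z}{1+q^{-2r-1}z}P_{\omega_0}^q ,$$ where in the case $r=2$ the projector $P_{\omega_2}^q$ is replaced by $P_{2\omega_2}^q$. In terms of matrix units, $$\check{R}(z)=\big(\check{R}(z)\big)_{\mathfrak{sl}_{2r+1}}+\frac{(q-q^{-1})(1-z)}{(q-q^{-1}z)(q^{r+1/2}+q^{-r-1/2}z)}Q(z),$$ where $$\big(\check R(z)\big)_{\mathfrak{sl}_{2r+1}}=\sum_{i=1}^{2r+1} E_{ii}\otimes E_{ii}+\frac{z(q-q^{-1})}{q-q^{-1}z}\sum_{i<j}E_{ii}\otimes E_{jj}+\frac{q-q^{-1}}{q-q^{-1}z}\sum_{i>j}E_{ii}\otimes E_{jj}+\frac{1-z}{q-q^{-1}z}\sum_{i\ne j}E_{ij}\otimes E_{ji},$$ $$Q(z)=z\sum_{i+j<2r+2}\frac{\varepsilon_i^q\varepsilon_j^q}{q^{r+1/2}}E_{ij}\otimes E_{\bar i\,\bar j}-\sum_{i+j>2r+2}\frac{\varepsilon_i^q\varepsilon_j^q}{q^{-r-1/2}}E_{ij}\otimes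 E_{\bar i\,\bar j}-\frac{q^r-q^{-r}z}{q^{1/2}+q^{-1/2}}\sum_{\substack{i+j=2r+2\\ i\ne r+1}}E_{ij}\otimes E_{\bar i\,\bar j}-\frac{q^{r+1}-q^{-r-1}z}{q^{1/2}+q^{-1/2}}E_{r+1,r+1}\otimes E_{r+1,r+1},$$ with all indices running over $1,\dots,2r+1$, $\bar i=2r+2-i$, and $\varepsilon_i^q=(-1)^{r+1-i}q^{r-i+1/2}$, $\varepsilon_{\bar i}^q=\varepsilon_i^{q^{-1}}$ for $1\le i\le r$, $\varepsilon_{r+1}^q=1$.
   Context: Fix $q\in\mathbb C^\times$, not a root of unity, and a square root $q^{1/2}$. $[2]_{1/2}=q^{1/2}+q^{-1/2}$. Algebra. $U_q(\mathrm A_{2r}^{(2)})$ (level zero) is generated by $E_i,F_i,K_i^{\pm1}$, $i=0,\dots,r$, with $d_0=2$, $d_1=\dots=d_{r-1}=1$, $d_r=\frac12$, $q_i=q^{d_i}$, symmetrized Cartan matrix $B$ with $B_{ii}=2d_i$, $B_{01}=-2$, $B_{i,i+1}=-1$ ($1\le i\le r-1$) (symmetric, other entries $0$), Cartan matrix $C_{ij}=B_{ij}/d_i$. Relations: the $K_i$ are invertible and commute, $K_0K_1^2\cdots K_r^2=1$, $K_iE_jK_i^{-1}=q^{B_{ij}}E_j$, $K_iF_jK_i^{-1}=q^{-B_{ij}}F_j$, $[E_i,F_j]=\delta_{ij}\frac{K_i-K_i^{-1}}{q_i-q_i^{-1}}$, and the quantum Serre relations. Coproduct: $\Delta K_i=K_i\otimes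 K_i$, $\Delta E_i=E_i\otimes K_i^{1/2}+K_i^{-1/2}\otimes E_i$, $\Delta F_i=F_i\otimes K_i^{1/2}+K_i^{-1/2}\otimes F_i$, where $K_i^{\pm1/2}$ acts by $q_i^{\pm\lambda_i/2}$ on a vector on which $K_i$ acts by $q_i^{\lambda_i}$. The subalgebra generated by $E_i,F_i,K_i^{\pm1}$, $1\le i\le r$, is $U_{q^{1/2}}(\mathrm B_r)$; $L_\lambda$ is its irreducible (type 1) module of highest weight $\lambda$, $\omega_i$ are the fundamental weights, $\omega_0=0$. First fundamental module. $\tilde L_1(a)$, $a\in\mathbb C^\times$, has basis $v_1,\dots,v_{2r+1}$ with $v_1$ of weight $\omega_1$; the nonzero actions of $F_1,\dots,F_r$ are $F_iv_i=v_{i+1}$, $F_iv_{\overline{i+1}}=v_{\bar i}$ ($1\le i\le r-1$), $F_rv_r=\sqrt{[2]_{1/2}}\,v_{r+1}$, $F_rv_{r+1}=\sqrt{[2]_{1/2}}\,v_{\bar r}$, and $E_i$ is the transpose of $F_i$. $E_{ij}$ are the matrix units, $E_{ij}v_k=\delta_{jk}v_i$. Further, $K_0=q^{-2}E_{11}+\sum_{i=2}^{2r}E_{ii}+q^2E_{2r+1,2r+1}$, $E_0(a)=aE_{2r+1,1}$, and $F_0(a)$ is the transpose of $a^{-2}E_0(a)$. (In terms of Drinfeld polynomials this is the first fundamental module, up to an overall rescaling of $a$ that does not affect $\check R$.) $R$-matrix. $\check R(z)$ is the rational $\mathrm{End}(\tilde L_1\otimes\tilde L_1)$-valued function of $z$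 (the flip composed with the universal $R$-matrix evaluated on $\tilde L_1(z)\otimes\tilde L_1(1)$, normalized) such that for generic $a/b$ the map $\check R(a/b):\tilde L_1(a)\otimes\tilde L_1(b)\to\tilde L_1(b)\otimes\tilde L_1(a)$ is the unique module homomorphism with $v_1\otimes v_1\mapsto v_1\otimes v_1$. Projectors. As $U_{q^{1/2}}(\mathrm B_r)$-modules, $L_{\omega_1}\otimes L_{\omega_1}\cong L_{2\omega_1}\oplus L_{\omega_2}\oplus L_{\omega_0}$ (with $L_{\omega_2}$ replaced by $L_{2\omega_2}$ for $r=2$), and $P^q_\lambda$ is the projector onto $L_\lambda$ along the other summands. *)

theory Defs
  imports "HOL-Analysis.Analysis" "HOL-Computational_Algebra.Polynomial"
begin

section \<open>Matrices over the complex numbers\<close>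

definition smult_mat :: "complex \<Rightarrow> complex^'m^'m \<Rightarrow> complex^'m^'m"  (infixr "*\<^sub>m" 75) where
  "x *\<^sub>m A = (\<chi> i j. x * A $ i $ j)"

text \<open>\<^typ>\<open>complex^('m \<times> 'n)\<close> is the tensor product of \<^typ>\<open>complex^'m\<close> and \<^typ>\<open>complex^'n\<close>.\<close>

definition tensor_mat :: "complex^'m^'m \<Rightarrow> complex^'n^'n \<Rightarrow> complex^('m \<times> 'n)^('m \<times> 'n)"
    (infixr "\<otimes>\<^sub>m" 80) where
  "A \<otimes>\<^sub>m B = (\<chi> p p'. A $ fst p $ fst p' * B $ snd p $ snd p')"

definition tensor_vec :: "complex^'m \<Rightarrow> complex^'n \<Rightarrow> complex^('m \<times> 'n)"
    (infixr "\<otimes>\<^sub>v" 80) where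
  "x \<otimes>\<^sub>v y = (\<chi> p. x $ fst p * y $ snd p)"

text \<open>The space of dimension \<open>2 * r + 1\<close> is \<^typ>\<open>complex^'n\<close>, where the bijection
  \<open>pos\<close> from the index type onto \<open>{1..2*r+1}\<close> numbers the basis vectors \<open>v\<^sub>1, v\<^sub>2, \<dots>\<close>.\<close>

definition basis_vec :: "('n \<Rightarrow> nat) \<Rightarrow> nat \<Rightarrow> complex^'n" where
  "basis_vec pos i = (\<chi> k. if pos k = i then 1 else 0)"

definition mat_unit :: "('n \<Rightarrow> nat) \<Rightarrow> nat \<Rightarrow> nat \<Rightarrow> complex^'n^'n" where
  "mat_unit pos i j = (\<chi> k l. if pos k = i \<and> pos l = j then 1 else 0)"


section \<open>Modules over the quantum affine algebra\<close>

text \<open>Throughout, \<open>s\<close> is the chosen square root of \<open>q\<close>. A module is given on a basis of weight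
  vectors by the actions of \<open>E\<^sub>i\<close> and \<open>F\<^sub>i\<close> (\<open>0 \<le> i \<le> r\<close>) and by integers \<open>wt i k\<close>
  such that \<open>K\<^sub>i\<close> multiplies the \<open>k\<close>-th basis vector by \<open>q\<close> to the power \<open>wt i k\<close>. In terms of
  \<open>q\<^sub>i\<close>, which is \<open>q\<close> to the power \<open>d\<^sub>i\<close>, this eigenvalue is \<open>q\<^sub>i\<close> to the power \<open>\<lambda>\<^sub>i\<close> with
  \<open>wt i k = d\<^sub>i * \<lambda>\<^sub>i\<close>. The defining relations of the algebra are not part of the record:
  homomorphisms and submodules depend on the actions of the generators only.\<close>

record ('m::finite) qmod =
  Eact :: "nat \<Rightarrow> complex^'m^'m"
  Fact :: "nat \<Rightarrow> complex^'m^'m"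
  wt :: "nat \<Rightarrow> 'm \<Rightarrow> int"

text \<open>\<open>Khalf s M i n\<close> is the \<open>n\<close>-th power of the square root of \<open>K\<^sub>i\<close>; so \<open>n = 2\<close> is \<open>K\<^sub>i\<close> itself
  and \<open>n = -2\<close> its inverse.\<close>

definition Khalf :: "complex \<Rightarrow> ('m::finite) qmod \<Rightarrow> nat \<Rightarrow> int \<Rightarrow> complex^'m^'m" where
  "Khalf s M i n = (\<chi> k l. if k = l then s powi (n * wt M i k) else 0)"

definition tensor_qmod :: "complex \<Rightarrow> ('m::finite) qmod \<Rightarrow> ('n::finite) qmod \<Rightarrow> ('m \<times> 'n) qmod" where
  "tensor_qmod s M N =
    \<lparr> Eact = (\<lambda>i. Eact M i \<otimes>\<^sub>m Khalf s N i 1 + Khalf s M i (-1) \<otimes>\<^sub>m Eact N i),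
      Fact = (\<lambda>i. Fact M i \<otimes>\<^sub>m Khalf s N i 1 + Khalf s M i (-1) \<otimes>\<^sub>m Fact N i),
      wt = (\<lambda>i p. wt M i (fst p) + wt N i (snd p)) \<rparr>"

definition qmod_hom ::
  "nat \<Rightarrow> complex \<Rightarrow> ('m::finite) qmod \<Rightarrow> 'm qmod \<Rightarrow> complex^'m^'m \<Rightarrow> bool" where
  "qmod_hom r s M N T \<longleftrightarrow> (\<forall>i\<le>r.
      T ** Eact M i = Eact N i ** T \<and>
      T ** Fact M i = Fact N i ** T \<and>
      T ** Khalf s M i 2 = Khalf s N i 2 ** T)"


section \<open>The first fundamental module\<close>

definition bar :: "nat \<Rightarrow> nat \<Rightarrow> nat" where
  "bar r i = 2 * r + 2 - i"

text \<open>\<open>eps_wt r j k\<close> is the \<open>j\<close>-th coordinate of the weight of \<open>v\<^sub>k\<close> in the orthonormal basis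
  in which the simple roots of \<open>B\<^sub>r\<close> are \<open>\<epsilon>\<^sub>i - \<epsilon>\<^sub>i\<^sub>+\<^sub>1\<close> (\<open>1 \<le> i < r\<close>) and \<open>\<epsilon>\<^sub>r\<close>. The weight of \<open>v\<^sub>1\<close> is
  \<open>\<omega>\<^sub>1 = \<epsilon>\<^sub>1\<close>, and \<open>\<alpha>\<^sub>0 = - 2 \<epsilon>\<^sub>1\<close> at level zero.\<close>

definition eps_wt :: "nat \<Rightarrow> nat \<Rightarrow> nat \<Rightarrow> int" where
  "eps_wt r j k = (if k = j then 1 else if k = bar r j then -1 else 0)"

definition fund_wt :: "nat \<Rightarrow> nat \<Rightarrow> nat \<Rightarrow> int" where
  "fund_wt r i k =
    (if i = 0 then - 2 * eps_wt r 1 k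
     else if i = r then eps_wt r r k
     else eps_wt r i k - eps_wt r (i + 1) k)"

definition fund_F :: "nat \<Rightarrow> complex \<Rightarrow> ('n::finite \<Rightarrow> nat) \<Rightarrow> nat \<Rightarrow> complex^'n^'n" where
  "fund_F r c pos i =
    (if i = r then c *\<^sub>m (mat_unit pos (r + 1) r + mat_unit pos (bar r r) (r + 1))
     else mat_unit pos (i + 1) i + mat_unit pos (bar r i) (bar r (i + 1)))"

definition fund_E0 :: "nat \<Rightarrow> ('n::finite \<Rightarrow> nat) \<Rightarrow> complex \<Rightarrow> complex^'n^'n" where
  "fund_E0 r pos a = a *\<^sub>m mat_unit pos (2 * r + 1) 1"

text \<open>The parameter \<open>c\<close> is the square root of \<open>[2]\<^sub>1\<^sub>/\<^sub>2\<close>, and \<open>a\<close> is the spectral parameter.\<close>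

definition fund_qmod :: "nat \<Rightarrow> complex \<Rightarrow> ('n::finite \<Rightarrow> nat) \<Rightarrow> complex \<Rightarrow> 'n qmod" where
  "fund_qmod r c pos a =
    \<lparr> Eact = (\<lambda>i. if i = 0 then fund_E0 r pos a else transpose (fund_F r c pos i)),
      Fact = (\<lambda>i. if i = 0 then transpose (a powi (-2) *\<^sub>m fund_E0 r pos a) else fund_F r c pos i),
      wt = (\<lambda>i k. fund_wt r i (pos k)) \<rparr>"


section \<open>The normalized R-matrix\<close>

text \<open>A rational function in lowest terms, \<open>N / D\<close>; its values at the poles are irrelevant.\<close>

definition rational_matrix_fun :: "(complex \<Rightarrow> complex^'m^'m) \<Rightarrow> bool" where
  "rational_matrix_fun R \<longleftrightarrow> (\<exists>(D :: complex poly) (N :: 'm \<Rightarrow> 'm \<Rightarrow> complex poly).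
      D \<noteq> 0 \<and>
      (\<forall>z. poly D z = 0 \<longrightarrow> (\<exists>i j. poly (N i j) z \<noteq> 0)) \<and>
      (\<forall>z i j. poly D z \<noteq> 0 \<longrightarrow> R z $ i $ j = poly (N i j) z / poly D z))"

definition normalized_R_matrix ::
  "nat \<Rightarrow> complex \<Rightarrow> complex \<Rightarrow> ('n::finite \<Rightarrow> nat)
    \<Rightarrow> (complex \<Rightarrow> complex^('n \<times> 'n)^('n \<times> 'n)) \<Rightarrow> bool" where
  "normalized_R_matrix r s c pos R \<longleftrightarrow>
    rational_matrix_fun R \<and>
    (\<exists>S. finite S \<and> (\<forall>a b. a \<noteq> 0 \<and> b \<noteq> 0 \<and> a / b \<notin> S \<longrightarrow>
      (\<forall>T. T = R (a / b) \<longleftrightarrow>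
        qmod_hom r s
          (tensor_qmod s (fund_qmod r c pos a) (fund_qmod r c pos b))
          (tensor_qmod s (fund_qmod r c pos b) (fund_qmod r c pos a)) T \<and>
        T *v (basis_vec pos 1 \<otimes>\<^sub>v basis_vec pos 1) = basis_vec pos 1 \<otimes>\<^sub>v basis_vec pos 1)))"


section \<open>Highest weight submodules for the subalgebra of type B\<close>

definition q_sub :: "nat \<Rightarrow> complex \<Rightarrow> nat \<Rightarrow> complex" where
  "q_sub r s i = (if i = 0 then s ^ 4 else if i = r then s else s ^ 2)"

definition B_submodule :: "nat \<Rightarrow> complex \<Rightarrow> ('m::finite) qmod \<Rightarrow> (complex^'m) set \<Rightarrow> bool" where
  "B_submodule r s M W \<longleftrightarrow> vec.subspace W \<and>
    (\<forall>i\<in>{1..r}. \<forall>w\<in>W. Eact M i *v w \<in> W \<and> Fact M i *v w \<in> W \<and>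
      Khalf s M i 2 *v w \<in> W \<and> Khalf s M i (-2) *v w \<in> W)"

text \<open>A dominant weight is given by its coordinates in the fundamental weights.\<close>

definition B_irrep ::
  "nat \<Rightarrow> complex \<Rightarrow> ('m::finite) qmod \<Rightarrow> (nat \<Rightarrow> nat) \<Rightarrow> (complex^'m) set \<Rightarrow> bool" where
  "B_irrep r s M \<mu> W \<longleftrightarrow>
    B_submodule r s M W \<and> W \<noteq> {0} \<and>
    (\<forall>U. B_submodule r s M U \<and> U \<subseteq> W \<longrightarrow> U = {0} \<or> U = W) \<and>
    (\<exists>w\<in>W. w \<noteq> 0 \<and>
      (\<forall>i\<in>{1..r}. Eact M i *v w = 0 \<and> Khalf s M i 2 *v w = (q_sub r s i ^ \<mu> i) *s w))"

definition omega :: "nat \<Rightarrow> nat \<Rightarrow> nat" where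
  "omega j = (\<lambda>i. if i = j \<and> j \<noteq> 0 then 1 else 0)"

text \<open>The highest weight of the quantum exterior square.\<close>

definition ext_wt :: "nat \<Rightarrow> nat \<Rightarrow> nat" where
  "ext_wt r = (if r = 2 then (\<lambda>i. 2 * omega 2 i) else omega 2)"

definition B_decomposition ::
  "nat \<Rightarrow> complex \<Rightarrow> ('m::finite) qmod \<Rightarrow> (nat \<Rightarrow> nat) set
    \<Rightarrow> ((nat \<Rightarrow> nat) \<Rightarrow> (complex^'m) set) \<Rightarrow> bool" where
  "B_decomposition r s M \<Lambda> W \<longleftrightarrow>
    (\<forall>\<mu>\<in>\<Lambda>. B_irrep r s M \<mu> (W \<mu>)) \<and>
    (\<forall>x. \<exists>!f. f \<in> PiE \<Lambda> W \<and> x = (\<Sum>\<mu>\<in>\<Lambda>. f \<mu>))"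

definition B_projector ::
  "nat \<Rightarrow> complex \<Rightarrow> ('m::finite) qmod \<Rightarrow> (nat \<Rightarrow> nat) set \<Rightarrow> (nat \<Rightarrow> nat) \<Rightarrow> complex^'m^'m" where
  "B_projector r s M \<Lambda> \<nu> = (THE P. \<exists>W. B_decomposition r s M \<Lambda> W \<and>
    (\<forall>\<mu>\<in>\<Lambda>. \<forall>x\<in>W \<mu>. P *v x = (if \<mu> = \<nu> then x else 0)))"

text \<open>The spectral parameters do not enter the action of the subalgebra, so both are set to \<open>1\<close>.\<close>

definition proj :: "nat \<Rightarrow> complex \<Rightarrow> complex \<Rightarrow> ('n::finite \<Rightarrow> nat) \<Rightarrow> (nat \<Rightarrow> nat)
    \<Rightarrow> complex^('n \<times> 'n)^('n \<times> 'n)" where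
  "proj r s c pos =
    B_projector r s (tensor_qmod s (fund_qmod r c pos 1) (fund_qmod r c pos 1))
      {\<lambda>i. 2 * omega 1 i, ext_wt r, omega 0}"


section \<open>The operators in terms of matrix units\<close>

definition R_sl :: "nat \<Rightarrow> complex \<Rightarrow> ('n::finite \<Rightarrow> nat) \<Rightarrow> complex
    \<Rightarrow> complex^('n \<times> 'n)^('n \<times> 'n)" where
  "R_sl r q pos z = (let I = {1..2*r+1}; E = mat_unit pos in
      (\<Sum>i\<in>I. E i i \<otimes>\<^sub>m E i i)
    + (z * (q - inverse q) / (q - inverse q * z)) *\<^sub>m
        (\<Sum>(i, j)\<in>{(i, j)\<in>I \<times> I. i < j}. E i i \<otimes>\<^sub>m E j j)
    + ((q - inverse q) / (q - inverse q * z)) *\<^sub>m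
        (\<Sum>(i, j)\<in>{(i, j)\<in>I \<times> I. i > j}. E i i \<otimes>\<^sub>m E j j)
    + ((1 - z) / (q - inverse q * z)) *\<^sub>m
        (\<Sum>(i, j)\<in>{(i, j)\<in>I \<times> I. i \<noteq> j}. E i j \<otimes>\<^sub>m E j i))"

text \<open>\<open>eps_low\<close> is for \<open>1 \<le> i \<le> r\<close>; replacing \<open>q\<close> by its inverse replaces \<open>s\<close> by its inverse.\<close>

definition eps_low :: "nat \<Rightarrow> complex \<Rightarrow> nat \<Rightarrow> complex" where
  "eps_low r s i = (-1) ^ (r + 1 - i) * s ^ (2 * (r - i) + 1)"

definition eps_q :: "nat \<Rightarrow> complex \<Rightarrow> nat \<Rightarrow> complex" where
  "eps_q r s i =
    (if i \<le> r then eps_low r s i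
     else if i = r + 1 then 1
     else eps_low r (inverse s) (bar r i))"

definition Q_mat :: "nat \<Rightarrow> complex \<Rightarrow> complex \<Rightarrow> ('n::finite \<Rightarrow> nat) \<Rightarrow> complex
    \<Rightarrow> complex^('n \<times> 'n)^('n \<times> 'n)" where
  "Q_mat r q s pos z = (let I = {1..2*r+1}; E = mat_unit pos; \<epsilon> = eps_q r s in
      z *\<^sub>m (\<Sum>(i, j)\<in>{(i, j)\<in>I \<times> I. i + j < 2 * r + 2}.
        (\<epsilon> i * \<epsilon> j / s ^ (2 * r + 1)) *\<^sub>m (E i j \<otimes>\<^sub>m E (bar r i) (bar r j)))
    - (\<Sum>(i, j)\<in>{(i, j)\<in>I \<times> I. i + j > 2 * r + 2}.
        (\<epsilon> i * \<epsilon> j / s powi (- 2 * int r - 1)) *\<^sub>m (E i j \<otimes>\<^sub>m E (bar r i) (bar r j)))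
    - ((q ^ r - q powi (- int r) * z) / (s + inverse s)) *\<^sub>m
        (\<Sum>(i, j)\<in>{(i, j)\<in>I \<times> I. i + j = 2 * r + 2 \<and> i \<noteq> r + 1}.
          E i j \<otimes>\<^sub>m E (bar r i) (bar r j))
    - ((q ^ (r + 1) - q powi (- int r - 1) * z) / (s + inverse s)) *\<^sub>m
        (E (r + 1) (r + 1) \<otimes>\<^sub>m E (r + 1) (r + 1)))"

end

theory Submission
  imports Defs
begin

text \<open>The formula in matrix units defines a candidate \<open>Rm z\<close>, and comparing entries shows that it
  intertwines the two tensor products. It is symmetric and invariant under reversing the order of the
  basis, and \<open>F\<^sub>i\<close> is the transpose of \<open>E\<^sub>i\<close>; so only commutators with \<open>E\<^sub>i\<close> need to be computed, and
  the entries with column of weight zero follow from those with row of weight zero.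

  The vectors of the tensor square that are annihilated by \<open>E\<^sub>1, \<dots>, E\<^sub>r\<close> are spanned by the highest
  weight vectors \<open>w1\<close>, \<open>w2\<close>, \<open>w0\<close> of the three summands. These generate the whole space: otherwise the
  annihilator of the submodule that they generate, for the symmetric bilinear form in which \<open>F\<^sub>i\<close> is
  adjoint to \<open>E\<^sub>i\<close>, would contain a nonzero vector annihilated by \<open>E\<^sub>1, \<dots>, E\<^sub>r\<close>, although the form is
  nondegenerate on the span of \<open>w1\<close>, \<open>w2\<close>, \<open>w0\<close>. Hence an operator that commutes with the subalgebra is
  determined by its eigenvalues on these three vectors. Those of \<open>Rm 0\<close> are distinct, which yields
  the projectors, and those of \<open>Rm z\<close> are the coefficients of the spectral formula. The action of
  \<open>E\<^sub>0\<close> fixes the eigenvalues of every normalized homomorphism, which is therefore \<open>Rm (a / b)\<close>; and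
  a rational function is determined by its values off a finite set.\<close>

text \<open>Two features shape the computation. The type A part satisfies by itself every relation
  whose row and column both have nonzero weight, because its coefficients depend only on the order
  of the indices. Weight zero means index sum \<open>2 * r + 2\<close>, and there
  \<open>Q_mat\<close> supplies the correction: off the antidiagonal its columns are proportional to
  \<open>eps_q\<close>, whose ratios make neighbouring columns cancel, so that a genuine identity in
  \<open>q\<close> and \<open>z\<close> remains only where the antidiagonal is met. With
  \<open>u\<close> standing for q^(r+1/2), these identities no longer mention \<open>r\<close>.

  That \<open>q\<close> is not a root of unity enters mainly through q^2 + 1, q^(2r+1) - 1 and
  q^(2r-1) + 1. Up to invertible factors the first is the norm of \<open>w2\<close>, the product of
  the other two is the norm of \<open>w0\<close>, and all three are the differences of the
  eigenvalues of \<open>Rm 0\<close>. So the nondegeneracy and the splitting have the same source,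
  and complete reducibility is derived rather than presupposed.\<close>

locale A2r_setting =
  fixes r :: nat and q s c :: complex and pos :: "'n::finite \<Rightarrow> nat"
  assumes r2: "r \<ge> 2"
    and q0: "q \<noteq> 0" and not_root: "\<And>n::nat. n > 0 \<Longrightarrow> q ^ n \<noteq> 1"
    and s2: "s ^ 2 = q" and c2: "c ^ 2 = s + inverse s"
    and pos_bij: "bij_betw pos UNIV {1..2 * r + 1}"
begin

lemma s_nz [simp]: "s \<noteq> 0"
  using q0 s2 by auto

lemma s_sum_nz: "s + inverse s \<noteq> 0"
proof
  assume "s + inverse s = 0"
  then have "s * (s + inverse s) = 0" by simp
  then have "q = -1" using s2 by (simp add: algebra_simps power2_eq_square eq_neg_iff_add_eq_0)
  then show False using not_root[of 2] by simp
qed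

lemma c_nz [simp]: "c \<noteq> 0"
  using c2 s_sum_nz by auto

section \<open>Numbering of the basis vectors\<close>

definition idx :: "nat \<Rightarrow> 'n" where "idx = inv_into UNIV pos"

lemma pos_range [simp]: "1 \<le> pos x" "Suc 0 \<le> pos x" "0 < pos x" "pos x \<le> 2 * r + 1" "pos x \<le> Suc (2 * r)"
proof -
  have "pos x \<in> {1..2 * r + 1}" using bij_betwE[OF pos_bij] by blast
  then show "1 \<le> pos x" "Suc 0 \<le> pos x" "0 < pos x" "pos x \<le> 2 * r + 1" "pos x \<le> Suc (2 * r)"
    by auto
qed

lemma idx_pos [simp]: "idx (pos x) = x"
  using pos_bij unfolding idx_def by (simp add: bij_betw_def inv_into_f_f)

lemma pos_idx [simp]: "1 \<le> k \<Longrightarrow> k \<le> 2 * r + 1 \<Longrightarrow> pos (idx k) = k"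
  using bij_betw_inv_into_right[OF pos_bij, of k] unfolding idx_def by simp

lemma pos_eq_iff [simp]: "pos x = pos y \<longleftrightarrow> x = y"
  using pos_bij by (auto simp: bij_betw_def inj_on_def)

lemma idx_eq_iff: "1 \<le> k \<Longrightarrow> k \<le> 2 * r + 1 \<Longrightarrow> x = idx k \<longleftrightarrow> pos x = k"
  by (metis idx_pos pos_idx)

lemma sum_pos: "(\<Sum>x\<in>UNIV. f (pos x)) = (\<Sum>k\<in>{1..2*r+1}. f k)"
  by (rule sum.reindex_bij_betw[OF pos_bij])

text \<open>\<open>raises i k\<close> says that \<open>E\<^sub>i\<close>, \<open>i \<ge> 1\<close>, maps the basis vector \<open>v\<close> with index \<open>k + 1\<close> to a nonzero multiple of the one with index \<open>k\<close>.\<close>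

definition raises :: "nat \<Rightarrow> nat \<Rightarrow> bool" where
  "raises i k \<longleftrightarrow> k = i \<or> k = 2 * r + 1 - i"

definition coef :: "nat \<Rightarrow> complex" where
  "coef i = (if i = r then c else 1)"

lemma coef_nz [simp]: "coef i \<noteq> 0"
  by (simp add: coef_def)

lemma raises_le: "i \<in> {1..r} \<Longrightarrow> raises i k \<Longrightarrow> 1 \<le> k \<and> k \<le> 2 * r"
  using r2 by (auto simp: raises_def)

section \<open>Matrix entries of the generators on the module and on its tensor square\<close>

abbreviation V :: "complex \<Rightarrow> 'n qmod" where
  "V a \<equiv> fund_qmod r c pos a"

abbreviation VV :: "complex \<Rightarrow> complex \<Rightarrow> ('n \<times> 'n) qmod" where
  "VV a b \<equiv> tensor_qmod s (V a) (V b)"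

text \<open>The basis vectors form a chain: edge \<open>k\<close> joins the indices \<open>k\<close>
  and \<open>k + 1\<close> and has as its color the smaller of \<open>k\<close> and
  \<open>2 * r + 1 - k\<close>. Each color sits on two mirrored edges, which are adjacent for
  \<open>i = r\<close>; apart from that, \<open>i = r\<close> differs only by the scalar
  \<open>coef i\<close>.\<close>

lemma fund_E_entry:
  assumes "i \<in> {1..r}"
  shows "Eact (V a) i $ x $ y =
    (if raises i (pos x) \<and> pos y = pos x + 1 then coef i else 0)"
proof -
  have E: "Eact (V a) i $ x $ y = fund_F r c pos i $ y $ x"
    using assms by (simp add: fund_qmod_def transpose_def)
  show ?thesis
  proof (cases "i = r")
    case True
    have "fund_F r c pos i $ y $ x = c * ((if pos y = r + 1 \<and> pos x = r then 1 else 0)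
        + (if pos y = r + 2 \<and> pos x = r + 1 then 1 else 0))"
      using True by (simp add: fund_F_def smult_mat_def mat_unit_def bar_def)
    moreover have "raises i (pos x) \<longleftrightarrow> pos x = r \<or> pos x = r + 1"
      using True by (auto simp: raises_def)
    ultimately show ?thesis
      using True unfolding E by (cases "pos x = r"; cases "pos x = r + 1") (simp_all add: coef_def)
  next
    case False
    have "fund_F r c pos i $ y $ x = (if pos y = i + 1 \<and> pos x = i then 1 else 0)
        + (if pos y = 2 * r + 2 - i \<and> pos x = 2 * r + 1 - i then 1 else 0)"
      using False by (simp add: fund_F_def mat_unit_def bar_def)
    moreover have "2 * r + 2 - i = 2 * r + 1 - i + 1" "i \<noteq> 2 * r + 1 - i"
      using False assms by auto
    ultimately show ?thesis
      using False unfolding E raises_def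
      by (cases "pos x = i"; cases "pos x = 2 * r + 1 - i") (simp_all add: coef_def)
  qed
qed

lemma fund_F_transpose: "i \<in> {1..r} \<Longrightarrow> Fact (V a) i = transpose (Eact (V a) i)"
  by (simp add: fund_qmod_def)

lemma fund_E0_entry:
  "Eact (V a) 0 $ x $ y = (if pos x = 2 * r + 1 \<and> pos y = 1 then a else 0)"
  by (auto simp: fund_qmod_def fund_E0_def smult_mat_def mat_unit_def)

lemma fund_F0_entry:
  "a \<noteq> 0 \<Longrightarrow> Fact (V a) 0 $ x $ y = (if pos y = 2 * r + 1 \<and> pos x = 1 then inverse a else 0)"
  by (auto simp: fund_qmod_def fund_E0_def smult_mat_def mat_unit_def transpose_def power2_eq_square
      power_int_minus field_simps)

lemma fund_wt_eq [simp]: "wt (V a) i x = fund_wt r i (pos x)"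
  by (simp add: fund_qmod_def)

lemma VV_E_entry:
  assumes "i \<in> {1..r}"
  shows "Eact (VV a b) i $ (x, y) $ (x', y') =
    coef i * ((if raises i (pos x) \<and> pos x' = pos x + 1 \<and> y = y' then s powi fund_wt r i (pos y) else 0)
     + (if raises i (pos y) \<and> pos y' = pos y + 1 \<and> x = x' then s powi (- fund_wt r i (pos x)) else 0))"
  by (simp add: tensor_qmod_def tensor_mat_def Khalf_def fund_E_entry[OF assms])

text \<open>The coproduct has the same form on \<open>E\<close> and on \<open>F\<close>, and the
  powers of \<open>K\<close> are diagonal, so transposition passes to the tensor product.\<close>

lemma VV_F_transpose: "i \<in> {1..r} \<Longrightarrow> Fact (VV a b) i = transpose (Eact (VV a b) i)"
  by (simp add: tensor_qmod_def fund_F_transpose vec_eq_iff transpose_def tensor_mat_def Khalf_def)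

lemma VV_E0_entry:
  "Eact (VV a b) 0 $ (x, y) $ (x', y') =
    ((if pos x = 2 * r + 1 \<and> pos x' = 1 \<and> y = y' then a * s powi fund_wt r 0 (pos y) else 0)
     + (if pos y = 2 * r + 1 \<and> pos y' = 1 \<and> x = x' then b * s powi (- fund_wt r 0 (pos x)) else 0))"
  by (simp add: tensor_qmod_def tensor_mat_def Khalf_def fund_E0_entry)

text \<open>The transpose relates the actions for the two orders of the spectral parameters.\<close>

lemma VV_F0_transpose:
  "a \<noteq> 0 \<Longrightarrow> b \<noteq> 0 \<Longrightarrow> (a * b) *\<^sub>m Fact (VV a b) 0 = transpose (Eact (VV b a) 0)"
  using r2 by (auto simp: tensor_qmod_def vec_eq_iff transpose_def tensor_mat_def Khalf_def
      fund_E0_entry fund_F0_entry smult_mat_def field_simps)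


text \<open>Delta functions of the column reduce a matrix product with \<open>E\<^sub>i\<close> to
  two terms. The condition \<open>raises i (pos x)\<close> keeps \<open>pos x + 1\<close> at most
  \<open>2 * r + 1\<close>, where \<open>idx\<close> is meaningful.\<close>

lemma VV_E_row:
  assumes "i \<in> {1..r}"
  shows "Eact (VV a b) i $ (x, y) $ u =
    coef i * ((if u = (idx (pos x + 1), y) then (if raises i (pos x) then s powi fund_wt r i (pos y) else 0) else 0)
     + (if u = (x, idx (pos y + 1)) then (if raises i (pos y) then s powi (- fund_wt r i (pos x)) else 0) else 0))"
proof -
  have *: "raises i (pos z) \<and> pos z' = pos z + 1 \<longleftrightarrow> raises i (pos z) \<and> z' = idx (pos z + 1)" for z z'
    using raises_le[OF assms, of "pos z"] idx_eq_iff[of "pos z + 1" z'] by auto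
  have **: "(P \<and> Q \<and> R) = ((P \<and> Q) \<and> R)" for P Q R by blast
  obtain x' y' where u: "u = (x', y')" by fastforce
  show ?thesis
    unfolding u VV_E_entry[OF assms] ** * by auto
qed

lemma sum_delta_mult:
  fixes h :: "'a::finite \<Rightarrow> complex"
  shows "(\<Sum>u\<in>UNIV. (e * ((if u = v then A else 0) + (if u = w then B else 0))) * h u) = e * (A * h v + B * h w)"
proof -
  have "(e * ((if u = v then A else 0) + (if u = w then B else 0))) * h u
      = (if u = v then e * A * h u else 0) + (if u = w then e * B * h u else 0)" for u
    by (auto simp: algebra_simps)
  then show ?thesis
    by (simp add: sum.distrib sum.delta algebra_simps)
qed

lemma sum_E_row:
  assumes "i \<in> {1..r}"
  shows "(\<Sum>u\<in>UNIV. Eact (VV a b) i $ (x, y) $ u * h u) =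
    coef i * ((if raises i (pos x) then s powi fund_wt r i (pos y) * h (idx (pos x + 1), y) else 0)
     + (if raises i (pos y) then s powi (- fund_wt r i (pos x)) * h (x, idx (pos y + 1)) else 0))"
  unfolding VV_E_row[OF assms] sum_delta_mult by simp

text \<open>At the top of the chain \<open>pos x - 1\<close> is \<open>0\<close>, which is not an
  edge of any color, so the truncated subtraction does no harm.\<close>

lemma VV_E_col:
  assumes "i \<in> {1..r}"
  shows "Eact (VV a b) i $ u $ (x, y) =
    coef i * ((if u = (idx (pos x - 1), y) then (if raises i (pos x - 1) then s powi fund_wt r i (pos y) else 0) else 0)
     + (if u = (x, idx (pos y - 1)) then (if raises i (pos y - 1) then s powi (- fund_wt r i (pos x)) else 0) else 0))"
proof -
  have *: "raises i (pos z) \<and> pos z' = pos z + 1 \<longleftrightarrow> raises i (pos z' - 1) \<and> z = idx (pos z' - 1)" for z z'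
    using raises_le[OF assms, of "pos z' - 1"] idx_eq_iff[of "pos z' - 1" z] pos_range[of z'] by auto
  have **: "(P \<and> Q \<and> R) = ((P \<and> Q) \<and> R)" for P Q R by blast
  obtain x' y' where u: "u = (x', y')" by fastforce
  show ?thesis
    unfolding u VV_E_entry[OF assms] ** * by auto
qed

lemma sum_E_col:
  assumes "i \<in> {1..r}"
  shows "(\<Sum>u\<in>UNIV. h u * Eact (VV a b) i $ u $ (x, y)) =
    coef i * ((if raises i (pos x - 1) then s powi fund_wt r i (pos y) * h (idx (pos x - 1), y) else 0)
     + (if raises i (pos y - 1) then s powi (- fund_wt r i (pos x)) * h (x, idx (pos y - 1)) else 0))"
  unfolding mult.commute[of "h _"] VV_E_col[OF assms] sum_delta_mult by simp

lemma VV_E0_row: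
  "Eact (VV a b) 0 $ (x, y) $ u =
    1 * ((if u = (idx 1, y) then (if pos x = 2 * r + 1 then a * s powi fund_wt r 0 (pos y) else 0) else 0)
     + (if u = (x, idx 1) then (if pos y = 2 * r + 1 then b * s powi (- fund_wt r 0 (pos x)) else 0) else 0))"
  by (cases u) (auto simp: VV_E0_entry idx_eq_iff)

lemma VV_E0_col:
  "Eact (VV a b) 0 $ u $ (x, y) =
    1 * ((if u = (idx (2 * r + 1), y) then (if pos x = 1 then a * s powi fund_wt r 0 (pos y) else 0) else 0)
     + (if u = (x, idx (2 * r + 1)) then (if pos y = 1 then b * s powi (- fund_wt r 0 (pos x)) else 0) else 0))"
  by (cases u) (auto simp: VV_E0_entry idx_eq_iff)

lemma sum_E0_row:
  "(\<Sum>u\<in>UNIV. Eact (VV a b) 0 $ (x, y) $ u * h u) =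
    (if pos x = 2 * r + 1 then a * s powi fund_wt r 0 (pos y) * h (idx 1, y) else 0)
     + (if pos y = 2 * r + 1 then b * s powi (- fund_wt r 0 (pos x)) * h (x, idx 1) else 0)"
  unfolding VV_E0_row sum_delta_mult by simp

lemma sum_E0_col:
  "(\<Sum>u\<in>UNIV. h u * Eact (VV a b) 0 $ u $ (x, y)) =
    (if pos x = 1 then a * s powi fund_wt r 0 (pos y) * h (idx (2 * r + 1), y) else 0)
     + (if pos y = 1 then b * s powi (- fund_wt r 0 (pos x)) * h (x, idx (2 * r + 1)) else 0)"
  unfolding mult.commute[of "h _"] VV_E0_col sum_delta_mult by simp


section \<open>Scalars of the R-matrix\<close>

text \<open>Here \<open>u\<close> is \<open>q\<close> to the power \<open>r + 1/2\<close>. The entry \<open>Rf z k l m n\<close> defined below is the coefficient of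
  \<open>v\<^sub>k \<otimes> v\<^sub>l\<close> in the image of \<open>v\<^sub>m \<otimes> v\<^sub>n\<close>: the part \<open>Af\<close> belongs to \<open>R_sl\<close>, and \<open>Qc\<close> to \<open>Q_mat\<close>.\<close>

definition u :: complex where "u = s ^ (2 * r + 1)"
definition D1 :: "complex \<Rightarrow> complex" where "D1 z = q - inverse q * z"
definition D2 :: "complex \<Rightarrow> complex" where "D2 z = u + inverse u * z"
definition eta :: complex where "eta = q - inverse q"
definition gz :: "complex \<Rightarrow> complex" where "gz z = eta * (1 - z) / (D1 z * D2 z)"
definition al :: "complex \<Rightarrow> nat \<Rightarrow> nat \<Rightarrow> complex" where
  "al z k l = (if k = l then 1 else if k < l then z * eta / D1 z else eta / D1 z)"
definition be :: "complex \<Rightarrow> complex" where "be z = (1 - z) / D1 z"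
text \<open>Since \<open>u / s\<close> is \<open>q ^ r\<close> and \<open>u * s\<close> is
  \<open>q ^ (r + 1)\<close>, the scalars \<open>a1\<close> and \<open>a0\<close> are the
  coefficients, with their signs, of the last two terms of \<open>Q_mat\<close>.\<close>

definition a1 :: "complex \<Rightarrow> complex" where "a1 z = - ((u / s - s / u * z) / (s + inverse s))"
definition a0 :: "complex \<Rightarrow> complex" where "a0 z = - ((u * s - z / (u * s)) / (s + inverse s))"
abbreviation ev :: "nat \<Rightarrow> complex" where "ev \<equiv> eps_q r s"

abbreviation opp :: "nat \<Rightarrow> nat" where "opp k \<equiv> 2 * r + 2 - k"

lemma u_nz [simp]: "u \<noteq> 0" by (simp add: u_def)

lemma q_pow_r: "q ^ r = u / s"
  by (simp add: u_def power_mult flip: s2)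

lemma u_sq: "u ^ 2 = q ^ (2 * r + 1)"
  unfolding u_def s2[symmetric] power_mult[symmetric] by (simp add: mult.commute)

text \<open>The complement of the two poles.\<close>

definition good :: "complex \<Rightarrow> bool" where
  "good z \<longleftrightarrow> z \<noteq> q ^ 2 \<and> z \<noteq> - (q ^ (2 * r + 1))"

lemma goodD:
  assumes "good z"
  shows "s ^ 4 - z \<noteq> 0" "u ^ 2 + z \<noteq> 0"
proof -
  have "z \<noteq> s ^ 4" using assms unfolding good_def unfolding s2[symmetric] power_mult[symmetric] by simp
  then show "s ^ 4 - z \<noteq> 0" by simp
  have "z \<noteq> - (u ^ 2)" using assms unfolding good_def u_sq by simp
  then show "u ^ 2 + z \<noteq> 0" by (simp add: add_eq_0_iff)
qed

lemma s2_1: "s ^ 2 + 1 \<noteq> 0"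
proof
  assume "s ^ 2 + 1 = 0"
  then have "s * (s + inverse s) = 0" by (simp add: algebra_simps power2_eq_square)
  then show False using s_sum_nz by simp
qed

lemma D1_eq: "D1 z = (s ^ 4 - z) / s ^ 2"
  unfolding D1_def unfolding s2[symmetric] by (simp add: field_simps power_numeral_reduce)

lemma D2_eq: "D2 z = (u ^ 2 + z) / u"
  by (simp add: D2_def field_simps power_numeral_reduce)

lemma D_nz: assumes "good z" shows "D1 z \<noteq> 0" "D2 z \<noteq> 0"
  using goodD[OF assms] by (simp_all add: D1_eq D2_eq)

lemma s_sum_eq: "s + inverse s = (s ^ 2 + 1) / s"
  by (simp add: field_simps power2_eq_square)

lemma eta_eq: "eta = (s ^ 4 - 1) / s ^ 2"
  unfolding eta_def unfolding s2[symmetric] by (simp add: field_simps power_numeral_reduce)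

section \<open>Scalar identities behind the intertwining relations\<close>

lemmas scalar_defs = gz_def be_def a1_def a0_def D1_eq D2_eq s_sum_eq eta_eq

text \<open>In this family \<open>u\<close> is an independent nonzero variable, so one identity
  serves all \<open>r\<close>; clearing denominators leaves a polynomial identity in
  \<open>s\<close>, \<open>u\<close>, \<open>z\<close>. The first four belong to rows where a
  relation with \<open>E\<^sub>i\<close> meets the antidiagonal of \<open>Q_mat\<close>, the next
  two to the corner rows for \<open>E\<^sub>0\<close>.\<close>

lemma scalar_id1:
  assumes "good z"
  shows "inverse s * (gz z * (- z * s ^ 2 / u)) + s * (gz z * a1 z + be z) = inverse s * be z"
  unfolding scalar_defs using goodD[OF assms] s2_1
  apply (simp add: divide_simps)
  apply (simp add: algebra_simps power_numeral_reduce)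
  done

lemma scalar_id2:
  assumes "good z"
  shows "inverse s * (gz z * a1 z + be z) + s * (gz z * (u / s ^ 2)) = s * be z"
  unfolding scalar_defs using goodD[OF assms] s2_1
  apply (simp add: divide_simps)
  apply (simp add: algebra_simps power_numeral_reduce)
  done

lemma scalar_id3:
  assumes "good z"
  shows "- (gz z * z / u) + 1 + gz z * a0 z = (z * eta + 1 - z) / D1 z"
  unfolding scalar_defs using goodD[OF assms] s2_1
  apply (simp add: divide_simps)
  apply (simp add: algebra_simps power_numeral_reduce)
  done

lemma scalar_id5:
  assumes "good z"
  shows "1 + gz z * a0 z + gz z * u = (eta + 1 - z) / D1 z"
  unfolding scalar_defs using goodD[OF assms] s2_1
  apply (simp add: divide_simps)
  apply (simp add: algebra_simps power_numeral_reduce)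
  done

lemma scalar_id6:
  assumes "good z"
  shows "z / s ^ 2 * (gz z * a1 z + be z) + s ^ 2 * (z * eta / D1 z + gz z * z * u / s ^ 4) = z * s ^ 2"
  unfolding scalar_defs using goodD[OF assms] s2_1
  apply (simp add: divide_simps)
  apply (simp add: algebra_simps power_numeral_reduce)
  done

lemma scalar_id7:
  assumes "good z"
  shows "z / s ^ 2 * (eta / D1 z - gz z * s ^ 4 / u) + s ^ 2 * (gz z * a1 z + be z) = 1 / s ^ 2"
  unfolding scalar_defs using goodD[OF assms] s2_1
  apply (simp add: divide_simps)
  apply (simp add: algebra_simps power_numeral_reduce)
  done

text \<open>The two relations of type A, used where \<open>E\<^sub>i\<close> starts from or arrives
  at the square of a basis vector.\<close>

lemma scalar_id8:
  assumes "good z"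
  shows "eta / D1 z + be z / s ^ 2 = 1" "z * eta / D1 z / s + s * be z = 1 / s"
  unfolding scalar_defs using goodD[OF assms] s2_1
   apply (simp_all add: divide_simps)
   apply (simp_all add: algebra_simps power_numeral_reduce)
  done

section \<open>The signed powers of q\<close>

lemma eps_low_Suc: "j < r \<Longrightarrow> eps_low r t j = - (t ^ 2 * eps_low r t (Suc j))"
proof -
  assume "j < r"
  then have "r + 1 - j = Suc (r + 1 - Suc j)" "2 * (r - j) + 1 = 2 * (r - Suc j) + 1 + 2"
    by auto
  then show ?thesis unfolding eps_low_def by (simp only: power_add power_Suc) simp
qed

lemma eps_low_inverse: "eps_low r s j * eps_low r (inverse s) j = 1"
proof -
  have "(-1) ^ k * (-1) ^ k = (1::complex)" "s ^ k * inverse s ^ k = 1" for k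
    by (simp_all flip: power_mult_distrib)
  then show ?thesis unfolding eps_low_def
    by (metis (no_types, opaque_lifting) mult.left_commute mult.commute mult.right_neutral)
qed

lemma ev_mid [simp]: "ev (r + 1) = 1" "ev (Suc r) = 1" by (simp_all add: eps_q_def)

lemma ev_r: "ev r = - s" "ev (r + 2) = - inverse s"
  by (simp_all add: eps_q_def eps_low_def bar_def)

text \<open>Next to the antidiagonal this cancellation turns the products of two values of
  \<open>ev\<close> in \<open>Qc\<close> into plain powers of \<open>s\<close>.\<close>

lemma ev_bar:
  assumes "1 \<le> k" "k \<le> 2 * r + 1"
  shows "ev k * ev (2 * r + 2 - k) = 1"
proof -
  consider "k \<le> r" | "k = r + 1" | "k > r + 1" by linarith
  then show ?thesis
  proof cases
    case 1
    then have "\<not> opp k \<le> r" "opp k \<noteq> r + 1" "opp (opp k) = k" by auto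
    with 1 show ?thesis by (simp add: eps_q_def bar_def eps_low_inverse)
  next
    case 2 then show ?thesis by (simp add: eps_q_def)
  next
    case 3
    then have "2 * r + 2 - k \<le> r" by simp
    with 3 show ?thesis
      by (simp add: eps_q_def bar_def mult.commute[of "eps_low r (inverse s) _"] eps_low_inverse)
  qed
qed

text \<open>The two steps around the middle index are left out because the ratio there is
  \<open>- (1 / s)\<close>; together they amount to one step of size
  \<open>1 / s ^ 2\<close>.\<close>

lemma ev_Suc:
  assumes "1 \<le> k" "k \<le> 2 * r" "k \<noteq> r" "k \<noteq> r + 1"
  shows "ev (Suc k) = - (ev k / s ^ 2)"
proof (cases "k < r")
  case True
  then show ?thesis by (simp add: eps_q_def eps_low_Suc)
next
  case False
  then have "2 * r + 2 - k = Suc (2 * r + 1 - k)" "2 * r + 1 - k < r" using assms by auto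
  then show ?thesis
    using False assms eps_low_Suc[of "2 * r + 1 - k" "inverse s"]
    by (simp add: eps_q_def bar_def power_inverse field_simps)
qed

lemma ev_nz: "1 \<le> k \<Longrightarrow> k \<le> 2 * r + 1 \<Longrightarrow> ev k \<noteq> 0"
  using ev_bar by fastforce

lemma ev_1: "ev 1 = (-1) ^ r * u / s ^ 2"
proof -
  have "2 * (r - 1) + 1 + 2 = 2 * r + 1" using r2 by simp
  then have "s ^ (2 * (r - 1) + 1) * s ^ 2 = u" unfolding u_def by (simp flip: power_add)
  then show ?thesis using r2 by (simp add: eps_q_def eps_low_def field_simps)
qed

lemma ev_N: "ev (2 * r + 1) = (-1) ^ r * s ^ 2 / u"
proof -
  have "ev 1 * ev (2 * r + 1) = 1" using ev_bar[of 1] by simp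
  moreover have "((-1) ^ r * u / s ^ 2) * ((-1) ^ r * s ^ 2 / u) = 1"
    by (simp add: flip: power_mult_distrib)
  ultimately show ?thesis unfolding ev_1
    by (metis mult_cancel_left mult_zero_left zero_neq_one)
qed

section \<open>Entries of the candidate and their symmetries\<close>

definition Qc :: "complex \<Rightarrow> nat \<Rightarrow> nat \<Rightarrow> complex" where
  "Qc z k m = (if k + m < 2 * r + 2 then z * ev k * ev m / u
    else if k + m > 2 * r + 2 then - (ev k * ev m * u)
    else if k = r + 1 then a0 z else a1 z)"

definition Af :: "complex \<Rightarrow> nat \<Rightarrow> nat \<Rightarrow> nat \<Rightarrow> nat \<Rightarrow> complex" where
  "Af z k l m n = (if k = m \<and> l = n then al z k l else 0)
    + (if k = n \<and> l = m \<and> k \<noteq> l then be z else 0)"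

definition Rf :: "complex \<Rightarrow> nat \<Rightarrow> nat \<Rightarrow> nat \<Rightarrow> nat \<Rightarrow> complex" where
  "Rf z k l m n = Af z k l m n
    + (if k + l = 2 * r + 2 \<and> m + n = 2 * r + 2 then gz z * Qc z k m else 0)"

definition Rm :: "complex \<Rightarrow> complex^('n \<times> 'n)^('n \<times> 'n)" where
  "Rm z = (\<chi> p p'. Rf z (pos (fst p)) (pos (snd p)) (pos (fst p')) (pos (snd p')))"

lemma Rm_entry: "Rm z $ (x, y) $ (x', y') = Rf z (pos x) (pos y) (pos x') (pos y')"
  by (simp add: Rm_def)

lemma Rf_transpose: "Rf z k l m n = Rf z m n k l"
  by (auto simp: Rf_def Af_def Qc_def algebra_simps)

lemma al_opp: "k \<le> 2 * r + 1 \<Longrightarrow> l \<le> 2 * r + 1 \<Longrightarrow> al z (opp l) (opp k) = al z k l"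
  unfolding al_def by (intro if_cong) auto

text \<open>Reversing the basis alone would interchange the two triangular coefficients in
  \<open>al\<close>; exchanging the tensor factors at the same time restores them.\<close>

lemma Rf_opp:
  assumes "k \<le> 2 * r + 1" "l \<le> 2 * r + 1" "m \<le> 2 * r + 1" "n \<le> 2 * r + 1"
  shows "Rf z (opp l) (opp k) (opp n) (opp m) = Rf z k l m n"
proof -
  have A: "Af z (opp l) (opp k) (opp n) (opp m) = Af z k l m n"
    unfolding Af_def al_opp[OF assms(1,2)] using assms by (intro arg_cong2[where f="(+)"] if_cong) auto
  have B: "opp l = k" "opp n = m" if "k + l = 2 * r + 2" "m + n = 2 * r + 2"
    using that by auto
  have C: "opp l + opp k = 2 * r + 2 \<longleftrightarrow> k + l = 2 * r + 2" "opp n + opp m = 2 * r + 2 \<longleftrightarrow> m + n = 2 * r + 2"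
    using assms by auto
  show ?thesis unfolding Rf_def A C using B by (intro arg_cong2[where f="(+)"] if_cong) auto
qed

text \<open>Transposition composed with reversal and exchange of factors is an anti-automorphism of
  the matrix algebra. It fixes the candidate, so it can interchange the two sides of a commutation
  relation.\<close>

lemma Rf_sym: 
  assumes "k \<le> 2 * r + 1" "l \<le> 2 * r + 1" "m \<le> 2 * r + 1" "n \<le> 2 * r + 1"
  shows "Rf z (opp n) (opp m) (opp l) (opp k) = Rf z k l m n"
  using Rf_opp[OF assms(3,4,1,2)] Rf_transpose by simp


section \<open>Weights of the basis vectors\<close>

lemma fund_wt_lt:
  assumes "1 \<le> i" "i < r"
  shows "fund_wt r i k = (if k = i \<or> k = 2 * r + 1 - i then 1 else if k = i + 1 \<or> k = 2 * r + 2 - i then -1 else 0)"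
proof -
  have "2 * r + 1 - i > i + 1" "2 * r + 2 - i = Suc (2 * r + 1 - i)" "2 * r + 2 - Suc i = 2 * r + 1 - i"
    using assms by auto
  then show ?thesis using assms by (simp add: fund_wt_def eps_wt_def bar_def)
qed

lemma fund_wt_r: "fund_wt r r k = (if k = r then 1 else if k = r + 2 then -1 else 0)"
  using r2 by (simp add: fund_wt_def eps_wt_def bar_def)

lemma fund_wt_0: "fund_wt r 0 k = (if k = 1 then -2 else if k = 2 * r + 1 then 2 else 0)"
  using r2 by (simp add: fund_wt_def eps_wt_def bar_def)

lemma eps_wt_opp:
  assumes "1 \<le> j" "j \<le> r" "1 \<le> k" "k \<le> 2 * r + 1"
  shows "eps_wt r j (opp k) = - eps_wt r j k"
proof -
  have "opp k = j \<longleftrightarrow> k = bar r j" "opp k = bar r j \<longleftrightarrow> k = j" "j \<noteq> bar r j"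
    using assms unfolding bar_def by auto
  then show ?thesis unfolding eps_wt_def by auto
qed

lemma fund_wt_opp:
  assumes "i \<le> r" "1 \<le> k" "k \<le> 2 * r + 1"
  shows "fund_wt r i (opp k) = - fund_wt r i k"
  using assms r2 eps_wt_opp[of 1 k] eps_wt_opp[of r k] eps_wt_opp[of i k] eps_wt_opp[of "i + 1" k]
  unfolding fund_wt_def by (auto simp del: diff_is_0_eq)

section \<open>Commutation with the finite type generators: rows and columns of nonzero
  weight\<close>

text \<open>Up to the factor \<open>coef i\<close>, \<open>Cl\<close> and \<open>Cr\<close> are the entries of \<open>R E\<^sub>i\<close> and \<open>E\<^sub>i R\<close>. In the names below, the letters
  \<open>Z\<close> and \<open>N\<close> say whether the row and the column have weight zero or not.\<close>

definition Cl :: "nat \<Rightarrow> complex \<Rightarrow> nat \<Rightarrow> nat \<Rightarrow> nat \<Rightarrow> nat \<Rightarrow> complex" where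
  "Cl i z k l m n =
    (if raises i (m - 1) then s powi fund_wt r i n * Rf z k l (m - 1) n else 0)
    + (if raises i (n - 1) then s powi (- fund_wt r i m) * Rf z k l m (n - 1) else 0)"

definition Cr :: "nat \<Rightarrow> complex \<Rightarrow> nat \<Rightarrow> nat \<Rightarrow> nat \<Rightarrow> nat \<Rightarrow> complex" where
  "Cr i z k l m n =
    (if raises i k then s powi fund_wt r i l * Rf z (k + 1) l m n else 0)
    + (if raises i l then s powi (- fund_wt r i k) * Rf z k (l + 1) m n else 0)"

lemma raises_opp:
  assumes "i \<in> {1..r}" "1 \<le> k" "k \<le> 2 * r + 1"
  shows "raises i (opp k - 1) \<longleftrightarrow> raises i k"
  using assms unfolding raises_def by auto

text \<open>The anti-automorphism of \<open>Rf_sym\<close> fixes \<open>E\<^sub>i\<close> on the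
  tensor square: reversal negates weights, and the exchange of factors puts one half power of
  \<open>K\<^sub>i\<close> in place of the inverse of the other.\<close>

lemma Cr_opp:
  assumes "i \<in> {1..r}" "k \<in> {1..2*r+1}" "l \<in> {1..2*r+1}" "m \<in> {1..2*r+1}" "n \<in> {1..2*r+1}"
  shows "Cr i z k l m n = Cl i z (opp n) (opp m) (opp l) (opp k)"
proof -
  have 1: "Rf z (opp n) (opp m) (opp l) (opp k - 1) = Rf z (k + 1) l m n" if "raises i k"
    using Rf_sym[of "k + 1" l m n z] raises_le[OF assms(1) that] assms by simp
  have 2: "Rf z (opp n) (opp m) (opp l - 1) (opp k) = Rf z k (l + 1) m n" if "raises i l"
    using Rf_sym[of k "l + 1" m n z] raises_le[OF assms(1) that] assms by simp
  show ?thesis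
    using assms raises_opp[of i k] raises_opp[of i l] fund_wt_opp[of i k] fund_wt_opp[of i l] 1 2
    unfolding Cr_def Cl_def by (simp add: add.commute)
qed

lemma Af_weight: "k + l \<noteq> m + n \<Longrightarrow> Af z k l m n = 0"
  unfolding Af_def by auto

lemma Rf_weight: "k + l \<noteq> m + n \<Longrightarrow> Rf z k l m n = 0"
  unfolding Rf_def using Af_weight[of k l m n z] by auto

lemma Rf_Af: "k + l \<noteq> 2 * r + 2 \<or> m + n \<noteq> 2 * r + 2 \<Longrightarrow> Rf z k l m n = Af z k l m n"
  unfolding Rf_def by auto

text \<open>A nonzero weight for \<open>i\<close> occurs only at an end of one of the two edges of
  color \<open>i\<close>, which are \<open>M\<close> and \<open>2 * r + 1 - M\<close>. Their lower
  ends are excluded by the last two hypotheses, their upper ends by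
  \<open>\<not> raises i N\<close>.\<close>

lemma wt_zero:
  assumes "i \<in> {1..r}" "raises i M" "\<not> raises i N" "n = Suc N" "n \<noteq> M" "Suc M + n \<noteq> 2 * r + 2"
  shows "fund_wt r i n = 0"
proof (cases "i = r")
  case True
  have R: "raises i k \<longleftrightarrow> k = r \<or> k = r + 1" for k
    unfolding raises_def True by auto
  have "n \<noteq> r" "n \<noteq> r + 2" using assms(2-6) unfolding R by linarith+
  then show ?thesis unfolding True fund_wt_r by simp
next
  case False
  then have i: "1 \<le> i" "i < r" using assms by auto
  have "n \<noteq> i" "n \<noteq> 2 * r + 1 - i" "n \<noteq> i + 1" "n \<noteq> 2 * r + 2 - i"
    using assms(2-6) i unfolding raises_def by linarith+
  then show ?thesis unfolding fund_wt_lt[OF i] by simp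
qed

text \<open>The edges of color \<open>r\<close> form a string of three vectors whose middle one,
  with index \<open>r + 1\<close>, has weight zero; hence the exception.\<close>

lemma wt_upper:
  assumes "i \<in> {1..r}" "raises i M" "M \<noteq> r + 1"
  shows "fund_wt r i M = 1"
proof (cases "i = r")
  case True
  have "M = r" using assms(2,3) unfolding raises_def True by linarith
  then show ?thesis unfolding True fund_wt_r by auto
next
  case False
  then have i: "1 \<le> i" "i < r" using assms by auto
  show ?thesis using assms(2) unfolding raises_def fund_wt_lt[OF i] by simp
qed

lemma wt_lowered:
  assumes "i \<in> {1..r}" "raises i M" "Suc M \<noteq> r + 1"
  shows "fund_wt r i (Suc M) = -1"
proof (cases "i = r")
  case True
  have "M = r + 1" using assms(2,3) unfolding raises_def True by linarith
  then show ?thesis unfolding True fund_wt_r by auto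
next
  case False
  then have i: "1 \<le> i" "i < r" using assms by auto
  have "2 * r + 1 - i > i + 1" "2 * r + 2 - i = Suc (2 * r + 1 - i)" using i by auto
  then show ?thesis using assms(2) unfolding raises_def fund_wt_lt[OF i] by (elim disjE) simp_all
qed

text \<open>\<open>Rf\<close> differs from \<open>Af\<close> only if row and column both have weight
  zero, so \<open>Q_mat\<close> drops out of all four terms and a relation of type A remains. The
  cases record which of the two factors of the column is moved by \<open>E\<^sub>i\<close> and
  whether the move creates or removes a coincidence of indices, the only moment at which
  \<open>al\<close> can change.\<close>

lemma comm_NN:
  assumes i: "i \<in> {1..r}" and "k \<in> {1..2*r+1}" "l \<in> {1..2*r+1}" "m \<in> {1..2*r+1}" "n \<in> {1..2*r+1}"
    and row: "k + l \<noteq> 2 * r + 2" and col: "m + n \<noteq> 2 * r + 2" and z: "good z"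
  shows "Cl i z k l m n = Cr i z k l m n"
proof -
  obtain M N where M: "m = Suc M" and N: "n = Suc N"
    using assms by (metis atLeastAtMost_iff not0_implies_Suc not_one_le_zero)
  have L: "Cl i z k l m n = (if raises i M then s powi fund_wt r i n * Af z k l M n else 0)
     + (if raises i N then s powi (- fund_wt r i m) * Af z k l m N else 0)"
    unfolding Cl_def using row by (simp add: Rf_Af M N)
  have R: "Cr i z k l m n = (if raises i k then s powi fund_wt r i l * Af z (k + 1) l m n else 0)
    + (if raises i l then s powi (- fund_wt r i k) * Af z k (l + 1) m n else 0)"
    unfolding Cr_def using col by (simp add: Rf_Af)
  consider "\<not> raises i M" "\<not> raises i N" | "raises i M" "raises i N" "m = n" 
    | "raises i M" "raises i N" "m \<noteq> n" | "raises i M" "\<not> raises i N" "n = M" | "raises i M" "\<not> raises i N" "n \<noteq> M"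
    | "\<not> raises i M" "raises i N" "m = N" | "\<not> raises i M" "raises i N" "m \<noteq> N" by blast
  then show ?thesis
  proof cases
    case 1
    have "Af z (k + 1) l m n = 0" if "raises i k"
    proof -
      have "k \<noteq> M" "k \<noteq> N" using 1 that by blast+
      then show ?thesis unfolding Af_def M N by simp
    qed
    moreover have "Af z k (l + 1) m n = 0" if "raises i l"
    proof -
      have "l \<noteq> M" "l \<noteq> N" using 1 that by blast+
      then show ?thesis unfolding Af_def M N by simp
    qed
    ultimately show ?thesis unfolding L R using 1 by simp
  next
    case 2
    have MN: "N = M" using 2 M N by simp
    have nm: "n = m" using 2 by simp
    have ne: "m \<noteq> r + 1" using col unfolding nm by simp
    have w: "fund_wt r i m = -1" "fund_wt r i n = -1"
      using wt_lowered[OF i 2(1)] ne M nm by auto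
    have a: "al z M m = z * eta / D1 z" "al z m M = eta / D1 z" by (simp_all add: al_def M)
    have b: "z * eta / (s * D1 z) + s * be z = 1 / s" "s * (eta / D1 z) + be z / s = s"
      using scalar_id8[OF z] by (simp_all add: field_simps power2_eq_square)
    consider "k = M" "l = m" | "k = m" "l = M" | "\<not> (k = M \<and> l = m)" "\<not> (k = m \<and> l = M)" by blast
    then show ?thesis
    proof cases
      case 1
      then have "Af z k l M n = al z M m" "Af z k l m N = be z" "Af z (k + 1) l m n = 1" "Af z k (l + 1) m n = 0"
        unfolding Af_def MN nm using M by (simp_all add: al_def)
      then show ?thesis unfolding L R using 1 2 w a b by (simp add: inverse_eq_divide)
    next
      case 2
      then have "Af z k l M n = be z" "Af z k l m N = al z m M" "Af z (k + 1) l m n = 0" "Af z k (l + 1) m n = 1"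
        unfolding Af_def MN nm using M by (simp_all add: al_def)
      then show ?thesis unfolding L R using 2 \<open>raises i M\<close> \<open>raises i N\<close> w a b by (simp add: inverse_eq_divide add.commute)
    next
      case 3
      then have "Af z k l M n = 0" "Af z k l m N = 0" "Af z (k + 1) l m n = 0" "Af z k (l + 1) m n = 0"
        unfolding Af_def MN nm using M by auto
      then show ?thesis unfolding L R by simp
    qed
  next
    case 3
    \<comment> \<open>Two distinct edges of one color have sum \<open>2 * r + 1\<close>. So
      \<open>E\<^sub>i\<close> takes the column into weight zero, and conservation of the index sum
      kills every term because the row has nonzero weight.\<close>
    have "m + n = 2 * r + 3" using i 3 unfolding raises_def M N by auto
    moreover then have "Af z k l M n = 0" "Af z k l m N = 0" using row M N by (intro Af_weight; simp)+
    moreover have "Af z (k + 1) l m n = 0" "Af z k (l + 1) m n = 0"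
      using row \<open>m + n = 2 * r + 3\<close> by (intro Af_weight; simp)+
    ultimately show ?thesis unfolding L R by simp
  next
    case 4
    have ne: "M \<noteq> r + 1" using 4 N unfolding raises_def by auto
    have w: "fund_wt r i M = 1" using wt_upper[OF i 4(1) ne] .
    have b: "s * (eta / D1 z) + be z / s = s"
      using scalar_id8[OF z] by (simp_all add: field_simps power2_eq_square)
    show ?thesis
    proof (cases "k = M \<and> l = M")
      case True
      then have "Af z k l M n = 1" "Af z (k + 1) l m n = eta / D1 z" "Af z k (l + 1) m n = be z"
        unfolding Af_def 4(3) using M by (simp_all add: al_def)
      then show ?thesis unfolding L R using True 4 w b by (simp add: inverse_eq_divide)
    next
      case False
      have "k \<noteq> N" if "raises i k" using that 4 by blast
      moreover have "l \<noteq> N" if "raises i l" using that 4 by blast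
      ultimately have "Af z k l M n = 0" "raises i k \<Longrightarrow> Af z (k + 1) l m n = 0" "raises i l \<Longrightarrow> Af z k (l + 1) m n = 0"
        using False unfolding Af_def using M N 4(3) by auto
      then show ?thesis unfolding L R using 4 by simp
    qed
  next
    case 5
    have wn: "fund_wt r i n = 0" using wt_zero[OF i 5(1,2) N 5(3)] col M by simp
    \<comment> \<open>Moving an index by one step leaves its order relative to \<open>n\<close>
      unchanged unless \<open>n\<close> is one of the two ends of the step.\<close>
    have "n \<noteq> m" using 5 M N by auto
    then have al: "al z M n = al z m n" using 5 unfolding M al_def by auto
    have A1: "Af z k l M n = (if raises i k \<and> l = n then Af z (k + 1) l m n else 0)
         + (if raises i l \<and> k = n then Af z k (l + 1) m n else 0)"
      unfolding Af_def using 5 al \<open>n \<noteq> m\<close> M by auto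
    have A2: "Af z (k + 1) l m n = 0" if "raises i k" "l \<noteq> n"
      using that 5 N unfolding Af_def by auto
    have A3: "Af z k (l + 1) m n = 0" if "raises i l" "k \<noteq> n"
      using that 5 N unfolding Af_def by auto
    show ?thesis unfolding L R A1 using 5(1,2) wn A2 A3 by (cases "k = n"; cases "l = n") auto
  next
    case 6
    have ne: "N \<noteq> r + 1" using 6 M unfolding raises_def by auto
    have w: "fund_wt r i N = 1" using wt_upper[OF i 6(2) ne] .
    have b: "s * be z + z * eta / (s * D1 z) = 1 / s"
      using scalar_id8[OF z] by (simp_all add: field_simps power2_eq_square)
    show ?thesis
    proof (cases "k = N \<and> l = N")
      case True
      then have "Af z k l m N = 1" "Af z (k + 1) l m n = be z" "Af z k (l + 1) m n = z * eta / D1 z"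
        unfolding Af_def 6(3) using N by (simp_all add: al_def)
      then show ?thesis unfolding L R using True 6 w b by (simp add: inverse_eq_divide)
    next
      case False
      have "k \<noteq> M" if "raises i k" using that 6 by blast
      moreover have "l \<noteq> M" if "raises i l" using that 6 by blast
      ultimately have "Af z k l m N = 0" "raises i k \<Longrightarrow> Af z (k + 1) l m n = 0" "raises i l \<Longrightarrow> Af z k (l + 1) m n = 0"
        using False unfolding Af_def using M N 6(3) by auto
      then show ?thesis unfolding L R using 6 by simp
    qed
  next
    case 7
    have wn: "fund_wt r i m = 0" using wt_zero[OF i 7(2,1) M 7(3)] col N by simp
    have "n \<noteq> m" using 7 M N by auto
    then have al: "al z m N = al z m n" using 7 unfolding N al_def by auto
    have A1: "Af z k l m N = (if raises i k \<and> l = m then Af z (k + 1) l m n else 0)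
         + (if raises i l \<and> k = m then Af z k (l + 1) m n else 0)"
      unfolding Af_def using 7 al \<open>n \<noteq> m\<close> N by auto
    have A2: "Af z (k + 1) l m n = 0" if "raises i k" "l \<noteq> m"
      using that 7 M unfolding Af_def by auto
    have A3: "Af z k (l + 1) m n = 0" if "raises i l" "k \<noteq> m"
      using that 7 M unfolding Af_def by auto
    show ?thesis unfolding L R A1 using 7(1,2) wn A2 A3 by (cases "k = m"; cases "l = m") auto
  qed
qed


section \<open>Commutation with the finite type generators: rows of weight zero\<close>

text \<open>The block of \<open>Rf\<close> on the weight zero space.\<close>

definition rho :: "complex \<Rightarrow> nat \<Rightarrow> nat \<Rightarrow> complex" where
  "rho z k m = Rf z k (opp k) m (opp m)"

lemma rho_eq:
  assumes "k \<in> {1..2*r+1}" "m \<in> {1..2*r+1}"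
  shows "rho z k m = (if k = m then al z m (opp m) else 0)
    + (if k = opp m \<and> k \<noteq> r + 1 then be z else 0) + gz z * Qc z k m"
proof -
  have "k + opp k = 2 * r + 2" "m + opp m = 2 * r + 2" "k = opp k \<longleftrightarrow> k = r + 1"
    "opp k = opp m \<longleftrightarrow> k = m" "opp k = m \<longleftrightarrow> k = opp m"
    using assms by auto
  then show ?thesis unfolding rho_def Rf_def Af_def by auto
qed

text \<open>On either side of the antidiagonal a row of \<open>Qc\<close> is a multiple of
  \<open>ev\<close>. A relation between two values of \<open>ev\<close> therefore carries over to
  the two columns in every row that has both on the same side.\<close>

lemma Qc_cancel:
  assumes "ev m = t * ev M" "k + M < 2 * r + 2 \<and> k + m < 2 * r + 2 \<or> k + M > 2 * r + 2 \<and> k + m > 2 * r + 2"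
  shows "Qc z k m = t * Qc z k M"
  using assms(2) unfolding Qc_def assms(1) by (elim disjE) (simp_all add: mult.assoc mult.left_commute)

text \<open>The ratio \<open>- (1 / s ^ 2)\<close> of consecutive \<open>ev\<close> cancels the two
  columns in all rows except \<open>N\<close> and \<open>Suc N\<close>, where one of them lies on
  the antidiagonal; these two rows are \<open>scalar_id1\<close> and
  \<open>scalar_id2\<close>.\<close>

lemma comm_ZN_generic:
  assumes "1 \<le> M" "M \<le> 2 * r" "M \<noteq> r" "M \<noteq> r + 1" "k \<in> {1..2*r+1}" "good z"
    and N: "N = 2 * r + 1 - M"
  shows "inverse s * rho z k M + s * rho z k (Suc M) =
    (if k = M then inverse s * al z (Suc M) (Suc N) else 0) + (if k = N then inverse s * be z else 0)
    + (if k = Suc M then s * al z (Suc M) (Suc N) else 0) + (if k = Suc N then s * be z else 0)"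
proof -
  have opp: "opp M = Suc N" "opp (Suc M) = N" and MN: "M + N = 2 * r + 1" and ne: "N \<noteq> M" "N \<noteq> Suc M" "Suc N \<noteq> M" "N \<noteq> r + 1" "Suc N \<noteq> r + 1"
    using assms by auto
  have al: "al z M (Suc N) = al z (Suc M) (Suc N)" "al z (Suc M) N = al z (Suc M) (Suc N)"
  proof -
    have "M < r \<or> r + 1 < M" using assms(3,4) by linarith
    then have "M < Suc N \<and> Suc M < Suc N \<and> Suc M < N \<or> Suc N < M \<and> Suc N < Suc M \<and> N < Suc M"
      using MN by (elim disjE) simp_all
    then show "al z M (Suc N) = al z (Suc M) (Suc N)" "al z (Suc M) N = al z (Suc M) (Suc N)"
      unfolding al_def by auto
  qed
  have evS: "ev (Suc M) = - (1 / s ^ 2) * ev M" using ev_Suc[of M] assms by simp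
  have evM: "ev M = - (s ^ 2) * ev (Suc M)" using evS by (simp add: field_simps)
  have evN: "ev N * ev (Suc M) = 1" "ev (Suc N) * ev M = 1" 
    using ev_bar[of "Suc M"] ev_bar[of M] opp assms by (simp_all add: mult.commute)
  have Q: "inverse s * (gz z * Qc z k M) + s * (gz z * Qc z k (Suc M)) + (if k = N then s * be z else 0) + (if k = Suc N then inverse s * be z else 0)
    = (if k = N then inverse s * be z else 0) + (if k = Suc N then s * be z else 0)"
  proof -
    consider "k < N" | "k = N" | "k = Suc N" | "k > Suc N" by linarith
    then show ?thesis
    proof cases
      case 1
      then have e: "Qc z k (Suc M) = - (1 / s ^ 2) * Qc z k M"
        using MN by (intro Qc_cancel[OF evS]) auto
      show ?thesis unfolding e using 1 by (simp add: field_simps power2_eq_square)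
    next
      case 2
      have "Qc z k M = z * (ev N * ev M) / u" using 2 MN by (simp add: Qc_def)
      also have "ev N * ev M = - (s ^ 2)" unfolding evM using evN by (simp add: algebra_simps)
      finally have 3: "Qc z k M = - z * s ^ 2 / u" by simp
      have "Qc z k (Suc M) = a1 z" using 2 MN ne by (simp add: Qc_def)
      then show ?thesis using 2 ne scalar_id1[OF \<open>good z\<close>] unfolding 3 by (simp add: algebra_simps)
    next
      case 3
      have "Qc z k (Suc M) = - (ev (Suc N) * ev (Suc M) * u)" using 3 MN by (simp add: Qc_def)
      also have "ev (Suc N) * ev (Suc M) = - (1 / s ^ 2)" unfolding evS using evN by (simp add: algebra_simps)
      finally have 4: "Qc z k (Suc M) = u / s ^ 2" by simp
      have "Qc z k M = a1 z" using 3 MN ne by (simp add: Qc_def)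
      then show ?thesis using 3 ne scalar_id2[OF \<open>good z\<close>] unfolding 4 by (simp add: algebra_simps)
    next
      case 4
      then have e: "Qc z k (Suc M) = - (1 / s ^ 2) * Qc z k M"
        using MN by (intro Qc_cancel[OF evS]) auto
      show ?thesis unfolding e using 4 by (simp add: field_simps power2_eq_square)
    qed
  qed
  have r1: "rho z k M = (if k = M then al z (Suc M) (Suc N) else 0)
    + (if k = Suc N then be z else 0) + gz z * Qc z k M"
    using rho_eq[of k M z] assms(1,2,5) ne unfolding opp al by auto
  have r2: "rho z k (Suc M) = (if k = Suc M then al z (Suc M) (Suc N) else 0)
    + (if k = N then be z else 0) + gz z * Qc z k (Suc M)"
    using rho_eq[of k "Suc M" z] assms(1,2,5) ne unfolding opp al by auto
  let ?a = "al z (Suc M) (Suc N)"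
  have "inverse s * rho z k M + s * rho z k (Suc M) =
     (if k = M then inverse s * ?a else 0) + (if k = Suc M then s * ?a else 0) + 
     (inverse s * (gz z * Qc z k M) + s * (gz z * Qc z k (Suc M)) + (if k = N then s * be z else 0) + (if k = Suc N then inverse s * be z else 0))"
    unfolding r1 r2 using ne by (simp add: algebra_simps)
  then show ?thesis unfolding Q by simp
qed

text \<open>At the middle of the chain the ratio of \<open>ev\<close> is \<open>- (1 / s)\<close>
  and one weight factor is \<open>1\<close>. Row \<open>Suc r\<close> meets the central entry
  \<open>a0\<close>, and this is where its value, different from \<open>a1\<close>, is
  needed.\<close>

lemma comm_ZN_mid1:
  assumes k: "k \<in> {1..2*r+1}" and z: "good z"
  shows "inverse s * rho z k r + rho z k (Suc r) =
    (if k = r then inverse s * al z (Suc r) (Suc (Suc r)) else 0) + (if k = Suc r then be z else 0)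
    + (if k = Suc r then al z (Suc r) (Suc (Suc r)) else 0) + (if k = Suc (Suc r) then s * be z else 0)"
proof -
  have o: "opp r = Suc (Suc r)" "opp (Suc r) = Suc r" by auto
  have a: "al z (Suc r) (Suc (Suc r)) = z * eta / D1 z" "al z r (Suc (Suc r)) = z * eta / D1 z" "al z (Suc r) (Suc r) = 1"
    by (simp_all add: al_def)
  have r1: "rho z k r = (if k = r then z * eta / D1 z else 0)
    + (if k = Suc (Suc r) then be z else 0) + gz z * Qc z k r"
    using rho_eq[of k r z] k r2 unfolding o a by auto
  have r2: "rho z k (Suc r) = (if k = Suc r then 1 else 0) + gz z * Qc z k (Suc r)"
    using rho_eq[of k "Suc r" z] k r2 unfolding o a by auto
  have evS: "ev (Suc r) = - (1 / s) * ev r" using ev_r by simp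
  consider "k < r" | "k = r" | "k = Suc r" | "k = Suc (Suc r)" | "k > Suc (Suc r)" by linarith
  then show ?thesis
  proof cases
    case 1
    then have e: "Qc z k (Suc r) = - (1 / s) * Qc z k r"
      by (intro Qc_cancel[OF evS]) auto
    show ?thesis unfolding r1 r2  e using 1 by (simp add: field_simps)
  next
    case 2
    then have e: "Qc z k (Suc r) = - (1 / s) * Qc z k r"
      by (intro Qc_cancel[OF evS]) auto
    show ?thesis unfolding r1 r2 a  e using 2 by (simp add: field_simps)
  next
    case 3
    have Q: "Qc z k r = - (z * s / u)" "Qc z k (Suc r) = a0 z" using 3 ev_r by (simp_all add: Qc_def)
    have "- (gz z * z / u) + 1 + gz z * a0 z = be z + z * eta / D1 z"
      unfolding scalar_id3[OF z] by (simp add: be_def add_divide_distrib diff_divide_distrib)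
    then show ?thesis unfolding r1 r2 a Q using 3 by (simp add: algebra_simps)
  next
    case 4
    have "Qc z k r = a1 z" "Qc z k (Suc r) = u / s" using 4 ev_r by (simp_all add: Qc_def inverse_eq_divide)
    then show ?thesis unfolding r1 r2 a using 4 scalar_id2[OF z]
      by (simp add: power2_eq_square inverse_eq_divide) (simp add: algebra_simps)
  next
    case 5
    then have e: "Qc z k (Suc r) = - (1 / s) * Qc z k r"
      by (intro Qc_cancel[OF evS]) auto
    show ?thesis unfolding r1 r2  e using 5 by (simp add: field_simps)
  qed
qed

text \<open>The other middle edge: the antidiagonal is now met in the rows \<open>r\<close> and
  \<open>Suc r\<close>.\<close>

lemma comm_ZN_mid2:
  assumes k: "k \<in> {1..2*r+1}" and z: "good z"
  shows "rho z k (Suc r) + s * rho z k (Suc (Suc r)) =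
    (if k = Suc r then al z (Suc (Suc r)) (Suc r) else 0) + (if k = r then inverse s * be z else 0)
    + (if k = Suc (Suc r) then s * al z (Suc (Suc r)) (Suc r) else 0) + (if k = Suc r then be z else 0)"
proof -
  have o: "opp (Suc (Suc r)) = r" "opp (Suc r) = Suc r" by auto
  have a: "al z (Suc (Suc r)) (Suc r) = eta / D1 z" "al z (Suc (Suc r)) r = eta / D1 z" "al z (Suc r) (Suc r) = 1"
    by (simp_all add: al_def)
  have r1: "rho z k (Suc (Suc r)) = (if k = Suc (Suc r) then eta / D1 z else 0)
    + (if k = r then be z else 0) + gz z * Qc z k (Suc (Suc r))"
    using rho_eq[of k "Suc (Suc r)" z] k r2 unfolding o a by auto
  have r2: "rho z k (Suc r) = (if k = Suc r then 1 else 0) + gz z * Qc z k (Suc r)"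
    using rho_eq[of k "Suc r" z] k r2 unfolding o a by auto
  have evS: "ev (Suc (Suc r)) = - (1 / s) * ev (Suc r)" using ev_r by (simp add: inverse_eq_divide)
  consider "k < r" | "k = r" | "k = Suc r" | "k = Suc (Suc r)" | "k > Suc (Suc r)" by linarith
  then show ?thesis
  proof cases
    case 1
    then have e: "Qc z k (Suc (Suc r)) = - (1 / s) * Qc z k (Suc r)"
      by (intro Qc_cancel[OF evS]) auto
    show ?thesis unfolding r1 r2  e using 1 by (simp add: field_simps)
  next
    case 2
    have "Qc z k (Suc r) = - (z * s / u)" "Qc z k (Suc (Suc r)) = a1 z" using 2 ev_r by (simp_all add: Qc_def)
    then show ?thesis unfolding r1 r2 a using 2 scalar_id1[OF z] 
      by (simp add: power2_eq_square inverse_eq_divide) (simp add: algebra_simps)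
  next
    case 3
    have "Qc z k (Suc r) = a0 z" "Qc z k (Suc (Suc r)) = u / s" using 3 ev_r by (simp_all add: Qc_def inverse_eq_divide)
    then show ?thesis unfolding r1 r2 a using 3 scalar_id5[OF z]
      by (simp add: be_def add_divide_distrib[symmetric] add_diff_eq)
  next
    case 4
    then have e: "Qc z k (Suc (Suc r)) = - (1 / s) * Qc z k (Suc r)"
      by (intro Qc_cancel[OF evS]) auto
    show ?thesis unfolding r1 r2 a  e using 4 by (simp add: field_simps)
  next
    case 5
    then have e: "Qc z k (Suc (Suc r)) = - (1 / s) * Qc z k (Suc r)"
      by (intro Qc_cancel[OF evS]) auto
    show ?thesis unfolding r1 r2  e using 5 by (simp add: field_simps)
  qed
qed

lemma comm_ZN:
  assumes i: "i \<in> {1..r}" and kl: "k \<in> {1..2*r+1}" "l \<in> {1..2*r+1}" "m \<in> {1..2*r+1}" "n \<in> {1..2*r+1}"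
    and row: "k + l = 2 * r + 2" and col: "m + n \<noteq> 2 * r + 2" and z: "good z"
  shows "Cl i z k l m n = Cr i z k l m n"
proof -
  obtain M N where M: "m = Suc M" and N: "n = Suc N"
    using assms by (metis atLeastAtMost_iff not0_implies_Suc not_one_le_zero)
  have R: "Cr i z k l m n = (if raises i k then s powi fund_wt r i l * Af z (k + 1) l m n else 0)
    + (if raises i l then s powi (- fund_wt r i k) * Af z k (l + 1) m n else 0)"
    unfolding Cr_def using col by (simp add: Rf_Af)
  have L: "Cl i z k l m n = (if raises i M then s powi fund_wt r i n * Rf z k l M n else 0)
    + (if raises i N then s powi (- fund_wt r i m) * Rf z k l m N else 0)"
    unfolding Cl_def by (simp add: M N)
  \<comment> \<open>\<open>E\<^sub>i\<close> lowers the index sum by one and the candidate preserves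
    it, so only columns of sum \<open>2 * r + 3\<close> can reach a row of weight zero.\<close>
  show ?thesis
  proof (cases "m + n = 2 * r + 3")
    case False
    then have "Rf z k l M n = 0" "Rf z k l m N = 0" using row M N by (intro Rf_weight; simp)+
    moreover have "Af z (k + 1) l m n = 0" "Af z k (l + 1) m n = 0" using row False by (intro Af_weight; simp)+
    ultimately show ?thesis unfolding L R by simp
  next
    case True
    then have MN: "M + N = 2 * r + 1" using M N by simp
    have rMN: "raises i N \<longleftrightarrow> raises i M" using MN i unfolding raises_def by auto
    show ?thesis
    proof (cases "raises i M")
      case False
      have "Af z (k + 1) l m n = 0" if "raises i k"
      proof -
        have "k \<noteq> M" "k \<noteq> N" using False rMN that by blast+
        then show ?thesis unfolding Af_def M N by simp
      qed
      moreover have "Af z k (l + 1) m n = 0" if "raises i l"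
      proof -
        have "l \<noteq> M" "l \<noteq> N" using False rMN that by blast+
        then show ?thesis unfolding Af_def M N by simp
      qed
      ultimately show ?thesis unfolding L R using False rMN by simp
    next
      case rM: True
      then have rN: "raises i N" using rMN by simp
      have l: "l = opp k" using row by simp
      have oM: "opp M = n" "opp m = N" using MN M N by auto
      have bM: "1 \<le> M" "M \<le> 2 * r" using raises_le[OF i rM] by auto
      have NM: "N = 2 * r + 1 - M" using MN by simp
      have L': "Cl i z k l m n = s powi fund_wt r i n * rho z k M + s powi (- fund_wt r i m) * rho z k m"
        unfolding L rho_def oM l[symmetric] using rM rN by simp
      have A1: "Af z (k + 1) l m n = (if k = M then al z m n else 0) + (if k = N then be z else 0)"
      proof -
        have "k = M \<longleftrightarrow> l = n" "k = N \<longleftrightarrow> l = m" using row MN M N by auto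
        moreover have "M \<noteq> N" using MN by presburger
        ultimately show ?thesis unfolding Af_def M N by auto
      qed
      have A2: "Af z k (l + 1) m n = (if k = m then al z m n else 0) + (if k = n then be z else 0)"
      proof -
        have "k = m \<longleftrightarrow> l = N" "k = n \<longleftrightarrow> l = M" using row MN M N by auto
        moreover have "M \<noteq> N" using MN by presburger
        ultimately show ?thesis unfolding Af_def M N by auto
      qed
      have B1: "(if raises i k then s powi fund_wt r i l * Af z (k + 1) l m n else 0)
        = (if k = M then s powi fund_wt r i n * al z m n else 0) + (if k = N then s powi fund_wt r i m * be z else 0)"
      proof -
        have "k = M \<Longrightarrow> l = n" "k = N \<Longrightarrow> l = m" using row MN M N by auto
        moreover have "M \<noteq> N" using MN by presburger
        ultimately show ?thesis unfolding A1 using rM rN by auto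
      qed
      have ln: "k = m \<Longrightarrow> l = N" "k = n \<Longrightarrow> l = M" using row MN M N by auto
      have B2: "(if raises i l then s powi (- fund_wt r i k) * Af z k (l + 1) m n else 0)
        = (if k = m then s powi (- fund_wt r i m) * al z m n else 0) + (if k = n then s powi (- fund_wt r i n) * be z else 0)"
        unfolding A2 using rM rN ln by (auto simp: distrib_left)
      have R': "Cr i z k l m n = 
        (if k = M then s powi fund_wt r i n * al z m n else 0) + (if k = N then s powi fund_wt r i m * be z else 0)
        + (if k = m then s powi (- fund_wt r i m) * al z m n else 0) + (if k = n then s powi (- fund_wt r i n) * be z else 0)"
        unfolding R B1 B2 by simp
      consider "M = r" | "M = r + 1" | "M \<noteq> r" "M \<noteq> r + 1" by blast
      then show ?thesis
      proof cases
        case 1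
        have ir: "i = r" using rM i 1 unfolding raises_def by auto
        have mn: "m = Suc r" "n = Suc (Suc r)" "N = Suc r" using M N MN 1 by auto
        have w: "fund_wt r i m = 0" "fund_wt r i n = -1" unfolding ir fund_wt_r mn by auto
        show ?thesis unfolding L' R' w using comm_ZN_mid1[OF kl(1) z] unfolding mn 1 by simp
      next
        case 2
        have ir: "i = r" using rM i 2 unfolding raises_def by auto
        have mn: "m = Suc (Suc r)" "n = Suc r" "N = r" using M N MN 2 by auto
        have w: "fund_wt r i m = -1" "fund_wt r i n = 0" unfolding ir fund_wt_r mn by auto
        show ?thesis unfolding L' R' w using comm_ZN_mid2[OF kl(1) z] unfolding mn 2 by simp
      next
        case 3
        have w: "fund_wt r i m = -1" "fund_wt r i n = -1"
          unfolding M N by (rule wt_lowered[OF i]; use 3 rM rN MN in simp)+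
        show ?thesis unfolding L' R' w
          using comm_ZN_generic[OF bM 3 kl(1) z NM] unfolding M N by simp
      qed
    qed
  qed
qed

text \<open>The index sums on the two sides differ by the one step of
  \<open>E\<^sub>i\<close>.\<close>

lemma comm_ZZ:
  assumes i: "i \<in> {1..r}" and kl: "k \<in> {1..2*r+1}" "l \<in> {1..2*r+1}" "m \<in> {1..2*r+1}" "n \<in> {1..2*r+1}"
    and "k + l = 2 * r + 2" "m + n = 2 * r + 2"
  shows "Cl i z k l m n = Cr i z k l m n"
proof -
  have "Rf z k l (m - 1) n = 0" "Rf z k l m (n - 1) = 0" "Rf z (k + 1) l m n = 0" "Rf z k (l + 1) m n = 0"
    by (rule Rf_weight; use assms in auto)+
  then show ?thesis unfolding Cl_def Cr_def by simp
qed

lemma Cl_eq_Cr: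
  assumes i: "i \<in> {1..r}" and kl: "k \<in> {1..2*r+1}" "l \<in> {1..2*r+1}" "m \<in> {1..2*r+1}" "n \<in> {1..2*r+1}"
    and z: "good z"
  shows "Cl i z k l m n = Cr i z k l m n"
proof -
  have o: "opp k \<in> {1..2*r+1}" "opp l \<in> {1..2*r+1}" "opp m \<in> {1..2*r+1}" "opp n \<in> {1..2*r+1}"
     "opp (opp k) = k" "opp (opp l) = l" "opp (opp m) = m" "opp (opp n) = n"
    using kl by auto
  consider "k + l \<noteq> 2 * r + 2" "m + n \<noteq> 2 * r + 2" | "k + l = 2 * r + 2" "m + n \<noteq> 2 * r + 2"
    | "k + l \<noteq> 2 * r + 2" "m + n = 2 * r + 2" | "k + l = 2 * r + 2" "m + n = 2 * r + 2" by blast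
  then show ?thesis
  proof cases
    case 3
    have "opp n + opp m = 2 * r + 2" "opp l + opp k \<noteq> 2 * r + 2" using 3 kl by auto
    then have "Cl i z (opp n) (opp m) (opp l) (opp k) = Cr i z (opp n) (opp m) (opp l) (opp k)"
      by (intro comm_ZN[OF i o(4,3,2,1) _ _ z])
    then show ?thesis using Cr_opp[OF i kl, of z] Cr_opp[OF i o(4,3,2,1), of z] unfolding o by simp
  qed (use comm_NN[OF i kl _ _ z] comm_ZN[OF i kl _ _ z] comm_ZZ[OF i kl] in blast)+
qed


section \<open>Commutation with the affine generator\<close>

text \<open>The entries of \<open>R E\<^sub>0\<close> and \<open>E\<^sub>0 R\<close> divided by the second spectral parameter, where \<open>z = a / b\<close>.\<close>

definition C0l :: "complex \<Rightarrow> nat \<Rightarrow> nat \<Rightarrow> nat \<Rightarrow> nat \<Rightarrow> complex" where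
  "C0l z k l m n =
    (if m = 1 then z * s powi fund_wt r 0 n * Rf z k l (2 * r + 1) n else 0)
    + (if n = 1 then s powi (- fund_wt r 0 m) * Rf z k l m (2 * r + 1) else 0)"

definition C0r :: "complex \<Rightarrow> nat \<Rightarrow> nat \<Rightarrow> nat \<Rightarrow> nat \<Rightarrow> complex" where
  "C0r z k l m n =
    (if k = 2 * r + 1 then s powi fund_wt r 0 l * Rf z 1 l m n else 0)
    + (if l = 2 * r + 1 then z * s powi (- fund_wt r 0 k) * Rf z k 1 m n else 0)"

lemma C0r_opp:
  assumes "k \<in> {1..2*r+1}" "l \<in> {1..2*r+1}" "m \<in> {1..2*r+1}" "n \<in> {1..2*r+1}"
  shows "C0r z k l m n = C0l z (opp n) (opp m) (opp l) (opp k)"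
proof -
  have 1: "Rf z (opp n) (opp m) (opp l) (2 * r + 1) = Rf z 1 l m n"
    using Rf_sym[of 1 l m n z] assms by simp
  have 2: "Rf z (opp n) (opp m) (2 * r + 1) (opp k) = Rf z k 1 m n"
    using Rf_sym[of k 1 m n z] assms by simp
  have 3: "opp k = 1 \<longleftrightarrow> k = 2 * r + 1" "opp l = 1 \<longleftrightarrow> l = 2 * r + 1" using assms by auto
  have 4: "fund_wt r 0 (opp l) = - fund_wt r 0 l" "fund_wt r 0 (opp k) = - fund_wt r 0 k"
    using assms by (intro fund_wt_opp; simp)+
  show ?thesis
    unfolding C0r_def C0l_def 1 2 3 4 by simp
qed

text \<open>The column belongs to the square of the first basis vector, the only one on which both
  terms of \<open>E\<^sub>0\<close> act; it is sent to the two corners of weight zero. In all other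
  rows the values of \<open>ev\<close> at the two ends, which are inverse to each other, make the
  terms cancel.\<close>

lemma comm0_corner:
  assumes k: "k \<in> {1..2*r+1}" and z: "good z"
  shows "z / s ^ 2 * rho z k (2 * r + 1) + s ^ 2 * rho z k 1 =
    (if k = 2 * r + 1 then 1 / s ^ 2 else 0) + (if k = 1 then z * s ^ 2 else 0)"
proof -
  have o: "opp 1 = 2 * r + 1" "opp (2 * r + 1) = 1" by auto
  have a: "al z 1 (2 * r + 1) = z * eta / D1 z" "al z (2 * r + 1) 1 = eta / D1 z"
    using r2 by (simp_all add: al_def)
  have r1: "rho z k 1 = (if k = 1 then z * eta / D1 z else 0)
    + (if k = 2 * r + 1 then be z else 0) + gz z * Qc z k 1"
    using rho_eq[of k 1 z] k r2 unfolding o a by auto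
  have rN: "rho z k (2 * r + 1) = (if k = 2 * r + 1 then eta / D1 z else 0)
    + (if k = 1 then be z else 0) + gz z * Qc z k (2 * r + 1)"
    using rho_eq[of k "2 * r + 1" z] k r2 unfolding o a by auto
  have sq: "(-1) ^ r * (-1) ^ r = (1::complex)" by (simp flip: power_mult_distrib)
  consider "k = 1" | "k = 2 * r + 1" | "1 < k" "k < 2 * r + 1" using k by fastforce
  then show ?thesis
  proof cases
    case 1
    have "Qc z k 1 = z * (ev 1 * ev 1) / u" using 1 r2 by (simp add: Qc_def)
    also have "ev 1 * ev 1 = u ^ 2 / s ^ 4" unfolding ev_1 using sq by (simp add: field_simps power_numeral_reduce)
    finally have Q1: "Qc z k 1 = z * u / s ^ 4" by (simp add: power2_eq_square)
    have QN: "Qc z k (2 * r + 1) = a1 z" using 1 r2 by (simp add: Qc_def)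
    show ?thesis unfolding r1 rN Q1 QN using 1 r2 scalar_id6[OF z] by (simp add: algebra_simps)
  next
    case 2
    have "Qc z k (2 * r + 1) = - (ev (2 * r + 1) * ev (2 * r + 1)) * u" using 2 r2 by (simp add: Qc_def)
    also have "ev (2 * r + 1) * ev (2 * r + 1) = s ^ 4 / u ^ 2" unfolding ev_N using sq by (simp add: field_simps power_numeral_reduce)
    finally have QN: "Qc z k (2 * r + 1) = - (s ^ 4 / u)" by (simp add: power2_eq_square)
    have Q1: "Qc z k 1 = a1 z" using 2 r2 by (simp add: Qc_def)
    show ?thesis unfolding r1 rN Q1 QN using 2 r2 scalar_id7[OF z] by (simp add: algebra_simps)
  next
    case 3
    have Q: "Qc z k 1 = z * ev k * ev 1 / u" "Qc z k (2 * r + 1) = - (ev k * ev (2 * r + 1) * u)"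
      using 3 by (simp_all add: Qc_def)
    show ?thesis unfolding r1 rN Q ev_1 ev_N using 3 by (simp add: field_simps)
  qed
qed

text \<open>\<open>E\<^sub>0\<close> raises the index sum by \<open>2 * r\<close>, so a row of
  weight zero is reached only from \<open>m = n = 1\<close>.\<close>

lemma C0l_eq_C0r_ZN:
  assumes kl: "k \<in> {1..2*r+1}" "l \<in> {1..2*r+1}" "m \<in> {1..2*r+1}" "n \<in> {1..2*r+1}"
    and row: "k + l = 2 * r + 2" and col: "m + n \<noteq> 2 * r + 2" and z: "good z"
  shows "C0l z k l m n = C0r z k l m n"
proof (cases "m = 1 \<and> n = 1")
  case True
  have l: "l = opp k" using row by simp
  have w: "fund_wt r 0 1 = -2" "fund_wt r 0 (2 * r + 1) = 2" using r2 by (simp_all add: fund_wt_0)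
  have "C0l z k l m n = z / s ^ 2 * rho z k (2 * r + 1) + s ^ 2 * rho z k 1"
    using True unfolding C0l_def rho_def l w[simplified] 
    by (simp add: w[simplified] power_int_minus inverse_eq_divide)
  moreover have "C0r z k l m n = (if k = 2 * r + 1 then 1 / s ^ 2 else 0) + (if k = 1 then z * s ^ 2 else 0)"
    using True l r2 row unfolding C0r_def
    by (auto simp: w[simplified] Rf_def Af_def al_def power_int_minus inverse_eq_divide)
  ultimately show ?thesis using comm0_corner[OF kl(1) z] by simp
next
  case False
  then have mn: "m + n > 2" "m = 1 \<Longrightarrow> n > 1" "n = 1 \<Longrightarrow> m > 1" using kl by auto
  have "Rf z k l (2 * r + 1) n = 0" if "m = 1" using mn that row by (intro Rf_weight) auto
  moreover have "Rf z k l m (2 * r + 1) = 0" if "n = 1" using mn that row by (intro Rf_weight) auto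
  moreover have "Rf z 1 l m n = 0" if "k = 2 * r + 1" using mn that row by (intro Rf_weight) auto
  moreover have "Rf z k 1 m n = 0" if "l = 2 * r + 1" using mn that row by (intro Rf_weight) auto
  ultimately show ?thesis unfolding C0l_def C0r_def by simp
qed

text \<open>\<open>E\<^sub>0\<close> carries an index from the bottom to the top of the order and
  thereby exchanges the two triangular coefficients of \<open>al\<close>. Their ratio is
  \<open>z\<close>, exactly the ratio of the spectral parameters.\<close>

lemma C0l_eq_C0r_NN:
  assumes kl: "k \<in> {1..2*r+1}" "l \<in> {1..2*r+1}" "m \<in> {1..2*r+1}" "n \<in> {1..2*r+1}"
    and row: "k + l \<noteq> 2 * r + 2" and col: "m + n \<noteq> 2 * r + 2"
  shows "C0l z k l m n = C0r z k l m n"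
proof -
  let ?N = "2 * r + 1"
  have L: "C0l z k l m n = (if m = 1 then z * s powi fund_wt r 0 n * Af z k l ?N n else 0)
    + (if n = 1 then s powi (- fund_wt r 0 m) * Af z k l m ?N else 0)"
    unfolding C0l_def using row by (simp add: Rf_Af)
  have R: "C0r z k l m n = (if k = ?N then s powi fund_wt r 0 l * Af z 1 l m n else 0)
    + (if l = ?N then z * s powi (- fund_wt r 0 k) * Af z k 1 m n else 0)"
    unfolding C0r_def using col by (simp add: Rf_Af)
  consider "m = 1" "n = 1" | "m = 1" "1 < n" "n < ?N" | "n = 1" "1 < m" "m < ?N" | "m \<noteq> 1" "n \<noteq> 1"
    using kl col by fastforce
  then show ?thesis
  proof cases
    case 1
    have "Af z k l ?N n = 0" "Af z k l m ?N = 0" using 1 row by (intro Af_weight; simp)+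
    moreover have "k = ?N \<Longrightarrow> Af z 1 l m n = 0" "l = ?N \<Longrightarrow> Af z k 1 m n = 0"
      using 1 row by (intro Af_weight; simp)+
    ultimately show ?thesis unfolding L R by simp
  next
    case 2
    have w: "fund_wt r 0 n = 0" using 2 by (simp add: fund_wt_0)
    have al: "al z 1 n = z * eta / D1 z" "al z ?N n = eta / D1 z" using 2 by (simp_all add: al_def)
    have "k = n \<Longrightarrow> fund_wt r 0 k = 0" "l = n \<Longrightarrow> fund_wt r 0 l = 0" using w by auto
    then show ?thesis unfolding L R Af_def using 2 w al by auto
  next
    case 3
    have w: "fund_wt r 0 m = 0" using 3 by (simp add: fund_wt_0)
    have al: "al z m 1 = eta / D1 z" "al z m ?N = z * eta / D1 z" using 3 by (simp_all add: al_def)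
    have "k = m \<Longrightarrow> fund_wt r 0 k = 0" "l = m \<Longrightarrow> fund_wt r 0 l = 0" using w by auto
    then show ?thesis unfolding L R Af_def using 3 w al by auto
  next
    case 4
    then have "Af z 1 l m n = 0" "Af z k 1 m n = 0" unfolding Af_def by auto
    then show ?thesis unfolding L R using 4 by simp
  qed
qed

lemma C0l_eq_C0r:
  assumes kl: "k \<in> {1..2*r+1}" "l \<in> {1..2*r+1}" "m \<in> {1..2*r+1}" "n \<in> {1..2*r+1}"
    and z: "good z"
  shows "C0l z k l m n = C0r z k l m n"
proof -
  have o: "opp k \<in> {1..2*r+1}" "opp l \<in> {1..2*r+1}" "opp m \<in> {1..2*r+1}" "opp n \<in> {1..2*r+1}"
     "opp (opp k) = k" "opp (opp l) = l" "opp (opp m) = m" "opp (opp n) = n"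
    using kl by auto
  consider "k + l \<noteq> 2 * r + 2" "m + n \<noteq> 2 * r + 2" | "k + l = 2 * r + 2" "m + n \<noteq> 2 * r + 2"
    | "k + l \<noteq> 2 * r + 2" "m + n = 2 * r + 2" | "k + l = 2 * r + 2" "m + n = 2 * r + 2" by blast
  then show ?thesis
  proof cases
    case 3
    have "opp n + opp m = 2 * r + 2" "opp l + opp k \<noteq> 2 * r + 2" using 3 kl by auto
    then have "C0l z (opp n) (opp m) (opp l) (opp k) = C0r z (opp n) (opp m) (opp l) (opp k)"
      by (intro C0l_eq_C0r_ZN[OF o(4,3,2,1) _ _ z])
    then show ?thesis using C0r_opp[OF kl, of z] C0r_opp[OF o(4,3,2,1), of z] unfolding o by simp
  next
    case 4
    have "m = 1 \<Longrightarrow> Rf z k l (2 * r + 1) n = 0" "n = 1 \<Longrightarrow> Rf z k l m (2 * r + 1) = 0"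
       "k = 2 * r + 1 \<Longrightarrow> Rf z 1 l m n = 0" "l = 2 * r + 1 \<Longrightarrow> Rf z k 1 m n = 0"
      using 4 r2 by (intro Rf_weight; simp)+
    then show ?thesis unfolding C0l_def C0r_def by simp
  qed (use C0l_eq_C0r_NN[OF kl] C0l_eq_C0r_ZN[OF kl _ _ z] in blast)+
qed

section \<open>The candidate as a module homomorphism\<close>

lemma Rm_sym: "transpose (Rm z) = Rm z"
  unfolding transpose_def Rm_def vec_eq_iff by (simp, intro allI, rule Rf_transpose)

lemma Rm_E:
  assumes i: "i \<in> {1..r}" and z: "good z"
  shows "Rm z ** Eact (VV a b) i = Eact (VV a' b') i ** Rm z"
proof -
  have "(Rm z ** Eact (VV a b) i) $ (x, y) $ (x', y') = (Eact (VV a' b') i ** Rm z) $ (x, y) $ (x', y')" for x y x' y'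
  proof -
    have b: "raises i k \<Longrightarrow> pos (idx k) = k" "raises i k \<Longrightarrow> pos (idx (Suc k)) = Suc k" for k
      using raises_le[OF i, of k] by simp_all
    have "(Rm z ** Eact (VV a b) i) $ (x, y) $ (x', y') = coef i * Cl i z (pos x) (pos y) (pos x') (pos y')"
      unfolding matrix_matrix_mult_def using sum_E_col[OF i, of "\<lambda>u. Rm z $ (x, y) $ u"]
      by (simp add: Cl_def Rm_entry b)
    moreover have "(Eact (VV a' b') i ** Rm z) $ (x, y) $ (x', y') = coef i * Cr i z (pos x) (pos y) (pos x') (pos y')"
      unfolding matrix_matrix_mult_def using sum_E_row[OF i, of a' b' x y "\<lambda>u. Rm z $ u $ (x', y')"]
      by (simp add: Cr_def Rm_entry b)
    ultimately show ?thesis using Cl_eq_Cr[OF i _ _ _ _ z, of "pos x" "pos y" "pos x'" "pos y'"] by simp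
  qed
  then show ?thesis by (simp add: vec_eq_iff)
qed

lemma Rm_E0:
  assumes a: "a \<noteq> 0" "b \<noteq> 0" and z: "good (a / b)"
  shows "Rm (a / b) ** Eact (VV a b) 0 = Eact (VV b a) 0 ** Rm (a / b)"
proof -
  let ?z = "a / b"
  have "(Rm ?z ** Eact (VV a b) 0) $ (x, y) $ (x', y') = (Eact (VV b a) 0 ** Rm ?z) $ (x, y) $ (x', y')" for x y x' y'
  proof -
    have "(Rm ?z ** Eact (VV a b) 0) $ (x, y) $ (x', y') = b * C0l ?z (pos x) (pos y) (pos x') (pos y')"
      unfolding matrix_matrix_mult_def using sum_E0_col[of "\<lambda>u. Rm ?z $ (x, y) $ u"] a
      by (simp add: C0l_def Rm_entry algebra_simps)
    moreover have "(Eact (VV b a) 0 ** Rm ?z) $ (x, y) $ (x', y') = b * C0r ?z (pos x) (pos y) (pos x') (pos y')"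
      unfolding matrix_matrix_mult_def using sum_E0_row[of b a x y "\<lambda>u. Rm ?z $ u $ (x', y')"] a
      by (simp add: C0r_def Rm_entry algebra_simps)
    ultimately show ?thesis using C0l_eq_C0r[OF _ _ _ _ z, of "pos x" "pos y" "pos x'" "pos y'"] by simp
  qed
  then show ?thesis by (simp add: vec_eq_iff)
qed

lemma Rm_F:
  assumes i: "i \<in> {1..r}" and z: "good z"
  shows "Rm z ** Fact (VV a b) i = Fact (VV a' b') i ** Rm z"
  using arg_cong[OF Rm_E[OF i z, of a' b' a b], of transpose]
  by (simp add: matrix_transpose_mul Rm_sym VV_F_transpose[OF i])

lemma smult_mat_mult: "(t *\<^sub>m A) ** B = t *\<^sub>m (A ** B)" "A ** (t *\<^sub>m B) = t *\<^sub>m (A ** B)"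
  for A B :: "complex^'m::finite^'m"
  by (simp_all add: smult_mat_def matrix_matrix_mult_def vec_eq_iff sum_distrib_left algebra_simps)

lemma smult_mat_cancel: "t \<noteq> 0 \<Longrightarrow> t *\<^sub>m A = t *\<^sub>m B \<Longrightarrow> A = B"
  by (simp add: smult_mat_def vec_eq_iff)

text \<open>Transposing the relation for \<open>E\<^sub>0\<close> exchanges its sides and replaces
  \<open>E\<^sub>0\<close> by \<open>F\<^sub>0\<close> scaled by \<open>a * b\<close>; the factor is
  symmetric in the two parameters and cancels.\<close>

lemma Rm_F0:
  assumes a: "a \<noteq> 0" "b \<noteq> 0" and z: "good (a / b)"
  shows "Rm (a / b) ** Fact (VV a b) 0 = Fact (VV b a) 0 ** Rm (a / b)"
proof (rule smult_mat_cancel)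
  show "a * b \<noteq> 0" using a by simp
  have "transpose (Eact (VV b a) 0 ** Rm (a / b)) = transpose (Rm (a / b) ** Eact (VV a b) 0)"
    by (simp add: Rm_E0[OF assms])
  then have "Rm (a / b) ** ((a * b) *\<^sub>m Fact (VV a b) 0) = ((b * a) *\<^sub>m Fact (VV b a) 0) ** Rm (a / b)"
    unfolding matrix_transpose_mul Rm_sym VV_F0_transpose[OF a] VV_F0_transpose[OF a(2,1)] .
  then show "(a * b) *\<^sub>m (Rm (a / b) ** Fact (VV a b) 0) = (a * b) *\<^sub>m (Fact (VV b a) 0 ** Rm (a / b))"
    by (simp add: smult_mat_mult mult.commute)
qed

lemma VV_wt: "wt (VV a b) i (x, y) = fund_wt r i (pos x) + fund_wt r i (pos y)"
  by (simp add: tensor_qmod_def)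

lemma Rf_wt:
  assumes "i \<le> r" "k \<in> {1..2*r+1}" "l \<in> {1..2*r+1}" "m \<in> {1..2*r+1}" "n \<in> {1..2*r+1}" "Rf z k l m n \<noteq> 0"
  shows "fund_wt r i k + fund_wt r i l = fund_wt r i m + fund_wt r i n"
proof -
  have "Rf z k l m n = 0" if "\<not> (k = m \<and> l = n)" "\<not> (k = n \<and> l = m)" "\<not> (k + l = 2 * r + 2 \<and> m + n = 2 * r + 2)"
    unfolding Rf_def Af_def using that by (simp only: if_False simp_thms add_0_left if_cancel) auto
  then consider "k = m" "l = n" | "k = n" "l = m" | "k + l = 2 * r + 2" "m + n = 2 * r + 2"
    using assms(6) by blast
  then show ?thesis
  proof cases
    case 3
    then have "l = opp k" "n = opp m" by auto
    then show ?thesis using fund_wt_opp[of i k] fund_wt_opp[of i m] assms by simp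
  qed auto
qed

lemma Khalf_comm_iff:
  "A ** Khalf s (VV a b) i j = Khalf s (VV a' b') i j ** A \<longleftrightarrow>
    (\<forall>p p'. A $ p $ p' * s powi (j * wt (VV a b) i p') = s powi (j * wt (VV a b) i p) * A $ p $ p')"
proof -
  have w: "wt (VV a' b') i p = wt (VV a b) i p" for p by (cases p) (simp add: VV_wt)
  show ?thesis
    unfolding vec_eq_iff matrix_matrix_mult_def Khalf_def w by (simp add: if_distrib if_distribR cong: if_cong)
qed

lemma Rm_K:
  assumes i: "i \<le> r"
  shows "Rm z ** Khalf s (VV a b) i j = Khalf s (VV a' b') i j ** Rm z"
  unfolding Khalf_comm_iff
proof (intro allI)
  fix p p' :: "'n \<times> 'n"
  obtain x y x' y' where p: "p = (x, y)" "p' = (x', y')" by fastforce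
  show "Rm z $ p $ p' * s powi (j * wt (VV a b) i p') = s powi (j * wt (VV a b) i p) * Rm z $ p $ p'"
    using Rf_wt[OF i, of "pos x" "pos y" "pos x'" "pos y'" z] unfolding p VV_wt Rm_entry
    by (cases "Rf z (pos x) (pos y) (pos x') (pos y') = 0") simp_all
qed

lemma Rm_hom:
  assumes a: "a \<noteq> 0" "b \<noteq> 0" and z: "good (a / b)"
  shows "qmod_hom r s (VV a b) (VV b a) (Rm (a / b))"
  unfolding qmod_hom_def
proof (intro allI impI)
  fix i assume "i \<le> r"
  then consider "i = 0" | "i \<in> {1..r}" by fastforce
  then show "Rm (a / b) ** Eact (VV a b) i = Eact (VV b a) i ** Rm (a / b) \<and>
    Rm (a / b) ** Fact (VV a b) i = Fact (VV b a) i ** Rm (a / b) \<and>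
    Rm (a / b) ** Khalf s (VV a b) i 2 = Khalf s (VV b a) i 2 ** Rm (a / b)"
    by cases (use Rm_K[OF \<open>i \<le> r\<close>] Rm_E0[OF assms] Rm_F0[OF assms] Rm_E[OF _ z] Rm_F[OF _ z] in blast)+
qed

end

section \<open>The bilinear form and annihilators\<close>

text \<open>Bilinear, not sesquilinear: nonzero vectors may be isotropic.\<close>

definition bil :: "complex^'m::finite \<Rightarrow> complex^'m \<Rightarrow> complex" where
  "bil x y = (\<Sum>p\<in>UNIV. x $ p * y $ p)"

lemma bil_add_right: "bil x (y + z) = bil x y + bil x z"
  by (simp add: bil_def distrib_left sum.distrib)

lemma bil_scale_right: "bil x (t *s y) = t * bil x y"
  by (simp add: bil_def sum_distrib_left mult.left_commute)

lemma bil_commute: "bil x y = bil y x"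
  by (simp add: bil_def mult.commute)

lemma bil_transpose: "bil x (A *v y) = bil (transpose A *v x) y"
proof -
  have "bil x (A *v y) = (\<Sum>p\<in>UNIV. \<Sum>p'\<in>UNIV. x $ p * (A $ p $ p' * y $ p'))"
    by (simp add: bil_def matrix_vector_mult_def sum_distrib_left)
  also have "\<dots> = (\<Sum>p'\<in>UNIV. \<Sum>p\<in>UNIV. x $ p * (A $ p $ p' * y $ p'))"
    by (rule sum.swap)
  also have "\<dots> = bil (transpose A *v x) y"
    by (simp add: bil_def matrix_vector_mult_def transpose_def sum_distrib_left sum_distrib_right mult_ac)
  finally show ?thesis .
qed

text \<open>Isotropic vectors rule out orthogonal projection. Instead a linear map is built that
  vanishes on \<open>U\<close> and fixes a vector outside, and \<open>y\<close> is a row of its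
  matrix, chosen at a nonzero coordinate of that vector.\<close>

lemma proper_subspace_annihilator:
  fixes U :: "(complex^'m::finite) set"
  assumes "vec.subspace U" "U \<noteq> UNIV"
  shows "\<exists>y. y \<noteq> 0 \<and> (\<forall>x\<in>U. bil x y = 0)"
proof -
  obtain v where v: "v \<notin> U" using assms(2) by blast
  obtain B where B: "B \<subseteq> U" "vec.independent B" "U \<subseteq> vec.span B"
    by (rule vec.maximal_independent_subset[of U])
  have span: "vec.span B = U"
    using B vec.span_minimal[OF B(1) assms(1)] by blast
  have "vec.independent (insert v B)"
    using B v span by (simp add: vec.independent_insert)
  then obtain g where g: "Vector_Spaces.linear (*s) (*s) g" "\<forall>x\<in>insert v B. g x = (if x = v then v else 0)"
    using vec.linear_independent_extend[of "insert v B" "\<lambda>x. if x = v then v else 0"] by blast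
  have "v \<noteq> 0" using v assms(1) vec.subspace_0 by blast
  then obtain j where j: "v $ j \<noteq> 0" by (auto simp: vec_eq_iff)
  let ?y = "matrix g $ j"
  have gx: "bil x ?y = g x $ j" for x
  proof -
    have "g x $ j = (matrix g *v x) $ j" by (simp only: matrix_works[OF g(1)])
    then show ?thesis by (simp add: bil_def matrix_vector_mult_def mult.commute)
  qed
  have "g x = 0" if "x \<in> U" for x
  proof -
    have "\<forall>b\<in>B. g b = 0" using g(2) B(1) v by auto
    then show ?thesis
      using vec.linear_eq_0_on_span[OF g(1)] that span by blast
  qed
  then have "\<forall>x\<in>U. bil x ?y = 0" by (simp add: gx)
  moreover have "?y \<noteq> 0"
  proof
    assume "?y = 0"
    then have "bil v ?y = 0" by (simp add: bil_def)
    then show False using g(2) j by (simp add: gx)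
  qed
  ultimately show ?thesis by blast
qed

lemma sum_pair: "(\<Sum>u\<in>UNIV. h u) = (\<Sum>x\<in>UNIV. \<Sum>y\<in>UNIV. h (x, y))"
  for h :: "'a::finite \<times> 'b::finite \<Rightarrow> complex"
  by (simp add: sum.cartesian_product flip: UNIV_Times_UNIV)

section \<open>Highest weight vectors of the tensor square\<close>

context A2r_setting
begin

lemma pos_neq_0 [simp]: "pos x \<noteq> 0"
  using pos_range(3)[of x] by simp

abbreviation EE :: "nat \<Rightarrow> complex^('n \<times> 'n)^('n \<times> 'n)" where "EE i \<equiv> Eact (VV 1 1) i"
abbreviation FF :: "nat \<Rightarrow> complex^('n \<times> 'n)^('n \<times> 'n)" where "FF i \<equiv> Fact (VV 1 1) i"

lemma VV_indep:
  assumes "i \<in> {1..r}"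
  shows "Eact (VV a b) i = EE i" "Fact (VV a b) i = FF i" 
  by (simp_all add: VV_F_transpose[OF assms] vec_eq_iff VV_E_entry[OF assms] split_paired_all transpose_def)

lemma Khalf_indep: "Khalf s (VV a b) i n = Khalf s (VV 1 1) i n"
  by (simp add: Khalf_def VV_wt vec_eq_iff split_paired_all)

definition vec_of :: "(nat \<Rightarrow> nat \<Rightarrow> complex) \<Rightarrow> complex^('n \<times> 'n)" where
  "vec_of f = (\<chi> p. f (pos (fst p)) (pos (snd p)))"

lemma vec_of_nth: "vec_of f $ (x, y) = f (pos x) (pos y)"
  by (simp add: vec_of_def)

definition w1 :: "complex^('n \<times> 'n)" where
  "w1 = vec_of (\<lambda>k l. if k = 1 \<and> l = 1 then 1 else 0)"
definition w2 :: "complex^('n \<times> 'n)" where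
  "w2 = vec_of (\<lambda>k l. if k = 1 \<and> l = 2 then 1 else if k = 2 \<and> l = 1 then - (1 / s ^ 2) else 0)"
definition w0 :: "complex^('n \<times> 'n)" where
  "w0 = vec_of (\<lambda>k l. if k + l = 2 * r + 2 then ev k else 0)"

lemma w1_tensor: "w1 = basis_vec pos 1 \<otimes>\<^sub>v basis_vec pos 1"
  by (simp add: w1_def vec_of_def tensor_vec_def basis_vec_def vec_eq_iff)

lemma EE_nth:
  assumes "i \<in> {1..r}"
  shows "(EE i *v X) $ (x, y) =
    coef i * ((if raises i (pos x) then s powi fund_wt r i (pos y) * X $ (idx (pos x + 1), y) else 0)
     + (if raises i (pos y) then s powi (- fund_wt r i (pos x)) * X $ (x, idx (pos y + 1)) else 0))"
  unfolding matrix_vector_mult_def using sum_E_row[OF assms, of 1 1 x y "\<lambda>u. X $ u"] by simp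

lemma EE_vec_of:
  assumes i: "i \<in> {1..r}"
  shows "(EE i *v vec_of f) $ (x, y) =
    coef i * ((if raises i (pos x) then s powi fund_wt r i (pos y) * f (pos x + 1) (pos y) else 0)
     + (if raises i (pos y) then s powi (- fund_wt r i (pos x)) * f (pos x) (pos y + 1) else 0))"
proof -
  have b: "raises i k \<Longrightarrow> pos (idx (Suc k)) = Suc k" for k
    using raises_le[OF i, of k] by simp
  show ?thesis unfolding EE_nth[OF i] vec_of_nth by (simp add: b)
qed

text \<open>The recursion that \<open>E\<^sub>i\<close> imposes on the coefficients of a vector of
  weight zero that it annihilates. It gives the invariance of \<open>w0\<close> and, since every
  edge has a color, also its uniqueness up to a scalar.\<close>

lemma ev_rec:
  assumes i: "i \<in> {1..r}" "raises i k" and l: "k + l = 2 * r + 1"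
  shows "s powi fund_wt r i l * ev (Suc k) + s powi (- fund_wt r i k) * ev k = 0"
proof -
  have k: "1 \<le> k" "k \<le> 2 * r" using raises_le[OF i] by auto
  have rl: "raises i l" using i l unfolding raises_def by auto
  consider "k = r" | "k = r + 1" | "k \<noteq> r" "k \<noteq> r + 1" by blast
  then show ?thesis
  proof cases
    case 1
    then have "i = r" "l = r + 1" using i l unfolding raises_def by auto
    then show ?thesis using 1 by (simp add: fund_wt_r ev_r)
  next
    case 2
    then have "i = r" "l = r" using i l unfolding raises_def by auto
    moreover have "ev (Suc (Suc r)) = - inverse s" using ev_r by simp
    ultimately show ?thesis using 2 by (simp add: fund_wt_r)
  next
    case 3
    have "l \<noteq> r + 1" using 3 l by auto
    then have "fund_wt r i k = 1" "fund_wt r i l = 1" using wt_upper[OF i(1)] i(2) rl 3 by auto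
    then show ?thesis using ev_Suc[OF k 3] by (simp add: field_simps power2_eq_square)
  qed
qed

lemma raises_color:
  assumes "1 \<le> k" "k \<le> 2 * r"
  obtains i where "i \<in> {1..r}" "raises i k" "\<forall>l. raises i l \<longleftrightarrow> l = k \<or> l = 2 * r + 1 - k"
proof (cases "k \<le> r")
  case True
  then show ?thesis using that[of k] assms by (auto simp: raises_def)
next
  case False
  then have "2 * r + 1 - k \<in> {1..r}" using assms by auto
  moreover have "raises (2 * r + 1 - k) l \<longleftrightarrow> l = k \<or> l = 2 * r + 1 - k" for l
    using assms unfolding raises_def by auto
  ultimately show ?thesis using that by blast
qed

lemma EE_w1: assumes i: "i \<in> {1..r}" shows "EE i *v w1 = 0"
proof -
  have "(EE i *v w1) $ (x, y) = 0" for x y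
    unfolding w1_def EE_vec_of[OF i] by simp
  then show ?thesis by (simp add: vec_eq_iff)
qed

lemma EE_w2: assumes i: "i \<in> {1..r}" shows "EE i *v w2 = 0"
proof -
  have "(EE i *v w2) $ (x, y) = 0" for x y
  proof (cases "pos x = 1 \<and> pos y = 1")
    case True
    have "fund_wt r i 1 = 1" if "raises i 1" using wt_upper[OF i that] r2 by simp
    then show ?thesis unfolding w2_def EE_vec_of[OF i] using True
      by (simp add: power2_eq_square field_simps)
  next
    case False
    have "pos x + 1 \<noteq> 1" "pos y + 1 \<noteq> 1" "pos x + 1 = 2 \<longleftrightarrow> pos x = 1" "pos y + 1 = 2 \<longleftrightarrow> pos y = 1"
      using pos_range[of x] pos_range[of y] by auto
    then show ?thesis unfolding w2_def EE_vec_of[OF i] using False by auto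
  qed
  then show ?thesis by (simp add: vec_eq_iff)
qed

lemma EE_w0: assumes i: "i \<in> {1..r}" shows "EE i *v w0 = 0"
proof -
  have "(EE i *v w0) $ (x, y) = 0" for x y
  proof (cases "pos x + pos y = 2 * r + 1")
    case True
    have "raises i (pos y) \<longleftrightarrow> raises i (pos x)" using True i unfolding raises_def by auto
    then show ?thesis unfolding w0_def EE_vec_of[OF i] using True ev_rec[OF i _ True] by simp
  next
    case False
    then show ?thesis unfolding w0_def EE_vec_of[OF i] by simp
  qed
  then show ?thesis by (simp add: vec_eq_iff)
qed

text \<open>Where only one factor can be raised, the equation has a single term and kills a
  coefficient. This leaves the positions (1,1), (1,2), (2,1) and those of weight zero; the equations
  with two terms tie (2,1) to (1,2) and propagate the coefficients of weight zero from one end of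
  the chain to the other.\<close>

lemma kernel_EE:
  assumes "\<And>i. i \<in> {1..r} \<Longrightarrow> EE i *v x = 0"
  obtains \<alpha> \<beta> \<gamma> where "x = \<alpha> *s w1 + \<beta> *s w2 + \<gamma> *s w0"
proof -
  define X where "X k l = x $ (idx k, idx l)" for k l
  have rel: "(if raises i k then s powi fund_wt r i l * X (Suc k) l else 0)
     + (if raises i l then s powi (- fund_wt r i k) * X k (Suc l) else 0) = 0"
    if i: "i \<in> {1..r}" and "k \<in> {1..2*r+1}" "l \<in> {1..2*r+1}" for i k l
  proof -
    have "(EE i *v x) $ (idx k, idx l) = 0" using assms[OF i] by simp
    moreover have p: "pos (idx k) = k" "pos (idx l) = l" using that by simp_all
    ultimately show ?thesis unfolding EE_nth[OF i] X_def p Suc_eq_plus1 by simp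
  qed
  have left: "X (Suc k) l = 0" if h: "1 \<le> k" "k \<le> 2 * r" "l \<in> {1..2*r+1}" "l \<noteq> k" "l \<noteq> 2 * r + 1 - k" for k l
  proof -
    obtain i where i: "i \<in> {1..r}" "raises i k" "\<forall>l. raises i l \<longleftrightarrow> l = k \<or> l = 2 * r + 1 - k"
      by (rule raises_color[OF h(1,2)])
    have "\<not> raises i l" using that i(3) by simp
    then show ?thesis using rel[OF i(1), of k l] that i(2) by simp
  qed
  have right: "X k (Suc l) = 0" if h: "1 \<le> l" "l \<le> 2 * r" "k \<in> {1..2*r+1}" "k \<noteq> l" "k \<noteq> 2 * r + 1 - l" for k l
  proof -
    obtain i where i: "i \<in> {1..r}" "raises i l" "\<forall>k. raises i k \<longleftrightarrow> k = l \<or> k = 2 * r + 1 - l"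
      by (rule raises_color[OF h(1,2)])
    have "\<not> raises i k" using that i(3) by simp
    then show ?thesis using rel[OF i(1), of k l] that i(2) by simp
  qed
  have supp: "X k l = 0" if kl: "k \<in> {1..2*r+1}" "l \<in> {1..2*r+1}" and n: "\<not> (k = 1 \<and> l = 1)" "\<not> (k = 1 \<and> l = 2)"
    "\<not> (k = 2 \<and> l = 1)" "k + l \<noteq> 2 * r + 2" for k l
  proof -
    obtain K L where K: "k = Suc K" "l = Suc L" using kl
      by (metis atLeastAtMost_iff not0_implies_Suc not_one_le_zero)
    show ?thesis
    \<comment> \<open>Raising the first factor fails to isolate the coefficient if
      \<open>k = 1\<close>, where there is no edge, or if \<open>l = K\<close>, where both factors
      carry the same color; the second factor then does it.\<close>
    proof (cases "1 \<le> K \<and> l \<noteq> K")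
      case True
      then show ?thesis unfolding K(1) using kl n K by (intro left) auto
    next
      case False
      have "1 \<le> L" "k \<noteq> L" using False n K by auto
      then show ?thesis unfolding K(2) using kl n K by (intro right) auto
    qed
  qed
  have two: "X 2 1 = - (1 / s ^ 2) * X 1 2"
  proof -
    have "raises 1 1" "1 \<in> {1..r}" using r2 by (auto simp: raises_def)
    moreover have "fund_wt r 1 1 = 1" using wt_upper[OF \<open>1 \<in> {1..r}\<close> \<open>raises 1 1\<close>] r2 by simp
    ultimately have "s * X 2 1 + X 1 2 / s = 0"
      using rel[of 1 1 1] by (simp add: numeral_2_eq_2 inverse_eq_divide)
    moreover have "X 2 1 + 1 / s ^ 2 * X 1 2 = (s * X 2 1 + X 1 2 / s) / s"
      by (simp add: add_divide_distrib power2_eq_square)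
    ultimately have "X 2 1 + 1 / s ^ 2 * X 1 2 = 0" by simp
    then show ?thesis by (simp only: eq_neg_iff_add_eq_0 mult_minus_left)
  qed
  define \<gamma> where "\<gamma> = X 1 (2 * r + 1) / ev 1"
  have zero: "X k (opp k) = \<gamma> * ev k" if "1 \<le> k" "k \<le> 2 * r + 1" for k
    using that
  proof (induction k rule: dec_induct)
    case base
    then show ?case using ev_nz[of 1] by (simp add: \<gamma>_def)
  next
    case (step k)
    have "1 \<le> k" "k \<le> 2 * r" using step.hyps step.prems by simp_all
    then obtain i where i: "i \<in> {1..r}" "raises i k" by (rule raises_color)
    define l where "l = 2 * r + 1 - k"
    have l: "k + l = 2 * r + 1" using step l_def by simp
    have o: "opp (Suc k) = l" "opp k = Suc l" using step unfolding l_def by auto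
    have rl: "raises i l" using i l unfolding raises_def by auto
    have "s powi fund_wt r i l * X (Suc k) l + s powi (- fund_wt r i k) * X k (Suc l) = 0"
      using rel[OF i(1), of k l] i(2) rl step l by simp
    then have "s powi fund_wt r i l * X (Suc k) l + \<gamma> * (s powi (- fund_wt r i k) * ev k) = 0"
      using step o by (simp add: mult.left_commute)
    moreover have "s powi (- fund_wt r i k) * ev k = - (s powi fund_wt r i l * ev (Suc k))"
      using ev_rec[OF i l] by (simp add: add_eq_0_iff)
    ultimately have "s powi fund_wt r i l * (X (Suc k) l - \<gamma> * ev (Suc k)) = 0"
      by (simp add: algebra_simps)
    then show ?case using o by simp
  qed
  have "x $ (a, b) = (X 1 1 *s w1 + X 1 2 *s w2 + \<gamma> *s w0) $ (a, b)" for a b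
  proof -
    have x: "x $ (a, b) = X (pos a) (pos b)" by (simp add: X_def)
    have w: "(X 1 1 *s w1 + X 1 2 *s w2 + \<gamma> *s w0) $ (a, b) =
      X 1 1 * (if pos a = 1 \<and> pos b = 1 then 1 else 0)
      + X 1 2 * (if pos a = 1 \<and> pos b = 2 then 1 else if pos a = 2 \<and> pos b = 1 then - (1 / s ^ 2) else 0)
      + \<gamma> * (if pos a + pos b = 2 * r + 2 then ev (pos a) else 0)"
      by (simp add: w1_def w2_def w0_def vec_of_nth)
    consider "pos a = 1" "pos b = 1" | "pos a = 1" "pos b = 2" | "pos a = 2" "pos b = 1" | "pos a + pos b = 2 * r + 2"
      | "\<not> (pos a = 1 \<and> pos b = 1)" "\<not> (pos a = 1 \<and> pos b = 2)" "\<not> (pos a = 2 \<and> pos b = 1)" "pos a + pos b \<noteq> 2 * r + 2"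
      by blast
    then show ?thesis
    proof cases
      case 1 then show ?thesis unfolding x w using r2 by simp
    next
      case 2 then show ?thesis unfolding x w using r2 by simp
    next
      case 3 then show ?thesis unfolding x w using r2 two by simp
    next
      case 4
      then have "pos b = opp (pos a)" by simp
      moreover have "\<not> (pos a = 1 \<and> pos b = 1)" "\<not> (pos a = 1 \<and> pos b = 2)" "\<not> (pos a = 2 \<and> pos b = 1)"
        using 4 r2 by auto
      ultimately show ?thesis unfolding x w using 4 zero[of "pos a"] by auto
    next
      case 5
      have "X (pos a) (pos b) = 0" by (rule supp) (use 5 in simp_all)
      then show ?thesis unfolding x w using 5 by auto
    qed
  qed
  then have "x = X 1 1 *s w1 + X 1 2 *s w2 + \<gamma> *s w0" by (simp add: vec_eq_iff)
  then show ?thesis using that by blast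
qed

text \<open>Every \<open>E\<^sub>i\<close> lowers the index sum, so applying them as long as the
  result is nonzero must stop; \<open>n\<close> bounds the index sum on the support.\<close>

lemma exists_killed_aux:
  assumes "\<And>i x. i \<in> {1..r} \<Longrightarrow> x \<in> U \<Longrightarrow> EE i *v x \<in> U"
  shows "x \<in> U \<Longrightarrow> x \<noteq> 0 \<Longrightarrow> (\<And>a b. pos a + pos b > n \<Longrightarrow> x $ (a, b) = 0) \<Longrightarrow>
    \<exists>y\<in>U. y \<noteq> 0 \<and> (\<forall>i\<in>{1..r}. EE i *v y = 0)"
proof (induction n arbitrary: x)
  case 0
  then have "x = 0" by (simp add: vec_eq_iff)
  then show ?case using 0 by simp
next
  case (Suc n)
  show ?case
  proof (cases "\<forall>i\<in>{1..r}. EE i *v x = 0")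
    case True
    then show ?thesis using Suc by blast
  next
    case False
    then obtain i where i: "i \<in> {1..r}" "EE i *v x \<noteq> 0" by blast
    show ?thesis
    proof (rule Suc.IH)
      show "EE i *v x \<in> U" using assms i Suc by blast
      fix a b assume ab: "pos a + pos b > n"
      have "x $ (idx (pos a + 1), b) = 0" if "raises i (pos a)"
        using raises_le[OF i(1) that] ab by (intro Suc.prems) simp
      moreover have "x $ (a, idx (pos b + 1)) = 0" if "raises i (pos b)"
        using raises_le[OF i(1) that] ab by (intro Suc.prems) simp
      ultimately show "(EE i *v x) $ (a, b) = 0" unfolding EE_nth[OF i(1)] by simp
    qed (rule i(2))
  qed
qed

lemma exists_killed:
  assumes "\<And>i x. i \<in> {1..r} \<Longrightarrow> x \<in> U \<Longrightarrow> EE i *v x \<in> U" "x \<in> U" "x \<noteq> 0"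
  obtains \<alpha> \<beta> \<gamma> where "\<alpha> *s w1 + \<beta> *s w2 + \<gamma> *s w0 \<in> U" "\<alpha> *s w1 + \<beta> *s w2 + \<gamma> *s w0 \<noteq> 0"
proof -
  have "pos a + pos b > 4 * r + 2 \<Longrightarrow> x $ (a, b) = 0" for a b
    using pos_range(4)[of a] pos_range(4)[of b] by linarith
  then obtain y where y: "y \<in> U" "y \<noteq> 0" "\<forall>i\<in>{1..r}. EE i *v y = 0"
    using exists_killed_aux[OF assms, of "4 * r + 2"] by blast
  then show ?thesis using kernel_EE[of y] that by metis
qed

section \<open>Nondegeneracy on the highest weight vectors\<close>

lemma q_nz_facts: "s ^ 4 \<noteq> 1" "s ^ 4 + 1 \<noteq> 0" "u ^ 2 \<noteq> 1" "u ^ 2 + s ^ 4 \<noteq> 0"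
proof -
  have q4: "s ^ 4 = q ^ 2" unfolding s2[symmetric] by simp
  show "s ^ 4 \<noteq> 1" unfolding q4 using not_root[of 2] by simp
  show "s ^ 4 + 1 \<noteq> 0"
  proof
    assume "s ^ 4 + 1 = 0"
    then have "q ^ 2 = -1" unfolding q4 by (simp add: eq_neg_iff_add_eq_0)
    then have "(q ^ 2) ^ 2 = 1" by simp
    then have "q ^ 4 = 1" by (simp flip: power_mult)
    then show False using not_root[of 4] by simp
  qed
  show "u ^ 2 \<noteq> 1" unfolding u_sq using not_root[of "2 * r + 1"] by simp
  show "u ^ 2 + s ^ 4 \<noteq> 0"
  proof
    assume "u ^ 2 + s ^ 4 = 0"
    moreover have "2 * r + 1 = (2 * r - 1) + 2" using r2 by simp
    ultimately have "q ^ ((2 * r - 1) + 2) + q ^ 2 = 0" unfolding u_sq q4 by simp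
    then have "q ^ 2 * (q ^ (2 * r - 1) + 1) = 0" unfolding power_add by (simp add: algebra_simps)
    then have "q ^ (2 * r - 1) = -1" using q0 by (simp add: eq_neg_iff_add_eq_0)
    then have "(q ^ (2 * r - 1)) ^ 2 = 1" by simp
    then have "q ^ ((2 * r - 1) * 2) = 1" by (simp flip: power_mult)
    then show False using not_root[of "(2 * r - 1) * 2"] r2 by simp
  qed
qed

text \<open>The sum is the quantum dimension of the module. Its terms form a geometric progression
  with ratio \<open>1 / s ^ 4\<close>, except for the two middle steps of ratio
  \<open>1 / s ^ 2\<close>; multiplied by the ratio minus one it telescopes up to two corrections.
  Its vanishing would force \<open>(u ^ 2 - 1) * (u ^ 2 + s ^ 4) = 0\<close>.\<close>

lemma sum_ev_sq_nz: "(\<Sum>k\<in>{1..2*r+1}. ev k ^ 2) \<noteq> 0"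
proof
  assume S0: "(\<Sum>k\<in>{1..2*r+1}. ev k ^ 2) = 0"
  let ?t = "1 / s ^ 4 :: complex"
  have step: "(?t - 1) * ev k ^ 2 = ev (Suc k) ^ 2 - ev k ^ 2
      + (if k = r then 1 / s ^ 2 - 1 else 0) + (if k = Suc r then ?t - 1 / s ^ 2 else 0)"
    if "k \<in> {1..2*r}" for k
  proof -
    consider "k = r" | "k = r + 1" | "k \<noteq> r" "k \<noteq> r + 1" by blast
    then show ?thesis
    proof cases
      case 1 then show ?thesis by (simp add: ev_r field_simps power_numeral_reduce)
    next
      case 2
      then have "ev (Suc k) = - inverse s" using ev_r by simp
      then show ?thesis using 2 by (simp add: field_simps power_numeral_reduce)
    next
      case 3
      then have "ev (Suc k) ^ 2 = ?t * ev k ^ 2"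
        using that ev_Suc[of k] by (simp add: power_divide flip: power_mult)
      then show ?thesis using 3 by (simp add: algebra_simps)
    qed
  qed
  have tel: "(\<Sum>k\<in>{1..2*r}. ev (Suc k) ^ 2 - ev k ^ 2) = ev (2 * r + 1) ^ 2 - ev 1 ^ 2"
    using sum_Suc_diff[of 1 "2 * r" "\<lambda>k. ev k ^ 2"] by simp
  have "(?t - 1) * (\<Sum>k\<in>{1..2*r}. ev k ^ 2) = (\<Sum>k\<in>{1..2*r}. ev (Suc k) ^ 2 - ev k ^ 2
      + (if k = r then 1 / s ^ 2 - 1 else 0) + (if k = Suc r then ?t - 1 / s ^ 2 else 0))"
    unfolding sum_distrib_left by (rule sum.cong[OF refl step])
  also have "\<dots> = ev (2 * r + 1) ^ 2 - ev 1 ^ 2 + (1 / s ^ 2 - 1) + (?t - 1 / s ^ 2)"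
    unfolding sum.distrib tel using r2 by simp
  finally have 1: "(?t - 1) * (\<Sum>k\<in>{1..2*r}. ev k ^ 2) = ev (2 * r + 1) ^ 2 - ev 1 ^ 2 + ?t - 1"
    by simp
  have "(\<Sum>k\<in>{1..2*r+1}. ev k ^ 2) = (\<Sum>k\<in>{1..2*r}. ev k ^ 2) + ev (2 * r + 1) ^ 2"
    by (simp add: atLeastAtMostSuc_conv add.commute)
  then have "(\<Sum>k\<in>{1..2*r}. ev k ^ 2) = - (ev (2 * r + 1) ^ 2)" using S0 by (simp add: add_eq_0_iff)
  then have "(?t - 1) * (- (ev (2 * r + 1) ^ 2)) = ev (2 * r + 1) ^ 2 - ev 1 ^ 2 + ?t - 1" using 1 by simp
  moreover have "ev 1 ^ 2 = u ^ 2 / s ^ 4" "ev (2 * r + 1) ^ 2 = s ^ 4 / u ^ 2"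
    unfolding ev_1 ev_N by (simp_all add: power_divide power_mult_distrib flip: power_mult) 
  ultimately have "(?t - 1) * (- (s ^ 4 / u ^ 2)) = s ^ 4 / u ^ 2 - u ^ 2 / s ^ 4 + ?t - 1" by simp
  moreover have "(u ^ 2 - 1) * (u ^ 2 + s ^ 4) =
    s ^ 4 * u ^ 2 * ((?t - 1) * (- (s ^ 4 / u ^ 2)) - (s ^ 4 / u ^ 2 - u ^ 2 / s ^ 4 + ?t - 1))"
    by (simp add: field_simps power_numeral_reduce)
  ultimately have "(u ^ 2 - 1) * (u ^ 2 + s ^ 4) = 0" by simp
  then show False using q_nz_facts by simp
qed

lemma bil_w: "bil w1 w1 = 1" "bil w2 w2 \<noteq> 0" "bil w0 w0 \<noteq> 0" "bil w1 w2 = 0" "bil w1 w0 = 0" "bil w2 w0 = 0"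
proof -
  have e1: "w1 $ p = (if p = (idx 1, idx 1) then 1 else 0)" for p
    by (cases p) (auto simp: w1_def vec_of_nth idx_eq_iff)
  have e2: "w2 $ p = (if p = (idx 1, idx 2) then 1 else 0) + (if p = (idx 2, idx 1) then - (1 / s ^ 2) else 0)" for p
    using r2 by (cases p) (auto simp: w2_def vec_of_nth idx_eq_iff)
  have o: "opp (pos x) \<in> {1..2*r+1}" for x using pos_range(1,4)[of x] by (auto simp del: pos_range)
  have e0: "w0 $ (x, y) = (if y = idx (opp (pos x)) then ev (pos x) else 0)" for x y
    using o[of x] idx_eq_iff[of "opp (pos x)" y] pos_range[of x] pos_range[of y] by (auto simp: w0_def vec_of_nth)
  have ne: "idx 1 \<noteq> idx 2"
  proof
    assume "idx 1 = idx 2"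
    then have "pos (idx 1) = pos (idx 2)" by simp
    then show False using r2 by simp
  qed
  have "w1 $ p * w1 $ p = (if p = (idx 1, idx 1) then 1 else 0)" for p
    unfolding e1 by simp
  then show "bil w1 w1 = 1" unfolding bil_def by simp
  have "bil w2 w2 = 1 + (1 / s ^ 2) ^ 2"
  proof -
    have "w2 $ p * w2 $ p = (if p = (idx 1, idx 2) then 1 else 0) + (if p = (idx 2, idx 1) then (1 / s ^ 2) ^ 2 else 0)" for p
      unfolding e2 using ne by (auto simp: power2_eq_square)
    then show ?thesis unfolding bil_def by (simp add: sum.distrib)
  qed
  moreover have "1 + (1 / s ^ 2) ^ 2 = (s ^ 4 + 1) / s ^ 4" by (simp add: field_simps power_numeral_reduce)
  ultimately show "bil w2 w2 \<noteq> 0" using q_nz_facts by simp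
  have "bil w0 w0 = (\<Sum>x\<in>UNIV. ev (pos x) ^ 2)"
  proof -
    have "w0 $ (x, y) * w0 $ (x, y) = (if y = idx (opp (pos x)) then ev (pos x) ^ 2 else 0)" for x y
      unfolding e0 by (auto simp: power2_eq_square)
    then show ?thesis unfolding bil_def sum_pair by simp
  qed
  also have "\<dots> = (\<Sum>k\<in>{1..2*r+1}. ev k ^ 2)" by (rule sum_pos)
  finally show "bil w0 w0 \<noteq> 0" using sum_ev_sq_nz by simp
  \<comment> \<open>The supports have index sums \<open>2\<close>, \<open>3\<close> and
    \<open>2 * r + 2\<close>, so they are disjoint.\<close>
  have z: "w1 $ (x, y) * w2 $ (x, y) = 0" "w1 $ (x, y) * w0 $ (x, y) = 0" "w2 $ (x, y) * w0 $ (x, y) = 0" for x y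
    using r2 by (auto simp: w1_def w2_def w0_def vec_of_nth)
  show "bil w1 w2 = 0" "bil w1 w0 = 0" "bil w2 w0 = 0"
    unfolding bil_def sum_pair z by simp_all
qed

section \<open>Operators commuting with the subalgebra of type B\<close>

definition B_comm :: "complex^('n \<times> 'n)^('n \<times> 'n) \<Rightarrow> bool" where
  "B_comm T \<longleftrightarrow> (\<forall>i\<in>{1..r}. T ** EE i = EE i ** T \<and> T ** FF i = FF i ** T
    \<and> T ** Khalf s (VV 1 1) i 2 = Khalf s (VV 1 1) i 2 ** T
    \<and> T ** Khalf s (VV 1 1) i (-2) = Khalf s (VV 1 1) i (-2) ** T)"

abbreviation Bsub :: "(complex^('n \<times> 'n)) set \<Rightarrow> bool" where
  "Bsub U \<equiv> B_submodule r s (VV 1 1) U"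

lemma submodule_generated:
  assumes U: "Bsub U" "w1 \<in> U" "w2 \<in> U" "w0 \<in> U"
  shows "U = UNIV"
proof (rule ccontr)
  assume "U \<noteq> UNIV"
  define P where "P = {y. \<forall>x\<in>U. bil x y = 0}"
  have "vec.subspace U" using U(1) by (simp add: B_submodule_def)
  then obtain y where y: "y \<in> P" "y \<noteq> 0" using proper_subspace_annihilator[OF _ \<open>U \<noteq> UNIV\<close>] P_def by auto
  have "EE i *v y \<in> P" if i: "i \<in> {1..r}" and "y \<in> P" for i y
  proof -
    have "bil x (EE i *v y) = 0" if "x \<in> U" for x
    proof -
      have "FF i *v x \<in> U" using U(1) i that unfolding B_submodule_def by blast
      then show ?thesis using \<open>y \<in> P\<close> unfolding bil_transpose VV_F_transpose[OF i, symmetric] P_def by simp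
    qed
    then show ?thesis by (simp add: P_def)
  qed
  then obtain \<alpha> \<beta> \<gamma> where z: "\<alpha> *s w1 + \<beta> *s w2 + \<gamma> *s w0 \<in> P" "\<alpha> *s w1 + \<beta> *s w2 + \<gamma> *s w0 \<noteq> 0"
    using exists_killed[of P y] y by blast
  have "bil w1 (\<alpha> *s w1 + \<beta> *s w2 + \<gamma> *s w0) = 0" "bil w2 (\<alpha> *s w1 + \<beta> *s w2 + \<gamma> *s w0) = 0"
    "bil w0 (\<alpha> *s w1 + \<beta> *s w2 + \<gamma> *s w0) = 0"
    using z(1) U unfolding P_def by blast+
  then have "\<alpha> = 0" "\<beta> = 0" "\<gamma> = 0"
    using bil_w bil_commute[of w2 w1] bil_commute[of w0 w1] bil_commute[of w0 w2]
    by (auto simp: bil_add_right bil_scale_right)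
  then show False using z(2) by simp
qed

text \<open>Equalizers of commuting operators are submodules; this turns generation by three vectors
  into uniqueness of operators.\<close>

lemma B_comm_eq_submodule:
  assumes "B_comm A" "B_comm B"
  shows "Bsub {x. A *v x = B *v x}"
proof -
  have "vec.subspace {x. A *v x = B *v x}"
    by (rule vec.subspaceI) (auto simp: matrix_vector_right_distrib vec.scale matrix_vector_mult_0_right vector_scalar_commute)
  moreover have "A *v (X *v x) = B *v (X *v x)"
    if "A ** X = X ** A" "B ** X = X ** B" "A *v x = B *v x" for X x
    using that by (metis matrix_vector_mul_assoc)
  ultimately show ?thesis using assms unfolding B_submodule_def B_comm_def by blast
qed

lemma B_comm_eqI:
  assumes "B_comm A" "B_comm B" "A *v w1 = B *v w1" "A *v w2 = B *v w2" "A *v w0 = B *v w0"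
  shows "A = B"
proof -
  have "{x. A *v x = B *v x} = UNIV"
    by (rule submodule_generated[OF B_comm_eq_submodule[OF assms(1,2)]]) (use assms in simp_all)
  then have "\<forall>x. A *v x = B *v x" by blast
  then show ?thesis using matrix_eq by blast
qed

lemma Rm_B_comm: "good z \<Longrightarrow> B_comm (Rm z)"
  unfolding B_comm_def using Rm_E[of _ z 1 1 1 1] Rm_F[of _ z 1 1 1 1] Rm_K[of _ z 1 1 _ 1 1] by auto

end

lemma smult_mat_vec: "(t *\<^sub>m A) *v x = t *s (A *v x)"
  for A :: "complex^'m::finite^'m"
  by (simp add: smult_mat_def matrix_vector_mult_def vec_eq_iff sum_distrib_left mult.assoc)

lemma matrix_mult_diff: "(A - B) ** C = A ** C - B ** C" "C ** (A - B) = C ** A - C ** B"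
  for A :: "complex^'m::finite^'m"
  by (simp_all add: matrix_matrix_mult_def vec_eq_iff sum_subtractf algebra_simps)

lemma matrix_mult_add: "(A + B) ** C = A ** C + B ** C"
  for A :: "complex^'m::finite^'m"
  by (simp add: matrix_matrix_mult_def vec_eq_iff sum.distrib algebra_simps)

lemma vec_mult_axis: "(A *v axis p 1) $ p' = A $ p' $ p"
  for A :: "complex^'m::finite^'m"
  by (simp add: matrix_vector_mult_def axis_def if_distrib cong: if_cong)

context A2r_setting
begin

section \<open>Weights of the three vectors and eigenvalues of commuting operators\<close>

lemma Khalf_nth: "(Khalf s M i n *v x) $ p = s powi (n * wt M i p) * x $ p"
  by (simp add: Khalf_def matrix_vector_mult_def if_distrib if_distribR cong: if_cong)

lemma fund_wt_1: "i \<in> {1..r} \<Longrightarrow> fund_wt r i 1 = (if i = 1 then 1 else 0)"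
proof -
  assume i: "i \<in> {1..r}"
  show ?thesis
  proof (cases "i = r")
    case True
    then show ?thesis using r2 by (simp add: fund_wt_r)
  next
    case False
    then have i: "1 \<le> i" "i < r" using i by auto
    show ?thesis unfolding fund_wt_lt[OF i] using i by auto
  qed
qed

lemma fund_wt_2: "i \<in> {1..r} \<Longrightarrow> fund_wt r i 2 = (if i = 1 then -1 else if i = 2 then 1 else 0)"
proof -
  assume i: "i \<in> {1..r}"
  show ?thesis
  proof (cases "i = r")
    case True
    then show ?thesis using r2 by (simp add: fund_wt_r)
  next
    case False
    then have i: "1 \<le> i" "i < r" using i by auto
    show ?thesis unfolding fund_wt_lt[OF i] using i by auto
  qed
qed

lemma wt_w1: "i \<in> {1..r} \<Longrightarrow> Khalf s (VV 1 1) i 2 *v w1 = (q_sub r s i ^ (2 * omega 1 i)) *s w1"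
proof -
  assume i: "i \<in> {1..r}"
  have "(Khalf s (VV 1 1) i 2 *v w1) $ (x, y) = ((q_sub r s i ^ (2 * omega 1 i)) *s w1) $ (x, y)" for x y
  proof (cases "pos x = 1 \<and> pos y = 1")
    case True
    then show ?thesis unfolding Khalf_nth VV_wt w1_def vec_of_nth
      using i r2 fund_wt_1[OF i] by (simp add: vec_of_nth q_sub_def omega_def flip: power_mult)
  qed (auto simp: Khalf_nth w1_def vec_of_nth)
  then show ?thesis by (simp add: vec_eq_iff)
qed

text \<open>The eigenvalue for the second node is \<open>s ^ 2\<close> in every rank. For
  \<open>r = 2\<close> this node is the short root, with \<open>q_sub\<close> equal to
  \<open>s\<close> instead of \<open>s ^ 2\<close>, which is why the label becomes 2.\<close>

lemma wt_w2: "i \<in> {1..r} \<Longrightarrow> Khalf s (VV 1 1) i 2 *v w2 = (q_sub r s i ^ ext_wt r i) *s w2"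
proof -
  assume i: "i \<in> {1..r}"
  have e: "s powi (2 * (fund_wt r i 1 + fund_wt r i 2)) = q_sub r s i ^ ext_wt r i"
    using i r2 unfolding fund_wt_1[OF i] fund_wt_2[OF i] by (auto simp: q_sub_def ext_wt_def omega_def)
  have "(Khalf s (VV 1 1) i 2 *v w2) $ (x, y) = ((q_sub r s i ^ ext_wt r i) *s w2) $ (x, y)" for x y
  proof -
    consider "pos x = 1" "pos y = 2" | "pos x = 2" "pos y = 1" | "w2 $ (x, y) = 0"
      unfolding w2_def vec_of_nth by fastforce
    then show ?thesis
      by cases (simp_all only: Khalf_nth VV_wt e add.commute[of "fund_wt r i 2"] vector_smult_component mult_zero_right)
  qed
  then show ?thesis by (simp add: vec_eq_iff)
qed

lemma wt_w0: "i \<in> {1..r} \<Longrightarrow> Khalf s (VV 1 1) i 2 *v w0 = (q_sub r s i ^ omega 0 i) *s w0"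
proof -
  assume i: "i \<in> {1..r}"
  have "(Khalf s (VV 1 1) i 2 *v w0) $ (x, y) = ((q_sub r s i ^ omega 0 i) *s w0) $ (x, y)" for x y
  proof (cases "pos x + pos y = 2 * r + 2")
    case True
    then have "pos y = opp (pos x)" by simp
    then have "fund_wt r i (pos y) = - fund_wt r i (pos x)" using fund_wt_opp[of i "pos x"] i by simp
    then show ?thesis unfolding Khalf_nth VV_wt by (simp add: omega_def)
  qed (auto simp: Khalf_nth w0_def vec_of_nth)
  then show ?thesis by (simp add: vec_eq_iff)
qed

lemma comb_nth:
  fixes \<alpha> \<beta> \<gamma> :: complex
  defines "x \<equiv> \<alpha> *s w1 + \<beta> *s w2 + \<gamma> *s w0"
  shows "x $ (idx 1, idx 1) = \<alpha>" "x $ (idx 1, idx 2) = \<beta>" "x $ (idx 1, idx (2 * r + 1)) = \<gamma> * ev 1"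
  using r2 by (simp_all add: x_def w1_def w2_def w0_def vec_of_nth)

lemma comb_eq_iff: "\<alpha> *s w1 + \<beta> *s w2 + \<gamma> *s w0 = \<alpha>' *s w1 + \<beta>' *s w2 + \<gamma>' *s w0 \<longleftrightarrow> \<alpha> = \<alpha>' \<and> \<beta> = \<beta>' \<and> \<gamma> = \<gamma>'"
  using comb_nth[of \<alpha> \<beta> \<gamma>] comb_nth[of \<alpha>' \<beta>' \<gamma>'] ev_nz[of 1] by (metis le_add2 mult_cancel_right order_refl)

lemma w_nz: "w1 \<noteq> 0" "w2 \<noteq> 0" "w0 \<noteq> 0"
  using comb_eq_iff[of 1 0 0 0 0 0] comb_eq_iff[of 0 1 0 0 0 0] comb_eq_iff[of 0 0 1 0 0 0] by simp_all

lemma s_facts: "s ^ 2 \<noteq> 1" "s ^ 4 \<noteq> 1"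
  using not_root[of 1] s2 q_nz_facts by auto

text \<open>The first two nodes suffice to separate the weights: their eigenvalues on
  \<open>w1\<close>, \<open>w2\<close>, \<open>w0\<close> are \<open>(s ^ 4, 1)\<close>,
  \<open>(1, s ^ 2)\<close> and \<open>(1, 1)\<close>.\<close>

lemma comb_weight:
  assumes x: "x = \<alpha> *s w1 + \<beta> *s w2 + \<gamma> *s w0"
    and K: "Khalf s (VV 1 1) 1 2 *v x = k1 *s x" "Khalf s (VV 1 1) 2 2 *v x = k2 *s x"
  shows "(k1 - s ^ 4) * \<alpha> = 0" "(k1 - 1) * \<beta> = 0" "(k1 - 1) * \<gamma> = 0"
    "(k2 - 1) * \<alpha> = 0" "(k2 - s ^ 2) * \<beta> = 0" "(k2 - 1) * \<gamma> = 0"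
proof -
  have i: "1 \<in> {1..r}" "2 \<in> {1..r}" using r2 by auto
  have K1: "Khalf s (VV 1 1) 1 2 *v w1 = s ^ 4 *s w1" "Khalf s (VV 1 1) 1 2 *v w2 = 1 *s w2" "Khalf s (VV 1 1) 1 2 *v w0 = 1 *s w0"
    unfolding wt_w1[OF i(1)] wt_w2[OF i(1)] wt_w0[OF i(1)] using r2
    by (simp_all add: q_sub_def omega_def ext_wt_def flip: power_mult)
  have K2: "Khalf s (VV 1 1) 2 2 *v w1 = 1 *s w1" "Khalf s (VV 1 1) 2 2 *v w2 = s ^ 2 *s w2" "Khalf s (VV 1 1) 2 2 *v w0 = 1 *s w0"
    unfolding wt_w1[OF i(2)] wt_w2[OF i(2)] wt_w0[OF i(2)] using r2
    by (auto simp: q_sub_def omega_def ext_wt_def)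
  have "(s ^ 4 * \<alpha>) *s w1 + \<beta> *s w2 + \<gamma> *s w0 = (k1 * \<alpha>) *s w1 + (k1 * \<beta>) *s w2 + (k1 * \<gamma>) *s w0"
    using K(1) unfolding x vec.add vec.scale K1 by (simp add: vector_smult_assoc vec.scale_right_distrib mult.commute)
  then show "(k1 - s ^ 4) * \<alpha> = 0" "(k1 - 1) * \<beta> = 0" "(k1 - 1) * \<gamma> = 0"
    unfolding comb_eq_iff by (auto simp: algebra_simps)
  have "\<alpha> *s w1 + (s ^ 2 * \<beta>) *s w2 + \<gamma> *s w0 = (k2 * \<alpha>) *s w1 + (k2 * \<beta>) *s w2 + (k2 * \<gamma>) *s w0"
    using K(2) unfolding x vec.add vec.scale K2 by (simp add: vector_smult_assoc vec.scale_right_distrib mult.commute)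
  then show "(k2 - 1) * \<alpha> = 0" "(k2 - s ^ 2) * \<beta> = 0" "(k2 - 1) * \<gamma> = 0"
    unfolding comb_eq_iff by (auto simp: algebra_simps)
qed

lemma weight_vector_line:
  assumes "\<And>i. i \<in> {1..r} \<Longrightarrow> EE i *v x = 0"
  shows "(\<And>i. i \<in> {1..r} \<Longrightarrow> Khalf s (VV 1 1) i 2 *v x = (q_sub r s i ^ (2 * omega 1 i)) *s x) \<Longrightarrow> \<exists>t. x = t *s w1"
    "(\<And>i. i \<in> {1..r} \<Longrightarrow> Khalf s (VV 1 1) i 2 *v x = (q_sub r s i ^ ext_wt r i) *s x) \<Longrightarrow> \<exists>t. x = t *s w2"
    "(\<And>i. i \<in> {1..r} \<Longrightarrow> Khalf s (VV 1 1) i 2 *v x = (q_sub r s i ^ omega 0 i) *s x) \<Longrightarrow> \<exists>t. x = t *s w0"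
proof -
  obtain \<alpha> \<beta> \<gamma> where x: "x = \<alpha> *s w1 + \<beta> *s w2 + \<gamma> *s w0" using kernel_EE[OF assms] by blast
  have i: "1 \<in> {1..r}" "2 \<in> {1..r}" using r2 by auto
  have q: "q_sub r s 1 ^ (2 * omega 1 1) = s ^ 4" "q_sub r s 2 ^ (2 * omega 1 2) = 1"
    "q_sub r s 1 ^ ext_wt r 1 = 1" "q_sub r s 2 ^ ext_wt r 2 = s ^ 2"
    "q_sub r s 1 ^ omega 0 1 = 1" "q_sub r s 2 ^ omega 0 2 = 1"
    using r2 by (auto simp: q_sub_def omega_def ext_wt_def simp flip: power_mult)
  note ne = s_facts s_facts[symmetric]
  { assume K: "\<And>i. i \<in> {1..r} \<Longrightarrow> Khalf s (VV 1 1) i 2 *v x = (q_sub r s i ^ (2 * omega 1 i)) *s x"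
    have "\<beta> = 0" "\<gamma> = 0" using comb_weight[OF x K[OF i(1)] K[OF i(2)]] ne unfolding q by auto
    then show "\<exists>t. x = t *s w1" using x by auto }
  { assume K: "\<And>i. i \<in> {1..r} \<Longrightarrow> Khalf s (VV 1 1) i 2 *v x = (q_sub r s i ^ ext_wt r i) *s x"
    have "\<alpha> = 0" "\<gamma> = 0" using comb_weight[OF x K[OF i(1)] K[OF i(2)]] ne unfolding q by auto
    then show "\<exists>t. x = t *s w2" using x by auto }
  { assume K: "\<And>i. i \<in> {1..r} \<Longrightarrow> Khalf s (VV 1 1) i 2 *v x = (q_sub r s i ^ omega 0 i) *s x"
    have "\<alpha> = 0" "\<beta> = 0" using comb_weight[OF x K[OF i(1)] K[OF i(2)]] ne unfolding q by auto
    then show "\<exists>t. x = t *s w0" using x by auto }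
qed

lemma B_comm_weight:
  assumes "B_comm T" "i \<in> {1..r}" "Khalf s (VV 1 1) i 2 *v x = t *s x"
  shows "Khalf s (VV 1 1) i 2 *v (T *v x) = t *s (T *v x)"
proof -
  have "Khalf s (VV 1 1) i 2 *v (T *v x) = T *v (Khalf s (VV 1 1) i 2 *v x)"
    using assms(1,2) unfolding B_comm_def by (simp add: matrix_vector_mul_assoc)
  then show ?thesis unfolding assms(3) by (simp add: vec.scale)
qed

lemma B_comm_kills:
  assumes "B_comm T" "i \<in> {1..r}" "EE i *v x = 0"
  shows "EE i *v (T *v x) = 0"
proof -
  have "EE i *v (T *v x) = T *v (EE i *v x)"
    using assms(1,2) unfolding B_comm_def by (simp add: matrix_vector_mul_assoc)
  then show ?thesis unfolding assms(3) by simp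
qed

text \<open>This plays the part of Schur's lemma: \<open>T\<close> preserves weights and the joint
  kernel of the \<open>E\<^sub>i\<close>, and in each of the three weights that kernel is a
  line.\<close>

lemma B_comm_eigen:
  assumes "B_comm T"
  shows "\<exists>t. T *v w1 = t *s w1" "\<exists>t. T *v w2 = t *s w2" "\<exists>t. T *v w0 = t *s w0"
proof -
  show "\<exists>t. T *v w1 = t *s w1"
  proof (rule weight_vector_line(1))
    fix i assume i: "i \<in> {1..r}"
    show "EE i *v (T *v w1) = 0" by (rule B_comm_kills[OF assms i EE_w1[OF i]])
    show "Khalf s (VV 1 1) i 2 *v (T *v w1) = (q_sub r s i ^ (2 * omega 1 i)) *s (T *v w1)"
      by (rule B_comm_weight[OF assms i wt_w1[OF i]])
  qed
  show "\<exists>t. T *v w2 = t *s w2"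
  proof (rule weight_vector_line(2))
    fix i assume i: "i \<in> {1..r}"
    show "EE i *v (T *v w2) = 0" by (rule B_comm_kills[OF assms i EE_w2[OF i]])
    show "Khalf s (VV 1 1) i 2 *v (T *v w2) = (q_sub r s i ^ ext_wt r i) *s (T *v w2)"
      by (rule B_comm_weight[OF assms i wt_w2[OF i]])
  qed
  show "\<exists>t. T *v w0 = t *s w0"
  proof (rule weight_vector_line(3))
    fix i assume i: "i \<in> {1..r}"
    show "EE i *v (T *v w0) = 0" by (rule B_comm_kills[OF assms i EE_w0[OF i]])
    show "Khalf s (VV 1 1) i 2 *v (T *v w0) = (q_sub r s i ^ omega 0 i) *s (T *v w0)"
      by (rule B_comm_weight[OF assms i wt_w0[OF i]])
  qed
qed

lemma Khalf_transpose: "transpose (Khalf s M i n) = Khalf s M i n"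
  by (auto simp: transpose_def Khalf_def vec_eq_iff)

text \<open>Transposition exchanges \<open>E\<^sub>i\<close> and \<open>F\<^sub>i\<close> and fixes
  the diagonal \<open>K\<^sub>i\<close>, so it preserves the commutant.\<close>

lemma B_comm_transpose:
  assumes "B_comm T" shows "B_comm (transpose T)"
  unfolding B_comm_def
proof (intro ballI conjI)
  fix i assume i: "i \<in> {1..r}"
  have T: "T ** EE i = EE i ** T" "T ** FF i = FF i ** T" "T ** Khalf s (VV 1 1) i 2 = Khalf s (VV 1 1) i 2 ** T"
    "T ** Khalf s (VV 1 1) i (-2) = Khalf s (VV 1 1) i (-2) ** T"
    using assms i unfolding B_comm_def by blast+
  have tr: "transpose (FF i) = EE i" "transpose (EE i) = FF i"
    by (simp_all add: VV_F_transpose[OF i])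
  show "transpose T ** EE i = EE i ** transpose T" "transpose T ** FF i = FF i ** transpose T"
    "transpose T ** Khalf s (VV 1 1) i 2 = Khalf s (VV 1 1) i 2 ** transpose T"
    "transpose T ** Khalf s (VV 1 1) i (-2) = Khalf s (VV 1 1) i (-2) ** transpose T"
    using T[THEN arg_cong[where f=transpose]] unfolding matrix_transpose_mul tr Khalf_transpose by simp_all
qed

lemma B_comm_add: "B_comm A \<Longrightarrow> B_comm B \<Longrightarrow> B_comm (A + B)"
  unfolding B_comm_def by (simp add: matrix_add_ldistrib matrix_mult_add)

lemma B_comm_diff: "B_comm A \<Longrightarrow> B_comm B \<Longrightarrow> B_comm (A - B)"
  unfolding B_comm_def by (simp add: matrix_mult_diff)

lemma B_comm_smult: "B_comm A \<Longrightarrow> B_comm (t *\<^sub>m A)"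
  unfolding B_comm_def by (simp add: smult_mat_mult)

lemma B_comm_mult: "B_comm A \<Longrightarrow> B_comm B \<Longrightarrow> B_comm (A ** B)"
proof -
  assume A: "B_comm A" and B: "B_comm B"
  have "(A ** B) ** X = X ** (A ** B)" if "A ** X = X ** A" "B ** X = X ** B"
    for X :: "complex^('n \<times> 'n)^('n \<times> 'n)"
  proof -
    have "(A ** B) ** X = A ** (X ** B)" by (simp only: matrix_mul_assoc[symmetric] that)
    also have "\<dots> = X ** (A ** B)" by (simp only: matrix_mul_assoc that)
    finally show ?thesis .
  qed
  then show ?thesis using A B unfolding B_comm_def by blast
qed

lemma B_comm_one: "B_comm (mat 1)"
  unfolding B_comm_def by simp

lemma B_comm_zero: "B_comm 0"
  unfolding B_comm_def by simp

lemmas B_comm_intros = B_comm_add B_comm_diff B_comm_smult B_comm_mult B_comm_one B_comm_zero Rm_B_comm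

section \<open>Eigenvalues of the candidate\<close>

text \<open>The images of \<open>v\<^sub>1 \<otimes> v\<^sub>1\<close> under \<open>E\<^sub>0\<close> for the two orders of the spectral parameters, divided by \<open>b\<close>. Pairing
  them with \<open>w0\<close> determines the eigenvalue on \<open>w0\<close>.\<close>

definition y_in :: "complex \<Rightarrow> complex^('n \<times> 'n)" where
  "y_in z = (z / s ^ 2) *s axis (idx (2 * r + 1), idx 1) 1 + s ^ 2 *s axis (idx 1, idx (2 * r + 1)) 1"

definition y_out :: "complex \<Rightarrow> complex^('n \<times> 'n)" where
  "y_out z = (1 / s ^ 2) *s axis (idx (2 * r + 1), idx 1) 1 + (z * s ^ 2) *s axis (idx 1, idx (2 * r + 1)) 1"

lemma bil_axis: "bil x (axis p 1) = x $ p"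
  by (simp add: bil_def axis_def if_distrib cong: if_cong)

text \<open>The quotient of the pairings of \<open>w0\<close> with \<open>y_out z\<close> and with
  \<open>y_in z\<close>.\<close>

definition f0 :: "complex \<Rightarrow> complex" where "f0 z = (1 / u + z * u) / D2 z"

definition f2 :: "complex \<Rightarrow> complex" where "f2 z = (z * eta - (1 - z) / s ^ 2) / D1 z"

text \<open>Since \<open>w0\<close> is not isotropic, \<open>T\<close> and its transpose have the
  same eigenvalue on it. Moving \<open>T\<close> across the form then compares the pairings of
  \<open>w0\<close> with \<open>y_in z\<close> and \<open>y_out z\<close>, and the former is nonzero
  away from the second pole.\<close>

lemma singlet_eigenvalue:
  assumes T: "B_comm T" "T *v y_in z = y_out z" and z: "good z"
  shows "T *v w0 = f0 z *s w0"
proof -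
  obtain t where t: "T *v w0 = t *s w0" using B_comm_eigen[OF T(1)] by blast
  obtain t' where t': "transpose T *v w0 = t' *s w0" using B_comm_eigen[OF B_comm_transpose[OF T(1)]] by blast
  have "bil w0 (T *v w0) = bil (transpose T *v w0) w0" by (rule bil_transpose)
  then have "t' = t" unfolding t t' using bil_w(3) by (simp add: bil_scale_right bil_commute[of "t' *s w0"])
  have "bil w0 (T *v y_in z) = bil (transpose T *v w0) (y_in z)" by (rule bil_transpose)
  then have "bil w0 (y_out z) = t * bil w0 (y_in z)"
    unfolding T(2) t' \<open>t' = t\<close> by (simp add: bil_scale_right bil_commute[of "t *s w0"] bil_commute[of w0])
  moreover
  have e: "w0 $ (idx (2 * r + 1), idx 1) = (-1) ^ r * s ^ 2 / u" "w0 $ (idx 1, idx (2 * r + 1)) = (-1) ^ r * u / s ^ 2"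
    using ev_1 ev_N by (simp_all add: w0_def vec_of_nth)
  have "bil w0 (y_in z) = (-1) ^ r * (z / u + u)" "bil w0 (y_out z) = (-1) ^ r * (1 / u + z * u)"
    unfolding y_in_def y_out_def bil_add_right bil_scale_right bil_axis e by (simp_all add: field_simps)
  ultimately have "(-1) ^ r * (1 / u + z * u) = (-1) ^ r * (t * (z / u + u))" by simp
  then have "1 / u + z * u = t * D2 z" by (simp add: D2_def inverse_eq_divide add.commute)
  then show ?thesis unfolding t f0_def using D_nz(2)[OF z] by simp
qed

lemma Rm_y_in: assumes z: "good z" shows "Rm z *v y_in z = y_out z"
proof -
  have "(Rm z *v y_in z) $ (x, y) = y_out z $ (x, y)" for x y
  proof -
    have L: "(Rm z *v y_in z) $ (x, y) = z / s ^ 2 * Rf z (pos x) (pos y) (2 * r + 1) 1 + s ^ 2 * Rf z (pos x) (pos y) 1 (2 * r + 1)"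
      by (simp add: y_in_def vec.add vec.scale vec_mult_axis Rm_entry)
    have R: "y_out z $ (x, y) = (if pos x = 2 * r + 1 \<and> pos y = 1 then 1 / s ^ 2 else 0) + (if pos x = 1 \<and> pos y = 2 * r + 1 then z * s ^ 2 else 0)"
      by (auto simp: y_out_def axis_def idx_eq_iff)
    show ?thesis
    proof (cases "pos x + pos y = 2 * r + 2")
      case True
      then have y: "pos y = opp (pos x)" by simp
      have "pos y = 1 \<longleftrightarrow> pos x = 2 * r + 1" "pos y = 2 * r + 1 \<longleftrightarrow> pos x = 1" using True by auto
      then show ?thesis unfolding L R using comm0_corner[of "pos x" z] z unfolding rho_def y[symmetric] by simp
    next
      case False
      then have "Rf z (pos x) (pos y) (2 * r + 1) 1 = 0" "Rf z (pos x) (pos y) 1 (2 * r + 1) = 0"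
        by (intro Rf_weight; simp)+
      then show ?thesis unfolding L R using False by auto
    qed
  qed
  then show ?thesis by (simp add: vec_eq_iff)
qed

lemma w1_axis: "w1 = axis (idx 1, idx 1) 1"
proof -
  have "w1 $ (x, y) = axis (idx 1, idx 1) 1 $ (x, y)" for x y
    by (auto simp: w1_def vec_of_nth axis_def idx_eq_iff)
  then show ?thesis by (simp add: vec_eq_iff)
qed

lemma w2_axis: "w2 = axis (idx 1, idx 2) 1 - (1 / s ^ 2) *s axis (idx 2, idx 1) 1"
proof -
  have "w2 $ (x, y) = (axis (idx 1, idx 2) 1 - (1 / s ^ 2) *s axis (idx 2, idx 1) 1) $ (x, y)" for x y
    using r2 by (auto simp: w2_def vec_of_nth axis_def idx_eq_iff)
  then show ?thesis by (simp add: vec_eq_iff)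
qed

text \<open>The vectors are known to be eigenvectors, so one coordinate fixes each of the first two
  eigenvalues. The entries involved have index sums \<open>2\<close> and \<open>3\<close>, where
  \<open>Q_mat\<close> does not contribute.\<close>

lemma Rm_w:
  assumes z: "good z"
  shows "Rm z *v w1 = w1" "Rm z *v w2 = f2 z *s w2" "Rm z *v w0 = f0 z *s w0"
proof -
  note eig = B_comm_eigen[OF Rm_B_comm[OF z]]
  obtain t1 where t1: "Rm z *v w1 = t1 *s w1" using eig(1) by blast
  have "(Rm z *v w1) $ (idx 1, idx 1) = Rf z 1 1 1 1"
    unfolding w1_axis vec_mult_axis Rm_entry using r2 by simp
  also have "\<dots> = 1" using r2 by (simp add: Rf_def Af_def al_def)
  finally have "t1 = 1" unfolding t1 by (simp add: w1_def vec_of_nth)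
  then show "Rm z *v w1 = w1" using t1 by simp
  obtain t2 where t2: "Rm z *v w2 = t2 *s w2" using eig(2) by blast
  have "(Rm z *v w2) $ (idx 1, idx 2) = Rf z 1 2 1 2 - Rf z 1 2 2 1 / s ^ 2"
    unfolding w2_axis vec.diff vec.scale vector_minus_component vector_smult_component vec_mult_axis Rm_entry using r2 by simp
  also have "\<dots> = f2 z"
  proof -
    have "Rf z 1 2 1 2 = z * eta / D1 z" "Rf z 1 2 2 1 = (1 - z) / D1 z"
      using r2 by (simp_all add: Rf_def Af_def al_def be_def)
    then show ?thesis by (simp add: f2_def diff_divide_distrib mult.commute)
  qed
  finally have "t2 = f2 z" unfolding t2 using r2 by (simp add: w2_def vec_of_nth)
  then show "Rm z *v w2 = f2 z *s w2" using t2 by simp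
  show "Rm z *v w0 = f0 z *s w0"
    by (rule singlet_eigenvalue[OF Rm_B_comm[OF z] Rm_y_in[OF z] z])
qed


section \<open>Projectors as polynomials in the candidate at zero\<close>

lemma good_0: "good 0"
  using q0 by (simp add: good_def)

lemma w_distinct: "w1 \<noteq> w2" "w1 \<noteq> w0" "w2 \<noteq> w0"
  using comb_eq_iff[of 1 0 0 0 1 0] comb_eq_iff[of 1 0 0 0 0 1] comb_eq_iff[of 0 1 0 0 0 1] by simp_all

lemma C_eigenvalues: "f2 0 = - (1 / s ^ 4)" "f0 0 = 1 / u ^ 2"
  by (simp_all add: f2_def f0_def D1_eq D2_eq field_simps power_numeral_reduce)

text \<open>In terms of \<open>q\<close> the eigenvalues are 1, -q^(-2) and q^(-2r-1). The factors
  to be excluded are those in the norms of \<open>w2\<close> and \<open>w0\<close>.\<close>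

lemma C_eigenvalues_distinct: "f2 0 \<noteq> 1" "f0 0 \<noteq> 1" "f2 0 \<noteq> f0 0"
proof -
  show "f2 0 \<noteq> 1"
  proof
    assume "f2 0 = 1"
    then have "- 1 = s ^ 4" unfolding C_eigenvalues by (simp add: field_simps)
    then have "s ^ 4 = - 1" by (rule sym)
    then show False using q_nz_facts by simp
  qed
  show "f0 0 \<noteq> 1" unfolding C_eigenvalues using q_nz_facts by simp
  show "f2 0 \<noteq> f0 0"
  proof
    assume "f2 0 = f0 0"
    then have "- (u ^ 2) = s ^ 4" unfolding C_eigenvalues by (simp add: field_simps)
    then have "s ^ 4 = - (u ^ 2)" by (rule sym)
    then show False using q_nz_facts by simp
  qed
qed

definition is_proj :: "complex^('n \<times> 'n) \<Rightarrow> complex^('n \<times> 'n)^('n \<times> 'n) \<Rightarrow> bool" where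
  "is_proj v P \<longleftrightarrow> B_comm P \<and> (\<forall>w\<in>{w1, w2, w0}. P *v w = (if w = v then w else 0))"

text \<open>Lagrange interpolation at the eigenvalues: as a polynomial in \<open>Rm 0\<close> the
  result commutes with the subalgebra.\<close>

lemma lagrange_proj:
  assumes "{v, v', v''} = {w1, w2, w0}" "v' \<noteq> v" "v'' \<noteq> v"
    and "Rm 0 *v v = e *s v" "Rm 0 *v v' = e' *s v'" "Rm 0 *v v'' = e'' *s v''" "e \<noteq> e'" "e \<noteq> e''"
  shows "\<exists>P. is_proj v P"
proof -
  define A where "A t = Rm 0 - t *\<^sub>m mat 1" for t
  define P where "P = (1 / ((e - e') * (e - e''))) *\<^sub>m (A e' ** A e'')"
  have AV: "A t *v x = Rm 0 *v x - t *s x" for t x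
    by (simp add: A_def matrix_vector_mult_diff_rdistrib smult_mat_vec)
  have PV: "P *v x = (1 / ((e - e') * (e - e''))) *s (A e' *v (A e'' *v x))" for x
    by (simp add: P_def smult_mat_vec matrix_vector_mul_assoc)
  have eig: "P *v x = ((t - e') * (t - e'') / ((e - e') * (e - e''))) *s x" if "Rm 0 *v x = t *s x" for t x
  proof -
    have 1: "A e'' *v x = (t - e'') *s x" unfolding AV that by (simp add: vec.scale_left_diff_distrib)
    have 2: "A e' *v x = (t - e') *s x" unfolding AV that by (simp add: vec.scale_left_diff_distrib)
    show ?thesis unfolding PV 1 vec.scale 2 vector_smult_assoc by (simp add: mult_ac)
  qed
  have "B_comm P" unfolding P_def A_def by (intro B_comm_intros good_0)
  moreover have "P *v v = v" using eig[OF assms(4)] assms(7,8) by simp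
  moreover have "P *v v' = 0" using eig[OF assms(5)] by simp
  moreover have "P *v v'' = 0" using eig[OF assms(6)] by simp
  ultimately have "is_proj v P" unfolding is_proj_def assms(1)[symmetric] using assms(2,3) by simp
  then show ?thesis by blast
qed

lemma proj_exists: "v \<in> {w1, w2, w0} \<Longrightarrow> \<exists>P. is_proj v P"
proof -
  assume v: "v \<in> {w1, w2, w0}"
  have R: "Rm 0 *v w1 = 1 *s w1" using Rm_w[OF good_0] by simp
  note ne = C_eigenvalues_distinct C_eigenvalues_distinct[symmetric] w_distinct w_distinct[symmetric]
  have "\<exists>P. is_proj w1 P"
    by (rule lagrange_proj[of w1 w2 w0, OF _ _ _ R Rm_w(2,3)[OF good_0]]) (use ne in auto)
  moreover have "\<exists>P. is_proj w2 P"
    by (rule lagrange_proj[of w2 w1 w0, OF _ _ _ Rm_w(2)[OF good_0] R Rm_w(3)[OF good_0]]) (use ne in auto)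
  moreover have "\<exists>P. is_proj w0 P"
    by (rule lagrange_proj[of w0 w1 w2, OF _ _ _ Rm_w(3)[OF good_0] R Rm_w(2)[OF good_0]]) (use ne in auto)
  ultimately show ?thesis using v by blast
qed

text \<open>The choice is unique, because commuting operators are determined on \<open>w1\<close>,
  \<open>w2\<close>, \<open>w0\<close>.\<close>

definition Pw :: "complex^('n \<times> 'n) \<Rightarrow> complex^('n \<times> 'n)^('n \<times> 'n)" where
  "Pw v = (SOME P. is_proj v P)"

lemma Pw: "v \<in> {w1, w2, w0} \<Longrightarrow> is_proj v (Pw v)"
  unfolding Pw_def using proj_exists someI_ex by metis

lemma Pw_comm: "v \<in> {w1, w2, w0} \<Longrightarrow> B_comm (Pw v)"
  using Pw by (simp add: is_proj_def)

lemma Pw_apply: "v \<in> {w1, w2, w0} \<Longrightarrow> w \<in> {w1, w2, w0} \<Longrightarrow> Pw v *v w = (if w = v then w else 0)"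
  using Pw unfolding is_proj_def by blast

lemma Pw_mult:
  assumes v: "v \<in> {w1, w2, w0}" and v': "v' \<in> {w1, w2, w0}"
  shows "Pw v ** Pw v' = (if v = v' then Pw v else 0)"
proof (rule B_comm_eqI)
  show "B_comm (Pw v ** Pw v')" by (intro B_comm_mult Pw_comm v v')
  show "B_comm (if v = v' then Pw v else 0)" using Pw_comm[OF v] B_comm_zero by (cases "v = v'") simp_all
  have "(Pw v ** Pw v') *v w = (if v = v' then Pw v else 0) *v w" if "w \<in> {w1, w2, w0}" for w
  proof -
    have A: "(Pw v ** Pw v') *v w = Pw v *v (Pw v' *v w)" by (simp add: matrix_vector_mul_assoc)
    show ?thesis unfolding A Pw_apply[OF v' that]
      by (cases "w = v'"; cases "v = v'") (use Pw_apply[OF v that] in auto)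
  qed
  then show "(Pw v ** Pw v') *v w1 = (if v = v' then Pw v else 0) *v w1"
    "(Pw v ** Pw v') *v w2 = (if v = v' then Pw v else 0) *v w2"
    "(Pw v ** Pw v') *v w0 = (if v = v' then Pw v else 0) *v w0" by blast+
qed

lemma B_comm_spectral:
  assumes "B_comm T" "T *v w1 = t1 *s w1" "T *v w2 = t2 *s w2" "T *v w0 = t0 *s w0"
  shows "T = t1 *\<^sub>m Pw w1 + t2 *\<^sub>m Pw w2 + t0 *\<^sub>m Pw w0"
  by (rule B_comm_eqI[OF assms(1)])
    (auto intro!: B_comm_intros Pw_comm simp: matrix_vector_mult_add_rdistrib smult_mat_vec Pw_apply assms w_distinct
      w_distinct[symmetric])

lemma Pw_sum: "Pw w1 + Pw w2 + Pw w0 = mat 1"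
  using B_comm_spectral[OF B_comm_one, of 1 1 1] by (simp add: smult_mat_def vec_eq_iff)

lemma submodule_vec_closed:
  assumes "Bsub U" "x \<in> U" "t \<noteq> 0" "x = t *s y" shows "y \<in> U"
proof -
  have "(1 / t) *s x \<in> U" using assms(1,2) unfolding B_submodule_def by (simp add: vec.subspace_scale)
  then show ?thesis using assms(3,4) by simp
qed

definition Wsp :: "complex^('n \<times> 'n) \<Rightarrow> (complex^('n \<times> 'n)) set" where
  "Wsp v = {x. Pw v *v x = x}"

lemma Wsp_sub: "v \<in> {w1, w2, w0} \<Longrightarrow> Bsub (Wsp v)"
  using B_comm_eq_submodule[OF Pw_comm B_comm_one] by (simp add: Wsp_def)

lemma Wsp_mem: "v \<in> {w1, w2, w0} \<Longrightarrow> v \<in> Wsp v"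
  using Pw_apply[of v v] by (simp add: Wsp_def)

text \<open>\<open>U\<close> contains some nonzero combination of the three highest weight vectors;
  being fixed by the projector, it is a multiple of \<open>v\<close>.\<close>

lemma Wsp_has_hw:
  assumes v: "v \<in> {w1, w2, w0}" and U: "Bsub U" "U \<subseteq> Wsp v" "U \<noteq> {0}"
  shows "v \<in> U"
proof -
  have "0 \<in> U" using U(1) vec.subspace_0 unfolding B_submodule_def by blast
  then obtain x where x: "x \<in> U" "x \<noteq> 0" using U(3) by blast
  have "EE i *v y \<in> U" if "i \<in> {1..r}" "y \<in> U" for i y
    using that U(1) unfolding B_submodule_def by blast
  then obtain \<alpha> \<beta> \<gamma> where y: "\<alpha> *s w1 + \<beta> *s w2 + \<gamma> *s w0 \<in> U" "\<alpha> *s w1 + \<beta> *s w2 + \<gamma> *s w0 \<noteq> 0"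
    using exists_killed[of U x] x by blast
  let ?y = "\<alpha> *s w1 + \<beta> *s w2 + \<gamma> *s w0"
  have P: "Pw v *v ?y = ?y" using y U(2) unfolding Wsp_def by blast
  have "Pw v *v ?y = \<alpha> *s (Pw v *v w1) + \<beta> *s (Pw v *v w2) + \<gamma> *s (Pw v *v w0)"
    by (simp only: vec.add vec.scale)
  then have "\<exists>t. Pw v *v ?y = t *s v"
    using v Pw_apply[OF v] by (auto simp: w_distinct w_distinct[symmetric] intro: exI[of _ 0])
  then obtain t where "?y = t *s v" using P by auto
  moreover have "t \<noteq> 0" using calculation y(2) by auto
  ultimately show ?thesis using submodule_vec_closed[OF U(1) y(1)] by blast
qed

text \<open>The preimage of \<open>U\<close> under the projector is a submodule containing all three
  generating vectors, two of them because they are sent to zero. So it is everything, and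
  \<open>U\<close> contains the image of the projector.\<close>

lemma Wsp_irreducible:
  assumes v: "v \<in> {w1, w2, w0}" and U: "Bsub U" "U \<subseteq> Wsp v" "U \<noteq> {0}"
  shows "U = Wsp v"
proof -
  have vU: "v \<in> U" by (rule Wsp_has_hw[OF assms])
  let ?U = "{x. Pw v *v x \<in> U}"
  have c: "B_comm (Pw v)" by (rule Pw_comm[OF v])
  have "vec.subspace ?U"
    using U(1) unfolding B_submodule_def
    by (intro vec.subspaceI) (auto simp: vec.add vec.scale vec.subspace_0 vec.subspace_add vec.subspace_scale)
  moreover have "Pw v *v (X *v x) \<in> U" if "Pw v ** X = X ** Pw v" "X *v (Pw v *v x) \<in> U" for X x
    using that by (simp add: matrix_vector_mul_assoc)
  ultimately have "Bsub ?U" using c U(1) unfolding B_submodule_def B_comm_def by blast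
  moreover have "w \<in> ?U" if "w \<in> {w1, w2, w0}" for w
  proof -
    have "0 \<in> U" using U(1) vec.subspace_0 unfolding B_submodule_def by blast
    then show ?thesis using Pw_apply[OF v that] vU by simp
  qed
  ultimately have "?U = UNIV" using submodule_generated[of ?U] by blast
  then have all: "Pw v *v x \<in> U" for x by (simp add: set_eq_iff)
  have "x \<in> U" if "x \<in> Wsp v" for x
  proof -
    have "Pw v *v x = x" using that by (simp add: Wsp_def)
    then show ?thesis using all[of x] by simp
  qed
  then show ?thesis using U(2) by blast
qed

section \<open>Decomposition of the tensor square\<close>

definition \<Lambda> :: "(nat \<Rightarrow> nat) set" where "\<Lambda> = {\<lambda>i. 2 * omega 1 i, ext_wt r, omega 0}"

definition hwv :: "(nat \<Rightarrow> nat) \<Rightarrow> complex^('n \<times> 'n)" where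
  "hwv \<mu> = (if \<mu> = (\<lambda>i. 2 * omega 1 i) then w1 else if \<mu> = ext_wt r then w2 else w0)"

lemma Lam_distinct: "(\<lambda>i. 2 * omega 1 i) \<noteq> ext_wt r" "(\<lambda>i. 2 * omega 1 i) \<noteq> omega 0" "ext_wt r \<noteq> omega 0"
proof -
  have "2 * omega 1 1 \<noteq> ext_wt r 1" "2 * omega 1 1 \<noteq> omega 0 1" "ext_wt r 2 \<noteq> omega 0 2"
    by (simp_all add: omega_def ext_wt_def)
  then show "(\<lambda>i. 2 * omega 1 i) \<noteq> ext_wt r" "(\<lambda>i. 2 * omega 1 i) \<noteq> omega 0" "ext_wt r \<noteq> omega 0"
    by metis+
qed

lemma hwv_simps: "hwv (\<lambda>i. 2 * omega 1 i) = w1" "hwv (ext_wt r) = w2" "hwv (omega 0) = w0"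
  using Lam_distinct Lam_distinct[symmetric] unfolding hwv_def by simp_all

lemmas hwv_simps' = hwv_simps hwv_simps[unfolded One_nat_def]

lemma hwv_mem: "hwv \<mu> \<in> {w1, w2, w0}"
  by (simp add: hwv_def)

lemma hwv_inj: "\<mu> \<in> \<Lambda> \<Longrightarrow> \<nu> \<in> \<Lambda> \<Longrightarrow> hwv \<mu> = hwv \<nu> \<longleftrightarrow> \<mu> = \<nu>"
  unfolding \<Lambda>_def using hwv_simps w_distinct w_distinct[symmetric] by auto

lemma hwv_weight:
  assumes "\<mu> \<in> \<Lambda>" "i \<in> {1..r}"
  shows "EE i *v hwv \<mu> = 0" "Khalf s (VV 1 1) i 2 *v hwv \<mu> = (q_sub r s i ^ \<mu> i) *s hwv \<mu>"
  using assms wt_w1 wt_w2 wt_w0 EE_w1 EE_w2 EE_w0 unfolding \<Lambda>_def by (auto simp: hwv_simps')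

lemma hwv_nz: "hwv \<mu> \<noteq> 0"
  using w_nz by (simp add: hwv_def)

lemma hwv_unique:
  assumes "\<mu> \<in> \<Lambda>" "\<And>i. i \<in> {1..r} \<Longrightarrow> EE i *v x = 0"
    "\<And>i. i \<in> {1..r} \<Longrightarrow> Khalf s (VV 1 1) i 2 *v x = (q_sub r s i ^ \<mu> i) *s x"
  shows "\<exists>t. x = t *s hwv \<mu>"
proof -
  consider "\<mu> = (\<lambda>i. 2 * omega 1 i)" | "\<mu> = ext_wt r" | "\<mu> = omega 0" using assms(1) unfolding \<Lambda>_def by blast
  then show ?thesis
  proof cases
    case 1 show ?thesis unfolding 1 hwv_simps by (rule weight_vector_line(1)) (use assms(2,3) 1 in simp_all)
  next
    case 2 show ?thesis unfolding 2 hwv_simps by (rule weight_vector_line(2)) (use assms(2,3) 2 in simp_all)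
  next
    case 3 show ?thesis unfolding 3 hwv_simps by (rule weight_vector_line(3)) (use assms(2,3) 3 in simp_all)
  qed
qed

definition Wd :: "(nat \<Rightarrow> nat) \<Rightarrow> (complex^('n \<times> 'n)) set" where "Wd \<mu> = Wsp (hwv \<mu>)"

lemma Wd_irrep:
  assumes "\<mu> \<in> \<Lambda>" shows "B_irrep r s (VV 1 1) \<mu> (Wd \<mu>)"
proof -
  have "hwv \<mu> \<in> Wd \<mu>" unfolding Wd_def by (rule Wsp_mem[OF hwv_mem])
  moreover have "Bsub (Wd \<mu>)" unfolding Wd_def by (rule Wsp_sub[OF hwv_mem])
  moreover have "U = {0} \<or> U = Wd \<mu>" if "Bsub U" "U \<subseteq> Wd \<mu>" for U
    using Wsp_irreducible[OF hwv_mem that(1)] that(2) unfolding Wd_def by blast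
  ultimately show ?thesis
    unfolding B_irrep_def using hwv_nz hwv_weight[OF assms] by blast
qed

lemma Pw_hwv_mult: "\<mu> \<in> \<Lambda> \<Longrightarrow> \<nu> \<in> \<Lambda> \<Longrightarrow> Pw (hwv \<mu>) ** Pw (hwv \<nu>) = (if \<mu> = \<nu> then Pw (hwv \<mu>) else 0)"
  using Pw_mult[OF hwv_mem hwv_mem] hwv_inj by simp

lemma Pw_on_Wd:
  assumes "\<mu> \<in> \<Lambda>" "\<nu> \<in> \<Lambda>" "x \<in> Wd \<mu>"
  shows "Pw (hwv \<nu>) *v x = (if \<mu> = \<nu> then x else 0)"
proof -
  have x: "Pw (hwv \<mu>) *v x = x" using assms(3) by (simp add: Wd_def Wsp_def)
  have "Pw (hwv \<nu>) *v (Pw (hwv \<mu>) *v x) = (if \<nu> = \<mu> then Pw (hwv \<nu>) *v x else 0)"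
    using Pw_hwv_mult[OF assms(2,1)] by (simp add: matrix_vector_mul_assoc)
  then show ?thesis using x by (auto split: if_splits)
qed

lemma finite_Lam: "finite \<Lambda>" by (simp add: \<Lambda>_def)

lemma Pw_hwv_sum: "(\<Sum>\<mu>\<in>\<Lambda>. Pw (hwv \<mu>) *v x) = x"
proof -
  have "(\<Sum>\<mu>\<in>\<Lambda>. Pw (hwv \<mu>) *v x) = Pw w1 *v x + (Pw w2 *v x + Pw w0 *v x)"
    unfolding \<Lambda>_def using Lam_distinct by (simp add: hwv_simps')
  also have "\<dots> = (Pw w1 + Pw w2 + Pw w0) *v x" by (simp add: matrix_vector_mult_add_rdistrib)
  finally show ?thesis by (simp add: Pw_sum)
qed

lemma Wd_decomposition: "B_decomposition r s (VV 1 1) \<Lambda> Wd"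
  unfolding B_decomposition_def
proof (intro conjI ballI allI)
  fix \<mu> assume "\<mu> \<in> \<Lambda>" then show "B_irrep r s (VV 1 1) \<mu> (Wd \<mu>)" by (rule Wd_irrep)
next
  fix x
  \<comment> \<open>Members of \<open>PiE\<close> take a default value outside \<Lambda>, and
    uniqueness of the family depends on it; hence the restriction.\<close>
  let ?g = "restrict (\<lambda>\<mu>. Pw (hwv \<mu>) *v x) \<Lambda>"
  show "\<exists>!f. f \<in> PiE \<Lambda> Wd \<and> x = (\<Sum>\<mu>\<in>\<Lambda>. f \<mu>)"
  proof (rule ex1I[of _ ?g])
    have "?g \<in> PiE \<Lambda> Wd"
      using Pw_hwv_mult by (auto simp: Wd_def Wsp_def matrix_vector_mul_assoc)
    then show "?g \<in> PiE \<Lambda> Wd \<and> x = (\<Sum>\<mu>\<in>\<Lambda>. ?g \<mu>)" using Pw_hwv_sum[of x] by simp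
  next
    fix f assume f: "f \<in> PiE \<Lambda> Wd \<and> x = (\<Sum>\<mu>\<in>\<Lambda>. f \<mu>)"
    show "f = ?g"
    proof (rule PiE_ext[of f \<Lambda> Wd ?g])
      show "f \<in> PiE \<Lambda> Wd" using f by blast
      show "?g \<in> PiE \<Lambda> Wd" using Pw_hwv_mult by (auto simp: Wd_def Wsp_def matrix_vector_mul_assoc)
      fix \<nu> assume \<nu>: "\<nu> \<in> \<Lambda>"
      have "Pw (hwv \<nu>) *v x = (\<Sum>\<mu>\<in>\<Lambda>. Pw (hwv \<nu>) *v f \<mu>)" using f by (simp add: vec.sum)
      also have "\<dots> = (\<Sum>\<mu>\<in>\<Lambda>. if \<mu> = \<nu> then f \<mu> else 0)"
        by (rule sum.cong[OF refl]) (use f \<nu> Pw_on_Wd in blast)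
      also have "\<dots> = f \<nu>" using \<nu> finite_Lam by simp
      finally show "f \<nu> = ?g \<nu>" using \<nu> by simp
    qed
  qed
qed

lemma Bsub_Int: "Bsub U \<Longrightarrow> Bsub U' \<Longrightarrow> Bsub (U \<inter> U')"
  unfolding B_submodule_def by (auto intro: vec.subspace_inter)

text \<open>The decomposition is multiplicity free: the highest weight vector in
  \<open>W \<mu>\<close> is a multiple of \<open>hwv \<mu>\<close>, so the two irreducible
  submodules meet nontrivially and coincide.\<close>

lemma decomposition_unique:
  assumes W: "B_decomposition r s (VV 1 1) \<Lambda> W" and \<mu>: "\<mu> \<in> \<Lambda>"
  shows "W \<mu> = Wd \<mu>"
proof -
  have I: "B_irrep r s (VV 1 1) \<mu> (W \<mu>)" using W \<mu> unfolding B_decomposition_def by blast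
  then obtain w where w: "w \<in> W \<mu>" "w \<noteq> 0" "\<forall>i\<in>{1..r}. EE i *v w = 0 \<and> Khalf s (VV 1 1) i 2 *v w = (q_sub r s i ^ \<mu> i) *s w"
    unfolding B_irrep_def by blast
  obtain t where t: "w = t *s hwv \<mu>" using hwv_unique[OF \<mu>, of w] w(3) by blast
  have sub: "Bsub (W \<mu>)" using I unfolding B_irrep_def by blast
  have "hwv \<mu> \<in> W \<mu>" using submodule_vec_closed[OF sub w(1) _ t] t w(2) by auto
  moreover have "hwv \<mu> \<in> Wd \<mu>" unfolding Wd_def by (rule Wsp_mem[OF hwv_mem])
  ultimately have ne: "W \<mu> \<inter> Wd \<mu> \<noteq> {0}" using hwv_nz by blast
  have "Bsub (W \<mu> \<inter> Wd \<mu>)" using Bsub_Int[OF sub] Wsp_sub[OF hwv_mem] unfolding Wd_def by blast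
  then have "W \<mu> \<inter> Wd \<mu> = W \<mu>" "W \<mu> \<inter> Wd \<mu> = Wd \<mu>"
    using ne I Wd_irrep[OF \<mu>] unfolding B_irrep_def by (metis inf_le1 inf_le2)+
  then show ?thesis by simp
qed

text \<open>Uniqueness of the summands makes the definite description in \<open>B_projector\<close>
  well defined.\<close>

lemma proj_eq:
  assumes \<nu>: "\<nu> \<in> \<Lambda>"
  shows "proj r s c pos \<nu> = Pw (hwv \<nu>)"
  unfolding proj_def B_projector_def \<Lambda>_def[symmetric]
proof (rule the_equality)
  show "\<exists>W. B_decomposition r s (VV 1 1) \<Lambda> W \<and> (\<forall>\<mu>\<in>\<Lambda>. \<forall>x\<in>W \<mu>. Pw (hwv \<nu>) *v x = (if \<mu> = \<nu> then x else 0))"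
    using Wd_decomposition Pw_on_Wd[OF _ \<nu>] by blast
  fix P assume "\<exists>W. B_decomposition r s (VV 1 1) \<Lambda> W \<and> (\<forall>\<mu>\<in>\<Lambda>. \<forall>x\<in>W \<mu>. P *v x = (if \<mu> = \<nu> then x else 0))"
  then obtain W where W: "B_decomposition r s (VV 1 1) \<Lambda> W" "\<forall>\<mu>\<in>\<Lambda>. \<forall>x\<in>W \<mu>. P *v x = (if \<mu> = \<nu> then x else 0)" by blast
  have P: "P *v x = (if \<mu> = \<nu> then x else 0)" if "\<mu> \<in> \<Lambda>" "x \<in> Wd \<mu>" for \<mu> x
    using W decomposition_unique[OF W(1)] that by blast
  have "P *v x = Pw (hwv \<nu>) *v x" for x
  proof -
    have mem: "Pw (hwv \<mu>) *v x \<in> Wd \<mu>" if "\<mu> \<in> \<Lambda>" for \<mu>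
      using Pw_hwv_mult[OF that that] by (simp add: Wd_def Wsp_def matrix_vector_mul_assoc)
    have "P *v x = (\<Sum>\<mu>\<in>\<Lambda>. P *v (Pw (hwv \<mu>) *v x))"
      by (subst Pw_hwv_sum[of x, symmetric]) (simp add: vec.sum)
    also have "\<dots> = (\<Sum>\<mu>\<in>\<Lambda>. if \<mu> = \<nu> then Pw (hwv \<mu>) *v x else 0)"
      by (rule sum.cong[OF refl]) (use P mem in blast)
    also have "\<dots> = Pw (hwv \<nu>) *v x" using \<nu> finite_Lam by simp
    finally show ?thesis .
  qed
  then show "P = Pw (hwv \<nu>)" using matrix_eq by blast
qed

lemma Rm_proj:
  assumes "good z"
  shows "Rm z = proj r s c pos (\<lambda>i. 2 * omega 1 i) + f2 z *\<^sub>m proj r s c pos (ext_wt r) + f0 z *\<^sub>m proj r s c pos (omega 0)"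
proof -
  have "Rm z = 1 *\<^sub>m Pw w1 + f2 z *\<^sub>m Pw w2 + f0 z *\<^sub>m Pw w0"
    using Rm_w[OF assms] by (intro B_comm_spectral Rm_B_comm assms) simp_all
  moreover have "1 *\<^sub>m A = A" for A :: "complex^('n \<times> 'n)^('n \<times> 'n)" by (simp add: smult_mat_def vec_eq_iff)
  ultimately show ?thesis
    using proj_eq[of "\<lambda>i. 2 * omega 1 i"] proj_eq[of "ext_wt r"] proj_eq[of "omega 0"]
    by (simp add: hwv_simps' \<Lambda>_def)
qed

section \<open>Uniqueness of the normalized homomorphism\<close>

lemma hom_B_comm:
  assumes "qmod_hom r s (VV a b) (VV b a) T"
  shows "B_comm T"
  unfolding B_comm_def
proof (intro ballI conjI)
  fix i assume i: "i \<in> {1..r}"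
  have h: "T ** Eact (VV a b) i = Eact (VV b a) i ** T" "T ** Fact (VV a b) i = Fact (VV b a) i ** T"
    "T ** Khalf s (VV a b) i 2 = Khalf s (VV b a) i 2 ** T"
    using assms i unfolding qmod_hom_def by simp_all
  show "T ** EE i = EE i ** T" "T ** FF i = FF i ** T" using h(1,2) unfolding VV_indep[OF i, of a b] VV_indep[OF i, of b a] .
  show K: "T ** Khalf s (VV 1 1) i 2 = Khalf s (VV 1 1) i 2 ** T" using h(3) unfolding Khalf_indep[of a b] Khalf_indep[of b a] .
  \<comment> \<open>Homomorphisms are only required to respect \<open>K\<^sub>i\<close>; for its
    inverse one divides by the nonzero eigenvalues, entry by entry.\<close>
  show "T ** Khalf s (VV 1 1) i (-2) = Khalf s (VV 1 1) i (-2) ** T"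
    unfolding Khalf_comm_iff
  proof (intro allI)
    fix p p'
    have "T $ p $ p' * s powi (2 * wt (VV 1 1) i p') = s powi (2 * wt (VV 1 1) i p) * T $ p $ p'"
      using K unfolding Khalf_comm_iff by blast
    then show "T $ p $ p' * s powi (- 2 * wt (VV 1 1) i p') = s powi (- 2 * wt (VV 1 1) i p) * T $ p $ p'"
      by (simp add: power_int_minus field_simps)
  qed
qed

lemma E0_axis:
  "Eact (VV a b) 0 *v axis (x, y) 1 =
    (if pos x = 1 then a * s powi fund_wt r 0 (pos y) else 0) *s axis (idx (2 * r + 1), y) 1
    + (if pos y = 1 then b * s powi (- fund_wt r 0 (pos x)) else 0) *s axis (x, idx (2 * r + 1)) 1"
  unfolding vec_eq_iff vec_mult_axis VV_E0_col by (simp add: axis_def)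

text \<open>These two vectors span the plane containing \<open>E\<^sub>0 w2\<close>. Their index sum
  is \<open>2 * r + 3\<close>, so only the type A part acts, and at \<open>z = 0\<close> it is
  triangular up to the exchange of factors.\<close>

lemma Rm_0_exterior:
  "Rm 0 *v axis (idx (2 * r + 1), idx 2) 1 = (1 - 1 / s ^ 4) *s axis (idx (2 * r + 1), idx 2) 1 + (1 / s ^ 2) *s axis (idx 2, idx (2 * r + 1)) 1"
  "Rm 0 *v axis (idx 2, idx (2 * r + 1)) 1 = (1 / s ^ 2) *s axis (idx (2 * r + 1), idx 2) 1"
proof -
  have D: "D1 0 = s ^ 2" by (simp add: D1_eq power_numeral_reduce)
  have al: "al 0 (2 * r + 1) 2 = 1 - 1 / s ^ 4" "al 0 2 (2 * r + 1) = 0" "be 0 = 1 / s ^ 2"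
    using r2 D by (simp_all add: al_def be_def eta_eq field_simps power_numeral_reduce)
  have 1: "Rf 0 k l (2 * r + 1) 2 = (if k = 2 * r + 1 \<and> l = 2 then 1 - 1 / s ^ 4 else 0) + (if k = 2 \<and> l = 2 * r + 1 then 1 / s ^ 2 else 0)" for k l
    unfolding Rf_def Af_def using r2 al by auto
  have 2: "Rf 0 k l 2 (2 * r + 1) = (if k = 2 * r + 1 \<and> l = 2 then 1 / s ^ 2 else 0)" for k l
    unfolding Rf_def Af_def using r2 al by auto
  have "(Rm 0 *v axis (idx (2 * r + 1), idx 2) 1) $ (x, y) =
    ((1 - 1 / s ^ 4) *s axis (idx (2 * r + 1), idx 2) 1 + (1 / s ^ 2) *s axis (idx 2, idx (2 * r + 1)) 1) $ (x, y)" for x y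
    unfolding vec_mult_axis Rm_entry using r2 1 by (auto simp: axis_def idx_eq_iff)
  then show "Rm 0 *v axis (idx (2 * r + 1), idx 2) 1 = (1 - 1 / s ^ 4) *s axis (idx (2 * r + 1), idx 2) 1 + (1 / s ^ 2) *s axis (idx 2, idx (2 * r + 1)) 1"
    by (simp add: vec_eq_iff)
  have "(Rm 0 *v axis (idx 2, idx (2 * r + 1)) 1) $ (x, y) = ((1 / s ^ 2) *s axis (idx (2 * r + 1), idx 2) 1) $ (x, y)" for x y
    unfolding vec_mult_axis Rm_entry using r2 2 by (auto simp: axis_def idx_eq_iff)
  then show "Rm 0 *v axis (idx 2, idx (2 * r + 1)) 1 = (1 / s ^ 2) *s axis (idx (2 * r + 1), idx 2) 1"
    by (simp add: vec_eq_iff)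
qed

text \<open>The eigenvalue on \<open>w2\<close> is found from the difference \<open>D\<close> with \<open>Rm\<close>. Its image lies in the eigenspace of
  \<open>Rm 0\<close> generated by \<open>w2\<close>, but \<open>E\<^sub>0 w2\<close> does not, unless \<open>a = q\<^sup>2 b\<close>.\<close>

lemma hom_unique:
  assumes a: "a \<noteq> 0" "b \<noteq> 0" and z: "good (a / b)" and T: "qmod_hom r s (VV a b) (VV b a) T" and n: "T *v w1 = w1"
  shows "T = Rm (a / b)"
proof -
  let ?z = "a / b"
  have Tc: "B_comm T" by (rule hom_B_comm[OF T])
  have TE0: "T ** Eact (VV a b) 0 = Eact (VV b a) 0 ** T" using T unfolding qmod_hom_def by simp
  have w: "fund_wt r 0 1 = -2" "fund_wt r 0 2 = 0" using r2 by (simp_all add: fund_wt_0)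
  have yin: "Eact (VV a b) 0 *v w1 = b *s y_in ?z" 
    unfolding w1_axis E0_axis y_in_def using a w by (simp add: vec.scale_right_distrib power_int_minus inverse_eq_divide)
  have yout: "Eact (VV b a) 0 *v w1 = b *s y_out ?z" 
    unfolding w1_axis E0_axis y_out_def using a w by (simp add: vec.scale_right_distrib power_int_minus inverse_eq_divide)
  have "T *v (Eact (VV a b) 0 *v w1) = Eact (VV b a) 0 *v (T *v w1)"
    by (simp add: matrix_vector_mul_assoc TE0)
  then have "b *s (T *v y_in ?z) = b *s y_out ?z" unfolding n yin yout by (simp add: vec.scale)
  then have "T *v y_in ?z = y_out ?z" using a by simp
  then have T0: "T *v w0 = f0 ?z *s w0" by (rule singlet_eigenvalue[OF Tc _ z])
  obtain t2 where t2: "T *v w2 = t2 *s w2" using B_comm_eigen[OF Tc] by blast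
  define D where "D = T - Rm ?z"
  define \<delta> where "\<delta> = t2 - f2 ?z"
  have Dc: "B_comm D" unfolding D_def by (intro B_comm_intros Tc z)
  have D: "D *v w1 = 0" "D *v w2 = \<delta> *s w2" "D *v w0 = 0"
    unfolding D_def \<delta>_def matrix_vector_mult_diff_rdistrib using n t2 T0 Rm_w[OF z]
    by (simp_all add: vec.scale_left_diff_distrib)
  have DE0: "D ** Eact (VV a b) 0 = Eact (VV b a) 0 ** D"
    unfolding D_def matrix_mult_diff TE0 Rm_E0[OF a z] ..
  \<comment> \<open>It suffices to compare on the three generating vectors: \<open>D\<close> kills
    \<open>w1\<close> and \<open>w0\<close>, and on \<open>w2\<close> the operator
    \<open>Rm 0\<close> has eigenvalue \<open>f2 0\<close>.\<close>
  have CD: "Rm 0 ** D = f2 0 *\<^sub>m D"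
    by (rule B_comm_eqI) (use D Rm_w[OF good_0] in \<open>auto intro!: B_comm_intros Dc good_0 simp: smult_mat_vec vec.scale mult.commute simp flip: matrix_vector_mul_assoc\<close>)
  define y where "y = b *s axis (idx (2 * r + 1), idx 2) 1 - (a / s ^ 2) *s (axis (idx 2, idx (2 * r + 1)) 1 :: complex^('n \<times> 'n))"
  have Ew2: "Eact (VV b a) 0 *v w2 = y"
    unfolding w2_axis vec.diff vec.scale E0_axis y_def using r2 w by simp
  have "D *v (Eact (VV a b) 0 *v w2) = Eact (VV b a) 0 *v (D *v w2)"
    by (simp add: matrix_vector_mul_assoc DE0)
  then have "\<delta> *s y = D *v (Eact (VV a b) 0 *v w2)" unfolding D(2) by (simp add: vec.scale Ew2)
  moreover have "Rm 0 *v (D *v x) = f2 0 *s (D *v x)" for x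
    by (simp only: matrix_vector_mul_assoc CD smult_mat_vec)
  ultimately have "Rm 0 *v (\<delta> *s y) = f2 0 *s (\<delta> *s y)" by simp
  then have eq: "\<delta> *s (Rm 0 *v y) = \<delta> *s (f2 0 *s y)" by (simp add: vec.scale mult.commute)
  have "\<delta> = 0"
  proof (rule ccontr)
    assume "\<delta> \<noteq> 0"
    then have eq': "Rm 0 *v y = f2 0 *s y" using eq by (simp only: vector_mul_lcancel simp_thms)
    have ne: "idx 2 \<noteq> idx (2 * r + 1)"
    proof
      assume "idx 2 = idx (2 * r + 1)"
      then have "pos (idx 2) = pos (idx (2 * r + 1))" by simp
      then show False using r2 by simp
    qed
    \<comment> \<open>At this coordinate only the first summand of \<open>y\<close> contributes to
      the image under \<open>Rm 0\<close>; the comparison gives \<open>a = s ^ 4 * b\<close>, the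
      first pole.\<close>
    have "(Rm 0 *v y) $ (idx 2, idx (2 * r + 1)) = b / s ^ 2"
      unfolding y_def vec.diff vec.scale Rm_0_exterior using ne by (simp add: axis_def)
    moreover have "(f2 0 *s y) $ (idx 2, idx (2 * r + 1)) = (1 / s ^ 4) * (a / s ^ 2)"
      unfolding y_def C_eigenvalues using ne by (simp add: axis_def)
    ultimately have "b / s ^ 2 = (1 / s ^ 4) * (a / s ^ 2)" unfolding eq' by simp
    then have "b / s ^ 2 = (a / s ^ 4) / s ^ 2" by simp
    then have "b = a / s ^ 4" by (subst (asm) divide_cancel_right) simp
    then have "a / b = s ^ 4" using a by (simp add: field_simps)
    then show False using goodD(1)[OF z] by simp
  qed
  then have "D = 0" using D by (intro B_comm_eqI[OF Dc B_comm_zero]) simp_all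
  then show ?thesis by (simp add: D_def)
qed


end

lemma sum_single_pair:
  fixes f :: "nat \<times> nat \<Rightarrow> complex"
  assumes "finite A"
  shows "(\<Sum>p\<in>A. if p = p0 \<and> Q then f p else 0) = (if p0 \<in> A \<and> Q then f p0 else 0)"
  using assms by (cases Q) (simp_all add: sum.delta)

section \<open>Irreducibility of the first fundamental module\<close>

context A2r_setting
begin

lemma fund_E_nth:
  assumes i: "i \<in> {1..r}"
  shows "(Eact (V a) i *v x) $ p = (if raises i (pos p) then coef i * x $ idx (pos p + 1) else 0)"
proof -
  have "Eact (V a) i $ p $ y * x $ y = (if y = idx (pos p + 1) then (if raises i (pos p) then coef i * x $ y else 0) else 0)" for y
    unfolding fund_E_entry[OF i] using raises_le[OF i, of "pos p"] idx_eq_iff[of "pos p + 1" y] by auto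
  then show ?thesis by (simp add: matrix_vector_mult_def)
qed

lemma fund_F_axis:
  assumes i: "i \<in> {1..r}" and k: "raises i k"
  shows "Fact (V a) i *v axis (idx k) 1 = coef i *s axis (idx (k + 1)) 1"
proof -
  have b: "1 \<le> k" "k \<le> 2 * r" using raises_le[OF i k] by auto
  have "(Fact (V a) i *v axis (idx k) 1) $ p = (coef i *s axis (idx (k + 1)) 1) $ p" for p
    unfolding vec_mult_axis fund_F_transpose[OF i] using b k
    by (auto simp: transpose_def fund_E_entry[OF i] axis_def idx_eq_iff)
  then show ?thesis by (simp add: vec_eq_iff)
qed

text \<open>The \<open>E\<^sub>i\<close> move the support towards the top of the chain. Since every
  edge has a color, a vector killed by all of them is supported on the first basis vector.\<close>

lemma submodule_contains_top:
  assumes U: "B_submodule r s (V a) U"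
  shows "x \<in> U \<Longrightarrow> x \<noteq> 0 \<Longrightarrow> (\<And>p. pos p > n \<Longrightarrow> x $ p = 0) \<Longrightarrow> axis (idx 1) 1 \<in> U"
proof (induction n arbitrary: x)
  case 0
  then have "x = 0" by (simp add: vec_eq_iff)
  then show ?case using 0 by simp
next
  case (Suc n)
  show ?case
  proof (cases "\<forall>i\<in>{1..r}. Eact (V a) i *v x = 0")
    case True
    define t where "t = x $ idx 1"
    have "x $ p = (t *s axis (idx 1) 1) $ p" for p
    proof (cases "pos p = 1")
      case True
      then have "p = idx 1" by (simp add: idx_eq_iff)
      then show ?thesis by (simp add: axis_def t_def)
    next
      case False
      define k where "k = pos p - 1"
      have k: "1 \<le> k" "k \<le> 2 * r" "pos p = k + 1" using False pos_range(1,4)[of p] unfolding k_def by linarith+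
      obtain i where i: "i \<in> {1..r}" "raises i k" by (rule raises_color[OF k(1,2)])
      have "(Eact (V a) i *v x) $ idx k = 0" using True i by simp
      moreover have "idx (k + 1) = p" by (metis idx_pos k(3))
      ultimately have "x $ p = 0" using i k(1,2) unfolding fund_E_nth[OF i(1)] by simp
      moreover have "p \<noteq> idx 1" using False by (simp add: idx_eq_iff)
      ultimately show ?thesis by (simp add: axis_def)
    qed
    then have xt: "x = t *s axis (idx 1) 1" by (simp add: vec_eq_iff)
    then have "t \<noteq> 0" using Suc.prems(2) by auto
    moreover have "(1 / t) *s x \<in> U" using U Suc.prems(1) unfolding B_submodule_def by (simp add: vec.subspace_scale)
    ultimately show ?thesis unfolding xt by simp
  next
    case False
    then obtain i where i: "i \<in> {1..r}" "Eact (V a) i *v x \<noteq> 0" by blast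
    show ?thesis
    proof (rule Suc.IH)
      show "Eact (V a) i *v x \<in> U" using U i Suc unfolding B_submodule_def by blast
      fix p assume p: "pos p > n"
      have "x $ idx (pos p + 1) = 0" if "raises i (pos p)"
        using raises_le[OF i(1) that] p by (intro Suc.prems) simp
      then show "(Eact (V a) i *v x) $ p = 0" unfolding fund_E_nth[OF i(1)] by simp
    qed (rule i(2))
  qed
qed

text \<open>From the top vector the \<open>F\<^sub>i\<close> descend the chain one edge at a time,
  with the nonzero factor \<open>coef i\<close>.\<close>

lemma fund_irreducible:
  assumes U: "B_submodule r s (V a) U" "U \<noteq> {0}"
  shows "U = UNIV"
proof -
  have sp: "vec.subspace U" using U(1) by (simp add: B_submodule_def)
  then obtain x where x: "x \<in> U" "x \<noteq> 0" using U(2) vec.subspace_0 by blast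
  have "axis (idx k) 1 \<in> U" if "1 \<le> k" "k \<le> 2 * r + 1" for k
    using that
  proof (induction k rule: dec_induct)
    case base
    have "x $ p = 0" if "pos p > 2 * r + 1" for p using that pos_range(4)[of p] by linarith
    then show ?case using submodule_contains_top[OF U(1) x, of "2 * r + 1"] by blast
  next
    case (step k)
    then have k: "1 \<le> k" "k \<le> 2 * r" by simp_all
    obtain i where i: "i \<in> {1..r}" "raises i k" by (rule raises_color[OF k])
    have "Fact (V a) i *v axis (idx k) 1 \<in> U" using U(1) i step unfolding B_submodule_def by simp
    then have "(1 / coef i) *s (coef i *s axis (idx (k + 1)) 1) \<in> U"
      unfolding fund_F_axis[OF i] using vec.subspace_scale[OF sp] by blast
    then show ?case by (simp add: vector_smult_assoc)
  qed
  then have ax: "axis p 1 \<in> U" for p using idx_pos[of p] pos_range(1,4)[of p] by metis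
  have "y \<in> U" for y
  proof -
    have "y = (\<Sum>p\<in>UNIV. y $ p *s axis p 1)"
      by (simp add: vec_eq_iff axis_def if_distrib cong: if_cong)
    also have "\<dots> \<in> U" by (intro vec.subspace_sum[OF sp] vec.subspace_scale[OF sp] ax)
    finally show ?thesis .
  qed
  then show ?thesis by blast
qed

lemma fund_B_irrep: "B_irrep r s (V a) (omega 1) UNIV"
proof -
  let ?v = "axis (idx 1) 1 :: complex^'n"
  have "Eact (V a) i *v ?v = 0 \<and> Khalf s (V a) i 2 *v ?v = (q_sub r s i ^ omega 1 i) *s ?v" if i: "i \<in> {1..r}" for i
  proof
    have "(Eact (V a) i *v ?v) $ p = 0" for p
      unfolding vec_mult_axis fund_E_entry[OF i] by simp
    then show "Eact (V a) i *v ?v = 0" by (simp add: vec_eq_iff)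
    have "(Khalf s (V a) i 2 *v ?v) $ p = ((q_sub r s i ^ omega 1 i) *s ?v) $ p" for p
      unfolding Khalf_nth using fund_wt_1[OF i] r2 by (auto simp: axis_def q_sub_def omega_def)
    then show "Khalf s (V a) i 2 *v ?v = (q_sub r s i ^ omega 1 i) *s ?v" by (simp only: vec_eq_iff simp_thms)
  qed
  moreover have "?v \<noteq> 0" by simp
  moreover have "B_submodule r s (V a) UNIV" by (simp add: B_submodule_def)
  ultimately show ?thesis
    unfolding B_irrep_def using fund_irreducible by blast
qed

section \<open>Entries of the formula in matrix units\<close>

lemma mat_unit_tensor_entry:
  "(mat_unit pos i j \<otimes>\<^sub>m mat_unit pos k l) $ (x, y) $ (x', y') =
    (if pos x = i \<and> pos x' = j \<and> pos y = k \<and> pos y' = l then 1 else 0)"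
  by (simp add: tensor_mat_def mat_unit_def)

lemma diagonal_units_entry:
  assumes "finite A"
  shows "(\<Sum>(i, j)\<in>A. mat_unit pos i i \<otimes>\<^sub>m mat_unit pos j j) $ (x, y) $ (x', y') =
    (if (pos x, pos y) \<in> A \<and> x = x' \<and> y = y' then 1 else 0)"
proof -
  have "(\<Sum>(i, j)\<in>A. mat_unit pos i i \<otimes>\<^sub>m mat_unit pos j j) $ (x, y) $ (x', y') =
    (\<Sum>p\<in>A. if p = (pos x, pos y) \<and> (x = x' \<and> y = y') then 1 else 0)"
    unfolding sum_component by (rule sum.cong[OF refl]) (auto simp: mat_unit_tensor_entry split: if_splits)
  then show ?thesis using sum_single_pair[OF assms, of "(pos x, pos y)" "x = x' \<and> y = y'" "\<lambda>_. 1"] by simp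
qed

lemma swap_units_entry:
  assumes "finite A"
  shows "(\<Sum>(i, j)\<in>A. mat_unit pos i j \<otimes>\<^sub>m mat_unit pos j i) $ (x, y) $ (x', y') =
    (if (pos x, pos y) \<in> A \<and> x = y' \<and> y = x' then 1 else 0)"
proof -
  have "(\<Sum>(i, j)\<in>A. mat_unit pos i j \<otimes>\<^sub>m mat_unit pos j i) $ (x, y) $ (x', y') =
    (\<Sum>p\<in>A. if p = (pos x, pos y) \<and> (x = y' \<and> y = x') then 1 else 0)"
    unfolding sum_component by (rule sum.cong[OF refl]) (auto simp: mat_unit_tensor_entry split: if_splits)
  then show ?thesis using sum_single_pair[OF assms, of "(pos x, pos y)" "x = y' \<and> y = x'" "\<lambda>_. 1"] by simp
qed

lemma bar_units_entry:
  assumes "finite A"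
  shows "(\<Sum>(i, j)\<in>A. t i j *\<^sub>m (mat_unit pos i j \<otimes>\<^sub>m mat_unit pos (bar r i) (bar r j))) $ (x, y) $ (x', y') =
    (if (pos x, pos x') \<in> A \<and> pos x + pos y = 2 * r + 2 \<and> pos x' + pos y' = 2 * r + 2 then t (pos x) (pos x') else 0)"
proof -
  have b: "pos b = bar r (pos a) \<longleftrightarrow> pos a + pos b = 2 * r + 2" for a b
    using pos_range(4)[of a] unfolding bar_def by linarith
  have "(\<Sum>(i, j)\<in>A. t i j *\<^sub>m (mat_unit pos i j \<otimes>\<^sub>m mat_unit pos (bar r i) (bar r j))) $ (x, y) $ (x', y') =
    (\<Sum>p\<in>A. if p = (pos x, pos x') \<and> (pos x + pos y = 2 * r + 2 \<and> pos x' + pos y' = 2 * r + 2) then t (fst p) (snd p) else 0)"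
    unfolding sum_component b[symmetric] by (rule sum.cong[OF refl]) (auto simp: mat_unit_tensor_entry smult_mat_def split: if_splits)
  then show ?thesis
    using sum_single_pair[OF assms, of "(pos x, pos x')" "pos x + pos y = 2 * r + 2 \<and> pos x' + pos y' = 2 * r + 2" "\<lambda>p. t (fst p) (snd p)"]
    by simp
qed

lemma smult_mat_entry: "(t *\<^sub>m A) $ p $ p' = t * A $ p $ p'"
  by (simp add: smult_mat_def)

lemma R_sl_entry: "R_sl r q pos z $ (x, y) $ (x', y') = Af z (pos x) (pos y) (pos x') (pos y')"
proof -
  let ?I = "{1..2*r+1}"
  have 1: "(\<Sum>i\<in>?I. mat_unit pos i i \<otimes>\<^sub>m mat_unit pos i i) $ (x, y) $ (x', y') =
    (if x = y \<and> x = x' \<and> y = y' then 1 else 0)"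
  proof -
    have "(\<Sum>i\<in>?I. mat_unit pos i i \<otimes>\<^sub>m mat_unit pos i i) $ (x, y) $ (x', y') =
      (\<Sum>i\<in>?I. if i = pos x then (if x = y \<and> x = x' \<and> y = y' then 1 else 0) else 0)"
      unfolding sum_component by (rule sum.cong[OF refl]) (auto simp: mat_unit_tensor_entry)
    also have "\<dots> = (if pos x \<in> ?I then (if x = y \<and> x = x' \<and> y = y' then 1 else 0) else 0)"
      by (rule sum.delta) simp
    finally show ?thesis by simp
  qed
  have f: "finite {(i, j) \<in> ?I \<times> ?I. P i j}" for P :: "nat \<Rightarrow> nat \<Rightarrow> bool"
    by (auto intro: finite_subset[of _ "?I \<times> ?I"])
  have m: "(pos x, pos y) \<in> {(i, j) \<in> ?I \<times> ?I. P i j} \<longleftrightarrow> P (pos x) (pos y)" for P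
    by simp
  have split: "(if e \<and> P then 1 else 0) + \<alpha> * (if L \<and> P then 1 else 0) + \<beta> * (if G \<and> P then 1 else 0)
      + \<gamma> * (if \<not> e \<and> Q \<and> Q' then 1 else 0)
    = (if P then if e then 1 else if L then \<alpha> else \<beta> else 0) + (if Q \<and> Q' \<and> \<not> e then \<gamma> else 0)"
    if "L \<Longrightarrow> \<not> e" "G \<longleftrightarrow> \<not> e \<and> \<not> L" for e P L G Q Q' and \<alpha> \<beta> \<gamma> :: complex
    using that by (cases e; cases L; cases P; cases Q; cases Q') simp_all
  have less: "pos y < pos x \<longleftrightarrow> x \<noteq> y \<and> \<not> pos x < pos y" "pos x < pos y \<Longrightarrow> x \<noteq> y"
    unfolding pos_eq_iff[symmetric] by linarith+
  show ?thesis
    unfolding R_sl_def Let_def vector_add_component smult_mat_entry 1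
      diagonal_units_entry[OF f] swap_units_entry[OF f] m
      D1_def[symmetric] eta_def[symmetric] be_def[symmetric] Af_def al_def pos_eq_iff
    by (rule split[OF less(2,1)])
qed

text \<open>The four terms have disjoint supports, according to whether the pair of first indices
  lies before, after or on the antidiagonal, or at its center.\<close>

lemma Q_mat_entry:
  "Q_mat r q s pos z $ (x, y) $ (x', y') =
    (if pos x + pos y = 2 * r + 2 \<and> pos x' + pos y' = 2 * r + 2 then Qc z (pos x) (pos x') else 0)"
proof -
  let ?I = "{1..2*r+1}"
  have f: "finite {(i, j) \<in> ?I \<times> ?I. P i j}" for P :: "nat \<Rightarrow> nat \<Rightarrow> bool"
    by (auto intro: finite_subset[of _ "?I \<times> ?I"])
  have one: "1 *\<^sub>m A = A" for A :: "complex^('n \<times> 'n)^('n \<times> 'n)" by (simp add: smult_mat_def vec_eq_iff)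
  have e3: "(\<Sum>(i, j)\<in>{(i, j)\<in>?I \<times> ?I. i + j = 2 * r + 2 \<and> i \<noteq> r + 1}. mat_unit pos i j \<otimes>\<^sub>m mat_unit pos (bar r i) (bar r j)) $ (x, y) $ (x', y')
     = (if (pos x, pos x') \<in> {(i, j)\<in>?I \<times> ?I. i + j = 2 * r + 2 \<and> i \<noteq> r + 1} \<and> pos x + pos y = 2 * r + 2 \<and> pos x' + pos y' = 2 * r + 2 then 1 else 0)"
    using bar_units_entry[OF f, where t = "\<lambda>_ _. 1"] unfolding one .
  have p: "s powi (- 2 * int r - 1) = 1 / u"
  proof -
    have "- 2 * int r - 1 = - int (2 * r + 1)" by simp
    then show ?thesis unfolding u_def by (simp only: power_int_minus power_int_of_nat inverse_eq_divide)
  qed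
  have qp: "q powi (- int r) = s / u" "q powi (- int r - 1) = 1 / (u * s)" "q ^ (r + 1) = u * s"
  proof -
    have q1: "q ^ (r + 1) = u * s" unfolding power_add q_pow_r by (simp add: s2[symmetric] power2_eq_square)
    have "- int r - 1 = - int (r + 1)" by simp
    then show "q powi (- int r - 1) = 1 / (u * s)" by (simp only: power_int_minus power_int_of_nat q1 inverse_eq_divide)
    show "q powi (- int r) = s / u" using q_pow_r by (simp add: power_int_minus)
    show "q ^ (r + 1) = u * s" by (rule q1)
  qed
  have m: "(pos x, pos x') \<in> {(i, j) \<in> ?I \<times> ?I. P i j} \<longleftrightarrow> P (pos x) (pos x')" for P
    by simp
  have split: "z * (if k + m < 2 * r + 2 \<and> k + l = 2 * r + 2 \<and> m + n = 2 * r + 2 then A else 0)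
      - (if k + m > 2 * r + 2 \<and> k + l = 2 * r + 2 \<and> m + n = 2 * r + 2 then B else 0)
      - C * (if (k + m = 2 * r + 2 \<and> k \<noteq> r + 1) \<and> k + l = 2 * r + 2 \<and> m + n = 2 * r + 2 then 1 else 0)
      - D * (if k = r + 1 \<and> m = r + 1 \<and> l = r + 1 \<and> n = r + 1 then 1 else 0)
    = (if k + l = 2 * r + 2 \<and> m + n = 2 * r + 2 then
        if k + m < 2 * r + 2 then z * A else if k + m > 2 * r + 2 then - B else if k = r + 1 then - D else - C
       else 0)" for k l m n and A B C D :: complex
  proof (cases "k + l = 2 * r + 2 \<and> m + n = 2 * r + 2")
    case True
    then have "k = r + 1 \<and> m = r + 1 \<and> l = r + 1 \<and> n = r + 1 \<longleftrightarrow> k + m = 2 * r + 2 \<and> k = r + 1" by linarith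
    then show ?thesis using True by (cases "k + m" "2 * r + 2" rule: linorder_cases; cases "k = r + 1") simp_all
  qed auto
  show ?thesis
    unfolding Q_mat_def Let_def vector_add_component vector_minus_component smult_mat_entry
      bar_units_entry[OF f] e3 mat_unit_tensor_entry p qp q_pow_r u_def[symmetric] m split
    by (simp add: Qc_def a0_def a1_def)
qed

lemma Rm_units: "Rm z = R_sl r q pos z + gz z *\<^sub>m Q_mat r q s pos z"
proof -
  have "Rm z $ (x, y) $ (x', y') = (R_sl r q pos z + gz z *\<^sub>m Q_mat r q s pos z) $ (x, y) $ (x', y')" for x y x' y'
    unfolding vector_add_component smult_mat_entry R_sl_entry Q_mat_entry Rm_entry Rf_def by simp
  then show ?thesis by (simp add: vec_eq_iff)
qed

section \<open>Rational dependence on the spectral parameter\<close>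

definition den_poly :: "complex poly" where
  "den_poly = [:q, - inverse q:] * [:u, inverse u:]"

definition Q_poly :: "nat \<Rightarrow> nat \<Rightarrow> complex poly" where
  "Q_poly k m =
    (if k + m < 2 * r + 2 then [:0, ev k * ev m / u:]
     else if k + m > 2 * r + 2 then [:- (ev k * ev m * u):]
     else if k = r + 1 then smult (- (1 / (s + inverse s))) [:u * s, - (1 / (u * s)):]
     else smult (- (1 / (s + inverse s))) [:u / s, - (s / u):])"

text \<open>Numerators of \<open>Rf\<close> over the common denominator: terms with only the first
  pole are multiplied by the second factor of \<open>den_poly\<close>.\<close>

definition num_poly :: "nat \<Rightarrow> nat \<Rightarrow> nat \<Rightarrow> nat \<Rightarrow> complex poly" where
  "num_poly k l m n =
    (if k = m \<and> l = n then (if k = l then den_poly else (if k < l then [:0, eta:] else [:eta:]) * [:u, inverse u:]) else 0)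
    + (if k = n \<and> l = m \<and> k \<noteq> l then [:1, -1:] * [:u, inverse u:] else 0)
    + (if k + l = 2 * r + 2 \<and> m + n = 2 * r + 2 then [:eta, - eta:] * Q_poly k m else 0)"

lemma poly_Q: "poly (Q_poly k m) z = Qc z k m"
  unfolding Q_poly_def Qc_def a0_def a1_def by (simp add: mult_ac diff_divide_distrib)

lemma poly_den: "poly den_poly z = D1 z * D2 z"
  by (simp add: den_poly_def D1_def D2_def algebra_simps)

lemma poly_den_zero_iff: "poly den_poly z = 0 \<longleftrightarrow> \<not> good z"
proof -
  have "good z \<longleftrightarrow> s ^ 4 \<noteq> z \<and> u ^ 2 + z \<noteq> 0"
    unfolding good_def u_sq[symmetric] unfolding s2[symmetric] power_mult[symmetric] 
    by (auto simp: add_eq_0_iff)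
  then show ?thesis unfolding poly_den D1_eq D2_eq by auto
qed

lemma poly_num:
  assumes "good z"
  shows "poly (num_poly k l m n) z = Rf z k l m n * poly den_poly z"
proof -
  have D: "D1 z \<noteq> 0" "D2 z \<noteq> 0" using D_nz[OF assms] by auto
  have g: "gz z * (D1 z * D2 z) = eta - z * eta" using D by (simp add: gz_def) (simp add: algebra_simps)
  have A: "Af z k l m n * (D1 z * D2 z) =
    (if k = m \<and> l = n then (if k = l then D1 z * D2 z else (if k < l then z * eta else eta) * D2 z) else 0)
    + (if k = n \<and> l = m \<and> k \<noteq> l then (1 - z) * D2 z else 0)"
    using D by (auto simp: Af_def al_def be_def)
  have R: "Rf z k l m n * (D1 z * D2 z) = Af z k l m n * (D1 z * D2 z)
    + (if k + l = 2 * r + 2 \<and> m + n = 2 * r + 2 then (eta - z * eta) * Qc z k m else 0)"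
    unfolding Rf_def g[symmetric] by (simp add: algebra_simps)
  have p: "poly [:u, inverse u:] z = D2 z" "poly [:0, eta:] z = z * eta" "poly [:eta:] z = eta"
    "poly [:1, -1:] z = 1 - z" "poly [:eta, - eta:] z = eta - z * eta"
    by (simp_all add: D2_def mult.commute)
  show ?thesis
    unfolding num_poly_def
    by (simp only: poly_den R A poly_add if_distrib[of "\<lambda>p. poly p z"] poly_mult poly_0 p poly_Q)
qed

text \<open>The entries used are (1,2),(2,1) at the first pole and (1,2r+1),(2,2r) at the second.\<close>

lemma num_den_coprime:
  assumes "poly den_poly z = 0"
  shows "\<exists>p p'. poly (num_poly (pos (fst p)) (pos (snd p)) (pos (fst p')) (pos (snd p'))) z \<noteq> 0"
proof -
  have "eta \<noteq> 0" using s_facts by (simp add: eta_eq)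
  have "\<not> good z" using assms poly_den_zero_iff by blast
  then consider "z = s ^ 4" | "z = - (u ^ 2)"
    unfolding good_def u_sq[symmetric] unfolding s2[symmetric] power_mult[symmetric] by auto
  then obtain k l m n where "{k, l, m, n} \<subseteq> {1..2*r+1}" "poly (num_poly k l m n) z \<noteq> 0"
  proof cases
    case 1
    have "poly (num_poly 1 2 2 1) z = (1 - z) * D2 z"
      using r2 by (simp add: num_poly_def D2_def algebra_simps)
    moreover have "1 - z \<noteq> 0" "D2 z \<noteq> 0" using 1 q_nz_facts by (simp_all add: D2_eq)
    ultimately show ?thesis using that[of 1 2 2 1] r2 by simp
  next
    case 2
    \<comment> \<open>This keeps the second pole away from \<open>z = 1\<close>, the zero of the
      factor in front of \<open>Q_mat\<close>.\<close>
    have "u ^ 2 \<noteq> - 1"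
    proof
      assume "u ^ 2 = - 1"
      then have "(q ^ (2 * r + 1)) ^ 2 = 1" unfolding u_sq by simp
      then have "q ^ ((2 * r + 1) * 2) = 1" by (simp only: power_mult)
      then show False using not_root[of "(2 * r + 1) * 2"] by simp
    qed
    then have z: "1 - z \<noteq> 0" "z \<noteq> 0" using 2 by (auto simp: add_eq_0_iff)
    have "poly (num_poly 1 (2 * r + 1) 2 (2 * r)) z = eta * (1 - z) * (z * (ev 1 * ev 2 / u))"
      using r2 by (simp add: num_poly_def Q_poly_def) (simp add: algebra_simps diff_divide_distrib)
    moreover have "ev 1 \<noteq> 0" "ev 2 \<noteq> 0" using ev_nz r2 by simp_all
    ultimately show ?thesis using that[of 1 "2 * r + 1" 2 "2 * r"] r2 z \<open>eta \<noteq> 0\<close> by simp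
  qed
  then show ?thesis by (intro exI[of _ "(idx k, idx l)"] exI[of _ "(idx m, idx n)"]) simp
qed

lemma den_poly_nz: "den_poly \<noteq> 0"
  using poly_den_zero_iff[of 0] good_0 by auto

lemma Rm_rational:
  assumes "poly den_poly z \<noteq> 0"
  shows "Rm z $ p $ p' = poly (num_poly (pos (fst p)) (pos (snd p)) (pos (fst p')) (pos (snd p'))) z / poly den_poly z"
  using assms poly_num[of z] poly_den_zero_iff by (simp add: Rm_def)

lemma Rm_hom_iff:
  assumes a: "a \<noteq> 0" "b \<noteq> 0" and z: "good (a / b)"
  shows "T = Rm (a / b) \<longleftrightarrow> qmod_hom r s (VV a b) (VV b a) T \<and>
    T *v (basis_vec pos 1 \<otimes>\<^sub>v basis_vec pos 1) = basis_vec pos 1 \<otimes>\<^sub>v basis_vec pos 1"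
  unfolding w1_tensor[symmetric] using Rm_hom[OF a z] Rm_w(1)[OF z] hom_unique[OF a z] by blast

lemma Rm_normalized: "normalized_R_matrix r s c pos Rm"
  unfolding normalized_R_matrix_def
proof (intro conjI)
  show "rational_matrix_fun Rm"
    unfolding rational_matrix_fun_def
    using den_poly_nz num_den_coprime Rm_rational
    by (intro exI[of _ den_poly] exI[of _ "\<lambda>p p'. num_poly (pos (fst p)) (pos (snd p)) (pos (fst p')) (pos (snd p'))"]) blast
  have "good z" if "z \<notin> {q ^ 2, - (q ^ (2 * r + 1))}" for z using that by (simp add: good_def)
  then show "\<exists>S. finite S \<and> (\<forall>a b. a \<noteq> 0 \<and> b \<noteq> 0 \<and> a / b \<notin> S \<longrightarrow>
      (\<forall>T. T = Rm (a / b) \<longleftrightarrow> qmod_hom r s (VV a b) (VV b a) T \<and>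
        T *v (basis_vec pos 1 \<otimes>\<^sub>v basis_vec pos 1) = basis_vec pos 1 \<otimes>\<^sub>v basis_vec pos 1))"
    using Rm_hom_iff by (intro exI[of _ "{q ^ 2, - (q ^ (2 * r + 1))}"]) blast
qed

text \<open>Both sides are the unique normalized homomorphism off a finite set, so the
  cross-multiplied polynomials agree identically. Lowest terms are needed at the end: a zero of
  \<open>D\<close> at a good \<open>z\<close> would make all its numerators vanish there.\<close>

lemma normalized_unique:
  assumes R: "normalized_R_matrix r s c pos R" and z: "good z"
  shows "R z = Rm z"
proof -
  let ?N = "\<lambda>p p'. num_poly (pos (fst p)) (pos (snd p)) (pos (fst p')) (pos (snd p'))"
  obtain D N where D: "D \<noteq> 0" "\<And>z. poly D z = 0 \<Longrightarrow> \<exists>p p'. poly (N p p') z \<noteq> 0"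
    "\<And>z p p'. poly D z \<noteq> 0 \<Longrightarrow> R z $ p $ p' = poly (N p p') z / poly D z"
    using R unfolding normalized_R_matrix_def rational_matrix_fun_def by blast
  obtain S where S: "finite S" "\<And>a b T. a \<noteq> 0 \<Longrightarrow> b \<noteq> 0 \<Longrightarrow> a / b \<notin> S \<Longrightarrow> 
      T = R (a / b) \<longleftrightarrow> qmod_hom r s (VV a b) (VV b a) T \<and>
        T *v (basis_vec pos 1 \<otimes>\<^sub>v basis_vec pos 1) = basis_vec pos 1 \<otimes>\<^sub>v basis_vec pos 1"
    using R unfolding normalized_R_matrix_def by blast
  have eq: "R y = Rm y" if "y \<notin> S" "y \<noteq> 0" "good y" for y
    using S(2)[of y 1 "R y"] Rm_hom_iff[of y 1 "R y"] that by simp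
  have cross: "N p p' * den_poly = ?N p p' * D" for p p'
  proof -
    let ?P = "N p p' * den_poly - ?N p p' * D"
    have "poly ?P y = 0" if "y \<notin> S \<union> {0} \<union> {y. poly D y = 0} \<union> {y. poly den_poly y = 0}" for y
    proof -
      have ne: "poly D y \<noteq> 0" "poly den_poly y \<noteq> 0" "R y = Rm y" using that eq poly_den_zero_iff by auto
      then have "poly (N p p') y / poly D y = poly (?N p p') y / poly den_poly y"
        using D(3)[of y p p'] Rm_rational[of y p p'] by simp
      then show ?thesis using ne by (simp add: field_simps)
    qed
    then have "UNIV = {y. poly ?P y = 0} \<union> (S \<union> {0} \<union> {y. poly D y = 0} \<union> {y. poly den_poly y = 0})" by blast
    moreover have "finite (S \<union> {0} \<union> {y. poly D y = 0} \<union> {y. poly den_poly y = 0})"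
      using S(1) D(1) den_poly_nz by (simp add: poly_roots_finite)
    ultimately have "infinite {y. poly ?P y = 0}" by (metis finite_Un infinite_UNIV_char_0)
    then have "?P = 0" using poly_roots_finite by blast
    then show ?thesis by simp
  qed
  have dz: "poly den_poly z \<noteq> 0" using z poly_den_zero_iff by blast
  have cross': "poly (N p p') z * poly den_poly z = poly (?N p p') z * poly D z" for p p'
    using arg_cong[OF cross, of "\<lambda>P. poly P z" p p'] by simp
  have "poly D z \<noteq> 0"
  proof
    assume d: "poly D z = 0"
    then have "poly (N p p') z = 0" for p p' using cross'[of p p'] dz by simp
    then show False using D(2)[OF d] by blast
  qed
  then have "R z $ p $ p' = Rm z $ p $ p'" for p p'
    unfolding D(3)[OF \<open>poly D z \<noteq> 0\<close>] Rm_rational[OF dz] using cross'[of p p'] dz by (simp add: field_simps)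
  then show ?thesis by (simp add: vec_eq_iff)
qed

section \<open>Coefficients in terms of q\<close>

lemma f2_eq: "f2 z = - (q powi (-2) * ((1 - q ^ 2 * z) / (1 - q powi (-2) * z)))" if "good z"
proof -
  have e: "q powi (-2) = 1 / q ^ 2" by (simp add: power_int_minus inverse_eq_divide)
  have "q ^ 2 - z \<noteq> 0" using that by (auto simp: good_def)
  then have ne: "1 - 1 / q ^ 2 * z \<noteq> 0" "D1 z \<noteq> 0" using q0 D_nz[OF that] by (simp_all add: field_simps)
  have D: "D1 z = q * (1 - 1 / q ^ 2 * z)" using q0 by (simp add: D1_def field_simps power2_eq_square)
  have n: "z * eta - (1 - z) / s ^ 2 = - ((1 - q ^ 2 * z) / q)"
    unfolding s2 eta_def using q0 by (simp add: field_simps power2_eq_square)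
  show ?thesis unfolding f2_def D n e using q0 by (simp add: power2_eq_square)
qed

lemma f0_eq: "f0 z = q powi (- 2 * int r - 1) * ((1 + q ^ (2 * r + 1) * z) / (1 + q powi (- 2 * int r - 1) * z))"
proof -
  have "- 2 * int r - 1 = - int (2 * r + 1)" by simp
  then have e: "q powi (- 2 * int r - 1) = 1 / u ^ 2"
    by (simp only: power_int_minus power_int_of_nat u_sq inverse_eq_divide)
  have D: "D2 z = u * (1 + 1 / u ^ 2 * z)" by (simp add: D2_def field_simps power2_eq_square)
  have n: "1 / u + z * u = (1 + u ^ 2 * z) / u" by (simp add: field_simps power2_eq_square)
  show ?thesis unfolding f0_def D n e u_sq[symmetric] by (simp add: power2_eq_square)
qed

lemma gz_eq: "gz z = (q - inverse q) * (1 - z) /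
    ((q - inverse q * z) * (s ^ (2 * r + 1) + s powi (- 2 * int r - 1) * z))"
proof -
  have "- 2 * int r - 1 = - int (2 * r + 1)" by simp
  then have "s powi (- 2 * int r - 1) = inverse u"
    unfolding u_def by (simp only: power_int_minus power_int_of_nat)
  then show ?thesis unfolding gz_def D1_def D2_def eta_def u_def by simp
qed

lemma Rm_spectral:
  assumes "good z"
  shows "Rm z = proj r s c pos (\<lambda>i. 2 * omega 1 i)
    - (q powi (-2) * ((1 - q ^ 2 * z) / (1 - q powi (-2) * z))) *\<^sub>m proj r s c pos (ext_wt r)
    + (q powi (- 2 * int r - 1) * ((1 + q ^ (2 * r + 1) * z) / (1 + q powi (- 2 * int r - 1) * z))) *\<^sub>m proj r s c pos (omega 0)"
proof -
  have m: "A + (- t) *\<^sub>m B = A - t *\<^sub>m B" for t and A B :: "complex^('n \<times> 'n)^('n \<times> 'n)"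
    by (simp add: smult_mat_def vec_eq_iff)
  show ?thesis unfolding Rm_proj[OF assms] f2_eq[OF assms] m f0_eq[symmetric] ..
qed

end

text \<open>The first clause identifies the module with the irreducible one of highest weight
  \<omega>_1, and the second keeps the third from being vacuous. The two excluded values of
  \<open>z\<close> are the poles of the formula.\<close>

theorem theorem3p6:
  fixes r :: nat and q s c :: complex and pos :: "'n::finite \<Rightarrow> nat"
  assumes "r \<ge> 2"
    and "q \<noteq> 0" and "\<And>n::nat. n > 0 \<Longrightarrow> q ^ n \<noteq> 1"
    and "s ^ 2 = q" and "c ^ 2 = s + inverse s"
    and "bij_betw pos UNIV {1..2 * r + 1}"
  shows "(\<forall>a. a \<noteq> 0 \<longrightarrow> B_irrep r s (fund_qmod r c pos a) (omega 1) UNIV) \<and>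
    (\<exists>R. normalized_R_matrix r s c pos R) \<and>
    (\<forall>R. normalized_R_matrix r s c pos R \<longrightarrow>
      (\<forall>z. z \<noteq> q ^ 2 \<and> z \<noteq> - (q ^ (2 * r + 1)) \<longrightarrow>
        R z = proj r s c pos (\<lambda>i. 2 * omega 1 i)
          - (q powi (-2) * ((1 - q ^ 2 * z) / (1 - q powi (-2) * z))) *\<^sub>m proj r s c pos (ext_wt r)
          + (q powi (- 2 * int r - 1) *
              ((1 + q ^ (2 * r + 1) * z) / (1 + q powi (- 2 * int r - 1) * z))) *\<^sub>m
            proj r s c pos (omega 0)
        \<and>
        R z = R_sl r q pos z
          + ((q - inverse q) * (1 - z) /
              ((q - inverse q * z) * (s ^ (2 * r + 1) + s powi (- 2 * int r - 1) * z))) *\<^sub>m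
            Q_mat r q s pos z))"
proof -
  interpret A2r_setting r q s c pos
    by unfold_locales (fact assms)+
  have "R z = proj r s c pos (\<lambda>i. 2 * omega 1 i)
          - (q powi (-2) * ((1 - q ^ 2 * z) / (1 - q powi (-2) * z))) *\<^sub>m proj r s c pos (ext_wt r)
          + (q powi (- 2 * int r - 1) *
              ((1 + q ^ (2 * r + 1) * z) / (1 + q powi (- 2 * int r - 1) * z))) *\<^sub>m
            proj r s c pos (omega 0)"
    "R z = R_sl r q pos z
          + ((q - inverse q) * (1 - z) /
              ((q - inverse q * z) * (s ^ (2 * r + 1) + s powi (- 2 * int r - 1) * z))) *\<^sub>m
            Q_mat r q s pos z"
    if "normalized_R_matrix r s c pos R" "good z" for R z
    unfolding normalized_unique[OF that]
    by (rule Rm_spectral[OF that(2)], rule Rm_units[of z, unfolded gz_eq])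
  then show ?thesis using fund_B_irrep Rm_normalized unfolding good_def by blast
qed

end
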